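(* Let $X$ be the Doob process determined by a triple $(\gamma,0,\nu)\in\mathscr{Q}_D$, i.e. $0<|\nu|<\infty$, with semigroup $(P_t)_{t\ge0}$, and let $$\mathbf{C}_{\nu,\gamma}=\Big\{F\in C(\overline{\mathbb{N}}):\ \sum_{k\in\mathbb{N}}(F(\infty)-F(k))\nu_k+\gamma F(\infty)=0\Big\},$$ a Banach space under $\|\cdot\|_\infty$. Then $(P_t)_{t\ge0}$ acts on $\mathbf{C}_{\nu,\gamma}$ as a strongly continuous contractive semigroup, i.e. $$P_tf\in\mathbf{C}_{\nu,\gamma}\ (t\ge0),\qquad \lim_{t\to0}\|P_tf-f\|_\infty=0$$ for all $f\in\mathbf{C}_{\nu,\gamma}$. Furthermore, the infinitesimal generator of $(P_t)_{t\ge0}$ on $\mathbf{C}_{\nu,\gamma}$ is $\mathscr{L}_{\nu,\gamma}F:=QF$ with domain $\mathcal{D}(\mathscr{L}_{\nu,\gamma}):=\{F\in\mathbf{C}_{\nu,\gamma}:\ QF\in\mathbf{C}_{\nu,\gamma}\}$.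
   Context: Setting. $\mathbb{N}=\{0,1,2,\dots\}$. Fix a birth-death matrix $Q=(q_{ij})_{i,j\in\mathbb{N}}$: $q_{k,k-1}=a_k>0$ ($k\ge1$), $q_{k,k+1}=b_k>0$ ($k\ge0$), $q_{kk}=-q_k$ with $q_k=a_k+b_k$ and $a_0:=0$, all other entries $0$. Put $c_0=0$, $c_1=\frac1{2b_0}$, $c_k=\frac1{2b_0}+\sum_{i=2}^k\frac{a_1\cdots a_{i-1}}{2b_0\cdots b_{i-1}}$ ($k\ge2$); $\mu_0=1$, $\mu_k=\frac{b_0\cdots b_{k-1}}{a_1\cdots a_k}$ ($k\ge1$); $R=\sum_{k\ge0}(c_{k+1}-c_k)\sum_{i=0}^k\mu_i$, $S=\sum_{k\ge0}c_k\mu_k$. The point $\infty$ is regular if $R,S<\infty$ and an exit if $R<\infty,S=\infty$. Standing assumption: $\infty$ is regular or an exit. A $Q$-process is a continuous-time Markov chain on $\mathbb{N}$ (possibly non-honest) with standard transition matrix $(p_{ij}(t))$ such that $p'_{ij}(0)=q_{ij}$. The minimal $Q$-process has transition matrix $p^{\min}_{ij}(t)$, the minimal nonnegative solution of the Kolmogorov backward equation; $\Phi^{\min}_{ij}(\alpha)=\int_0^\infty e^{-\alpha t}p^{\min}_{ij}(t)\,dt$ and $u^{\min}_\alpha(i)=1-\alpha\sum_j\Phi^{\min}_{ij}(\alpha)$. $\mathscr{Q}$ is the set of triples $(\gamma,\beta,\nu)$ with $\gamma,\beta\ge0$ constants and $\nu=(\nu_k)_{k\in\mathbb{N}}$ a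 nonnegative measure on $\mathbb{N}$, $|\nu|:=\sum_k\nu_k$, such that $\sum_k\nu_k\big(\sum_{j\ge k}(c_{j+1}-c_j)\sum_{i=0}^j\mu_i\big)<\infty$, $|\nu|+\beta\ne0$, and $\beta=0$ if $\infty$ is an exit. The $Q$-process determined by $(\gamma,\beta,\nu)$ is the one whose resolvent matrix $\Phi_{ij}(\alpha)=\int_0^\infty e^{-\alpha t}p_{ij}(t)\,dt$ is $$\Phi_{ij}(\alpha)=\Phi^{\min}_{ij}(\alpha)+u^{\min}_\alpha(i)\frac{\sum_k\nu_k\Phi^{\min}_{kj}(\alpha)+\beta\mu_ju^{\min}_\alpha(j)}{\gamma+\sum_k\nu_k(1-u^{\min}_\alpha(k))+\beta\alpha\sum_k\mu_ku^{\min}_\alpha(k)}.$$ $\mathscr{Q}_D=\{(\gamma,\beta,\nu)\in\mathscr{Q}:\beta=0,\ 0<|\nu|<\infty\}$; the corresponding $Q$-processes are called Doob processes. Function spaces. $\overline{\mathbb{N}}_\partial=\mathbb{N}\cup\{\infty\}\cup\{\partial\}$ is the compact metric space obtained by identifying $n\in\mathbb{N}$ with $\frac1{n+1}$, $\infty$ with $0$, and the cemetery $\partial$ with $-1$ in $\mathbb{R}$. $C(\overline{\mathbb{N}})$ is the set of continuous real functions $f$ on $\overline{\mathbb{N}}_\partial$ with $f(\partial)=0$; $\|\cdot\|_\infty$ is the sup norm. Semigroup. For $f\in C(\overline{\mathbb{N}})$: $P_tf(i)=\sum_jp_{ij}(t)f(j)$ for $i\in\mathbb{N}$, $P_tf(\partial)=0$,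 and $t\mapsto P_tf(\infty)$ is the right-continuous function on $[0,\infty)$ with $\int_0^\infty e^{-\alpha t}P_tf(\infty)\,dt=\lim_{i\to\infty}\sum_j\Phi_{ij}(\alpha)f(j)$ for all $\alpha>0$ (Ray semigroup). For a Doob process one has $P_0(\infty,\cdot)=\pi$ with $\pi(\{k\})=\frac{\nu_k}{\gamma+|\nu|}$ ($k\in\mathbb{N}$), $\pi(\{\partial\})=\frac{\gamma}{\gamma+|\nu|}$. The operator $Q$. For a function $F$ on $\mathbb{N}$, $QF(k)=a_kF(k-1)-q_kF(k)+b_kF(k+1)$, $k\in\mathbb{N}$, with $F(-1):=0$. A function on $\mathbb{N}$ having a finite limit at infinity is identified with its extension in $C(\overline{\mathbb{N}})$ (value at $\infty$ equal to the limit, value at $\partial$ equal to $0$); "$QF\in\mathbf{C}_{\nu,\gamma}$" is understood in this sense. *)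

theory Defs
  imports "HOL-Analysis.Analysis"
begin

section \<open>Birth-death matrices\<close>

definition birth_death :: "(nat \<Rightarrow> real) \<Rightarrow> (nat \<Rightarrow> real) \<Rightarrow> bool" where
  "birth_death a b \<longleftrightarrow> a 0 = 0 \<and> (\<forall>k\<ge>1. a k > 0) \<and> (\<forall>k. b k > 0)"

definition q_matrix :: "(nat \<Rightarrow> real) \<Rightarrow> (nat \<Rightarrow> real) \<Rightarrow> nat \<Rightarrow> nat \<Rightarrow> real" where
  "q_matrix a b i j =
     (if i = Suc j then a i
      else if j = Suc i then b i
      else if j = i then - (a i + b i)
      else 0)"

definition scale_fun :: "(nat \<Rightarrow> real) \<Rightarrow> (nat \<Rightarrow> real) \<Rightarrow> nat \<Rightarrow> real" where
  "scale_fun a b k =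
     (if k = 0 then 0
      else 1 / (2 * b 0) + (\<Sum>i=2..k. (\<Prod>l=1..i-1. a l) / (2 * (\<Prod>l=0..i-1. b l))))"

definition speed :: "(nat \<Rightarrow> real) \<Rightarrow> (nat \<Rightarrow> real) \<Rightarrow> nat \<Rightarrow> real" where
  "speed a b k = (\<Prod>l<k. b l) / (\<Prod>l=1..k. a l)"

text \<open>The series of nonnegative terms are taken in the extended nonnegative reals, so that
  finiteness and divergence are meaningful.\<close>

definition R_term :: "(nat \<Rightarrow> real) \<Rightarrow> (nat \<Rightarrow> real) \<Rightarrow> nat \<Rightarrow> real" where
  "R_term a b k = (scale_fun a b (Suc k) - scale_fun a b k) * (\<Sum>i\<le>k. speed a b i)"

definition R_series :: "(nat \<Rightarrow> real) \<Rightarrow> (nat \<Rightarrow> real) \<Rightarrow> ennreal" where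
  "R_series a b = (\<Sum>k. ennreal (R_term a b k))"

definition S_series :: "(nat \<Rightarrow> real) \<Rightarrow> (nat \<Rightarrow> real) \<Rightarrow> ennreal" where
  "S_series a b = (\<Sum>k. ennreal (scale_fun a b k * speed a b k))"

definition regular_boundary :: "(nat \<Rightarrow> real) \<Rightarrow> (nat \<Rightarrow> real) \<Rightarrow> bool" where
  "regular_boundary a b \<longleftrightarrow> R_series a b < \<infinity> \<and> S_series a b < \<infinity>"

definition exit_boundary :: "(nat \<Rightarrow> real) \<Rightarrow> (nat \<Rightarrow> real) \<Rightarrow> bool" where
  "exit_boundary a b \<longleftrightarrow> R_series a b < \<infinity> \<and> S_series a b = \<infinity>"


section \<open>Q-processes\<close>

text \<open>A \<open>Q\<close>-process is represented by its transition matrix; \<open>p t i j\<close> stands for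
  \<open>p\<^sub>i\<^sub>j(t)\<close> and only times \<open>t \<ge> 0\<close> matter.  Row sums may be strictly less than one.\<close>

definition standard_transition_matrix :: "(real \<Rightarrow> nat \<Rightarrow> nat \<Rightarrow> real) \<Rightarrow> bool" where
  "standard_transition_matrix p \<longleftrightarrow>
     (\<forall>t\<ge>0. \<forall>i j. p t i j \<ge> 0) \<and>
     (\<forall>t\<ge>0. \<forall>i. summable (p t i) \<and> (\<Sum>j. p t i j) \<le> 1) \<and>
     (\<forall>i j. p 0 i j = of_bool (i = j)) \<and>
     (\<forall>s\<ge>0. \<forall>t\<ge>0. \<forall>i j. (\<lambda>k. p s i k * p t k j) sums p (s + t) i j) \<and>
     (\<forall>i j. ((\<lambda>t. p t i j) \<longlongrightarrow> of_bool (i = j)) (at_right 0))"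

definition Q_process :: "(nat \<Rightarrow> real) \<Rightarrow> (nat \<Rightarrow> real) \<Rightarrow> (real \<Rightarrow> nat \<Rightarrow> nat \<Rightarrow> real) \<Rightarrow> bool" where
  "Q_process a b p \<longleftrightarrow>
     standard_transition_matrix p \<and>
     (\<forall>i j. ((\<lambda>t. p t i j) has_real_derivative q_matrix a b i j) (at 0 within {0..}))"

definition backward_solution ::
  "(nat \<Rightarrow> real) \<Rightarrow> (nat \<Rightarrow> real) \<Rightarrow> (real \<Rightarrow> nat \<Rightarrow> nat \<Rightarrow> real) \<Rightarrow> bool" where
  "backward_solution a b f \<longleftrightarrow>
     (\<forall>t\<ge>0. \<forall>i j. f t i j \<ge> 0) \<and>
     (\<forall>i j. f 0 i j = of_bool (i = j)) \<and>
     (\<forall>t\<ge>0. \<forall>i j.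
        ((\<lambda>s. f s i j) has_real_derivative (\<Sum>k. q_matrix a b i k * f t k j)) (at t within {0..}))"

text \<open>The minimal nonnegative backward solution is the transition matrix of a \<open>Q\<close>-process, called
  the minimal one.  Minimality is among all nonnegative solutions and makes \<open>p t\<close> unique for
  \<open>t \<ge> 0\<close>.\<close>

definition minimal_Q_process ::
  "(nat \<Rightarrow> real) \<Rightarrow> (nat \<Rightarrow> real) \<Rightarrow> (real \<Rightarrow> nat \<Rightarrow> nat \<Rightarrow> real) \<Rightarrow> bool" where
  "minimal_Q_process a b p \<longleftrightarrow>
     Q_process a b p \<and> backward_solution a b p \<and>
     (\<forall>f. backward_solution a b f \<longrightarrow> (\<forall>t\<ge>0. \<forall>i j. p t i j \<le> f t i j))"

definition resolvent :: "(real \<Rightarrow> nat \<Rightarrow> nat \<Rightarrow> real) \<Rightarrow> real \<Rightarrow> nat \<Rightarrow> nat \<Rightarrow> real" where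
  "resolvent p \<alpha> i j = (LBINT t:{0..}. exp (- \<alpha> * t) * p t i j)"

definition u_fun :: "(real \<Rightarrow> nat \<Rightarrow> nat \<Rightarrow> real) \<Rightarrow> real \<Rightarrow> nat \<Rightarrow> real" where
  "u_fun pmin \<alpha> i = 1 - \<alpha> * (\<Sum>j. resolvent pmin \<alpha> i j)"


section \<open>The parametrization of Q-processes by triples\<close>

definition total_mass :: "(nat \<Rightarrow> real) \<Rightarrow> ennreal" where
  "total_mass \<nu> = (\<Sum>k. ennreal (\<nu> k))"

text \<open>The inner sum over \<open>j \<ge> k\<close> is written with the shifted index \<open>k + j\<close>.\<close>

definition Q_triples :: "(nat \<Rightarrow> real) \<Rightarrow> (nat \<Rightarrow> real) \<Rightarrow> (real \<times> real \<times> (nat \<Rightarrow> real)) set" where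
  "Q_triples a b = {(\<gamma>, \<beta>, \<nu>).
     \<gamma> \<ge> 0 \<and> \<beta> \<ge> 0 \<and> (\<forall>k. \<nu> k \<ge> 0) \<and>
     (\<Sum>k. ennreal (\<nu> k) * (\<Sum>j. ennreal (R_term a b (k + j)))) < \<infinity> \<and>
     total_mass \<nu> + ennreal \<beta> \<noteq> 0 \<and>
     (exit_boundary a b \<longrightarrow> \<beta> = 0)}"

definition Doob_triples :: "(nat \<Rightarrow> real) \<Rightarrow> (nat \<Rightarrow> real) \<Rightarrow> (real \<times> real \<times> (nat \<Rightarrow> real)) set" where
  "Doob_triples a b =
     {(\<gamma>, \<beta>, \<nu>) \<in> Q_triples a b. \<beta> = 0 \<and> 0 < total_mass \<nu> \<and> total_mass \<nu> < \<infinity>}"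

definition determined_by ::
  "(nat \<Rightarrow> real) \<Rightarrow> (nat \<Rightarrow> real) \<Rightarrow> (real \<Rightarrow> nat \<Rightarrow> nat \<Rightarrow> real) \<Rightarrow> real \<times> real \<times> (nat \<Rightarrow> real) \<Rightarrow>
   (real \<Rightarrow> nat \<Rightarrow> nat \<Rightarrow> real) \<Rightarrow> bool" where
  "determined_by a b pmin = (\<lambda>(\<gamma>, \<beta>, \<nu>) p.
     Q_process a b p \<and>
     (\<forall>\<alpha>>0. \<forall>i j.
        resolvent p \<alpha> i j =
          resolvent pmin \<alpha> i j +
          u_fun pmin \<alpha> i *
            (((\<Sum>k. \<nu> k * resolvent pmin \<alpha> k j) + \<beta> * speed a b j * u_fun pmin \<alpha> j) /
             (\<gamma> + (\<Sum>k. \<nu> k * (1 - u_fun pmin \<alpha> k))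
                + \<beta> * \<alpha> * (\<Sum>k. speed a b k * u_fun pmin \<alpha> k)))))"


section \<open>The compactified state space and its continuous functions\<close>

datatype state = Fin nat | Infty | Cemetery

primrec coord :: "state \<Rightarrow> real" where
  "coord (Fin n) = 1 / (real n + 1)"
| "coord Infty = 0"
| "coord Cemetery = -1"

lemma coord_Fin_pos: "coord (Fin n) > 0"
  by simp

lemma inj_coord: "inj coord"
proof (rule injI)
  fix x y assume eq: "coord x = coord y"
  show "x = y"
  proof (cases x)
    case (Fin n)
    then have "coord y > 0" using eq coord_Fin_pos[of n] by simp
    then obtain m where "y = Fin m" by (cases y) auto
    then show ?thesis using eq Fin by simp
  next
    case Infty
    then have "coord y = 0" using eq by simp
    then have "y = Infty" by (cases y) auto
    then show ?thesis using Infty by simp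
  next
    case Cemetery
    then have "coord y < 0" using eq by simp
    then have "y = Cemetery" using coord_Fin_pos by (cases y) (auto dest: less_asym simp del: coord.simps(1))
    then show ?thesis using Cemetery by simp
  qed
qed

instantiation state :: metric_space
begin

definition dist_state :: "state \<Rightarrow> state \<Rightarrow> real" where
  "dist_state x y = \<bar>coord x - coord y\<bar>"

definition uniformity_state :: "(state \<times> state) filter" where
  "uniformity_state = (INF e\<in>{0<..}. principal {(x, y). dist x y < e})"

definition open_state :: "state set \<Rightarrow> bool" where
  "open_state U \<longleftrightarrow> (\<forall>x\<in>U. eventually (\<lambda>(x', y). x' = x \<longrightarrow> y \<in> U) uniformity)"

instance
proof
  fix x y z :: state
  show "dist x y = 0 \<longleftrightarrow> x = y"
    using inj_coord by (auto simp: dist_state_def dest: injD)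
  show "dist x y \<le> dist x z + dist y z"
    by (simp add: dist_state_def)
qed (simp_all add: uniformity_state_def open_state_def)

end

text \<open>Since the state space is compact (\<open>compact_state\<close>), \<open>state \<Rightarrow>\<^sub>C real\<close> is the space of all
  continuous functions on it and its norm is the supremum norm.\<close>

lemma Fin_tendsto_Infty: "Fin \<longlonglongrightarrow> Infty"
proof -
  have "(\<lambda>n. 1 / (real n + 1)) \<longlonglongrightarrow> 0"
    using LIMSEQ_inverse_real_of_nat by (simp add: inverse_eq_divide add.commute)
  then show ?thesis
    by (subst tendsto_dist_iff) (simp add: dist_state_def)
qed

lemma open_state_singleton:
  assumes "x \<noteq> Infty"
  shows "open {x}"
proof -
  have cont: "continuous_on UNIV coord"
    unfolding continuous_on_iff by (auto simp: dist_state_def dist_real_def)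
  have *: "open (coord -` S)" if "open S" for S
    using open_vimage[OF that cont] .
  show ?thesis
  proof (cases x)
    case (Fin n)
    let ?S = "{1 / (real n + 3/2) <..< 1 / (real n + 1/2)}"
    have "y = Fin n" if y: "coord y \<in> ?S" for y
    proof -
      have "0 < 1 / (real n + 3/2)" by simp
      with y have "coord y > 0" by (meson greaterThanLessThan_iff less_trans)
      then obtain m where m: "y = Fin m" by (cases y) auto
      have "1 / (real m + 1) < 1 / (real n + 1/2)" "1 / (real n + 3/2) < 1 / (real m + 1)"
        using y m by simp_all
      then have "inverse (real m + 1) < inverse (real n + 1/2)"
        "inverse (real n + 3/2) < inverse (real m + 1)"
        by (simp_all only: inverse_eq_divide)
      then have "real n + 1/2 < real m + 1" "real m + 1 < real n + 3/2"
        by (auto intro: inverse_less_imp_less)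
      then show ?thesis using m by simp
    qed
    moreover have "coord (Fin n) \<in> ?S"
      by (simp add: divide_strict_left_mono)
    ultimately have "coord -` ?S = {x}" using Fin by auto
    then show ?thesis using *[of ?S] by simp
  next
    case Cemetery
    have "y = Cemetery" if y: "coord y < - (1/2)" for y
    proof (cases y)
      case (Fin m)
      then have "coord y > 0" by simp
      then show ?thesis using y by linarith
    qed (use y in simp_all)
    then have "coord -` {..< - (1/2)} = {x}" using Cemetery by auto
    then show ?thesis using *[of "{..< - (1/2)}"] by simp
  qed (use assms in simp)
qed

lemma compact_state: "compact (UNIV :: state set)"
proof (rule compactI)
  fix C :: "state set set"
  assume op: "\<forall>t\<in>C. open t" and cov: "UNIV \<subseteq> \<Union>C"
  from cov obtain U where U: "U \<in> C" "Infty \<in> U" by blast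
  have "eventually (\<lambda>n. Fin n \<in> U) sequentially"
    using topological_tendstoD[OF Fin_tendsto_Infty] op U by blast
  then obtain N where N: "\<And>n. n \<ge> N \<Longrightarrow> Fin n \<in> U"
    by (auto simp: eventually_sequentially)
  have "\<forall>x. \<exists>V\<in>C. x \<in> V" using cov by blast
  then obtain V where V: "\<And>x. V x \<in> C" "\<And>x. x \<in> V x" by metis
  let ?D = "insert U (insert (V Cemetery) ((\<lambda>n. V (Fin n)) ` {..<N}))"
  have "x \<in> \<Union>?D" for x
  proof (cases x)
    case (Fin n)
    then show ?thesis using V(2)[of "Fin n"] N[of n] by (cases "n < N") auto
  qed (use U V(2)[of Cemetery] in auto)
  then show "\<exists>D\<subseteq>C. finite D \<and> UNIV \<subseteq> \<Union>D"
    using U V by (intro exI[of _ ?D]) auto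
qed

definition C_bar :: "(state \<Rightarrow>\<^sub>C real) set" where
  "C_bar = {F :: state \<Rightarrow>\<^sub>C real. F Cemetery = 0}"

definition C_nu_gamma :: "(nat \<Rightarrow> real) \<Rightarrow> real \<Rightarrow> (state \<Rightarrow>\<^sub>C real) set" where
  "C_nu_gamma \<nu> \<gamma> = {F \<in> C_bar.
     (\<Sum>k. (F Infty - F (Fin k)) * \<nu> k) + \<gamma> * F Infty = 0}"

definition extend_state :: "(nat \<Rightarrow> real) \<Rightarrow> state \<Rightarrow> real" where
  "extend_state h x = (case x of Fin k \<Rightarrow> h k | Infty \<Rightarrow> lim h | Cemetery \<Rightarrow> 0)"

lemma extend_state_bcontfun:
  assumes "convergent h"
  shows "extend_state h \<in> bcontfun"
proof -
  have lim: "h \<longlonglongrightarrow> lim h" using assms by (simp add: convergent_LIMSEQ_iff)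
  have "isCont (extend_state h) x" for x
  proof (cases "x = Infty")
    case False
    then have "at x = bot" using open_state_singleton by (metis at_eq_bot_iff)
    then show ?thesis by (simp add: continuous_def)
  next
    case True
    have "\<exists>d>0. \<forall>y. dist y Infty < d \<longrightarrow> dist (extend_state h y) (extend_state h Infty) < e" if "e > 0" for e
    proof -
      obtain N where N: "\<And>n. n \<ge> N \<Longrightarrow> dist (h n) (lim h) < e"
        using lim \<open>e > 0\<close> unfolding lim_sequentially by blast
      have "dist (extend_state h y) (extend_state h Infty) < e" if y: "dist y Infty < 1 / (real N + 1)" for y
      proof (cases y)
        case (Fin n)
        then have "1 / (real n + 1) < 1 / (real N + 1)" using y by (simp add: dist_state_def)
        then have "n \<ge> N" by (simp add: field_simps)
        then show ?thesis using N Fin by (simp add: extend_state_def)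
      next
        case Cemetery
        then show ?thesis using y by (simp add: dist_state_def field_simps)
      qed (use \<open>e > 0\<close> in simp)
      then show ?thesis by (intro exI[of _ "1 / (real N + 1)"]) auto
    qed
    then show ?thesis using True by (simp add: continuous_at_eps_delta)
  qed
  then have c: "continuous_on UNIV (extend_state h)" by (simp add: continuous_at_imp_continuous_on)
  then have "bounded (range (extend_state h))"
    using compact_continuous_image[OF c compact_state] compact_imp_bounded by blast
  with c show ?thesis by (simp add: bcontfun_def)
qed

definition Q_operator :: "(nat \<Rightarrow> real) \<Rightarrow> (nat \<Rightarrow> real) \<Rightarrow> (nat \<Rightarrow> real) \<Rightarrow> nat \<Rightarrow> real" where
  "Q_operator a b F k =
     a k * (if k = 0 then 0 else F (k - 1)) - (a k + b k) * F k + b k * F (k + 1)"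

definition L_op :: "(nat \<Rightarrow> real) \<Rightarrow> (nat \<Rightarrow> real) \<Rightarrow> (state \<Rightarrow>\<^sub>C real) \<Rightarrow> (state \<Rightarrow>\<^sub>C real)" where
  "L_op a b F = Bcontfun (extend_state (Q_operator a b (\<lambda>k. F (Fin k))))"

text \<open>By \<open>extend_state_bcontfun\<close>, \<open>L_op a b F\<close> is the continuous extension of \<open>QF\<close> whenever
  \<open>QF\<close> has a finite limit at infinity; otherwise it is a junk value, excluded from the domain.\<close>

definition L_domain ::
  "(nat \<Rightarrow> real) \<Rightarrow> (nat \<Rightarrow> real) \<Rightarrow> (nat \<Rightarrow> real) \<Rightarrow> real \<Rightarrow> (state \<Rightarrow>\<^sub>C real) set" where
  "L_domain a b \<nu> \<gamma> =
     {F \<in> C_nu_gamma \<nu> \<gamma>.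
        convergent (Q_operator a b (\<lambda>k. F (Fin k))) \<and>
        L_op a b F \<in> C_nu_gamma \<nu> \<gamma>}"


section \<open>Semigroups\<close>

text \<open>\<open>P t f\<close> is a plain function on the state space because it need not be continuous
  (for a Doob process \<open>P 0 f Infty\<close> is in general different from \<open>f Infty\<close>).  The Laplace transform
  and right-continuity determine \<open>P t f Infty\<close> uniquely for \<open>t \<ge> 0\<close>.\<close>

definition Ray_semigroup ::
  "(real \<Rightarrow> nat \<Rightarrow> nat \<Rightarrow> real) \<Rightarrow> (real \<Rightarrow> (state \<Rightarrow>\<^sub>C real) \<Rightarrow> state \<Rightarrow> real) \<Rightarrow> bool" where
  "Ray_semigroup p P \<longleftrightarrow> (\<forall>f\<in>C_bar.
     (\<forall>t\<ge>0. \<forall>i. P t f (Fin i) = (\<Sum>j. p t i j * f (Fin j))) \<and>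
     (\<forall>t\<ge>0. P t f Cemetery = 0) \<and>
     (\<forall>t\<ge>0. continuous (at_right t) (\<lambda>s. P s f Infty)) \<and>
     (\<forall>\<alpha>>0.
        set_integrable lborel {0..} (\<lambda>t. exp (- \<alpha> * t) * P t f Infty) \<and>
        (\<lambda>i. \<Sum>j. resolvent p \<alpha> i j * f (Fin j))
          \<longlonglongrightarrow> (LBINT t:{0..}. exp (- \<alpha> * t) * P t f Infty)))"

definition strongly_continuous_contraction_semigroup ::
  "'a::real_normed_vector set \<Rightarrow> (real \<Rightarrow> 'a \<Rightarrow> 'a) \<Rightarrow> bool" where
  "strongly_continuous_contraction_semigroup X T \<longleftrightarrow>
     (\<forall>t\<ge>0. \<forall>x\<in>X. T t x \<in> X) \<and>
     (\<forall>t\<ge>0. \<forall>x\<in>X. \<forall>y\<in>X. T t (x + y) = T t x + T t y) \<and>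
     (\<forall>t\<ge>0. \<forall>c. \<forall>x\<in>X. T t (c *\<^sub>R x) = c *\<^sub>R T t x) \<and>
     (\<forall>x\<in>X. T 0 x = x) \<and>
     (\<forall>s\<ge>0. \<forall>t\<ge>0. \<forall>x\<in>X. T (s + t) x = T s (T t x)) \<and>
     (\<forall>t\<ge>0. \<forall>x\<in>X. norm (T t x) \<le> norm x) \<and>
     (\<forall>x\<in>X. ((\<lambda>t. norm (T t x - x)) \<longlongrightarrow> 0) (at_right 0))"

definition infinitesimal_generator ::
  "'a::real_normed_vector set \<Rightarrow> (real \<Rightarrow> 'a \<Rightarrow> 'a) \<Rightarrow> 'a set \<Rightarrow> ('a \<Rightarrow> 'a) \<Rightarrow> bool" where
  "infinitesimal_generator X T D A \<longleftrightarrow>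
     D = {x \<in> X. \<exists>y\<in>X. ((\<lambda>t. (1 / t) *\<^sub>R (T t x - x)) \<longlongrightarrow> y) (at_right 0)} \<and>
     (\<forall>x\<in>D. ((\<lambda>t. (1 / t) *\<^sub>R (T t x - x)) \<longlongrightarrow> A x) (at_right 0))"

end

(*
  The resolvent of the Doob process maps bounded functions to functions h with a limit h(\<infinity>)
  satisfying the boundary condition (\<gamma> + |\<nu>|) h(\<infinity>) = \<Sum> \<nu>(k) h(k): the minimal resolvent
  vanishes at infinity, because it is dominated by the tails of the series R (obtained from Picard
  iteration), and hence u tends to 1.  A function with Q h = h and this boundary condition is zero,
  as it would otherwise be strictly monotone.  Therefore eventually constant functions satisfying the
  boundary condition, which are dense in C(\<nu>, \<gamma>), lie in the range of the resolvent, and this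
  gives strong continuity.  Weierstrass approximation transfers limit and boundary condition from
  the Laplace transforms to the semigroup at each fixed time.  Finally, the rows of Q sum to zero, so
  that the pointwise derivative at time 0 of P(t) F is Q F for every bounded F, which identifies the
  generator.
*)

theory Submission
  imports Defs
begin

text \<open>Nothing is known beforehand about the point at infinity except a Laplace transform and
  right-continuity, so all estimates are made for functions on the states in N, through
  \<open>trans_op\<close> and \<open>res_op\<close>. Strong continuity is needed there before
  invariance of the space: it holds uniformly in the starting state, and this uniformity is the
  equicontinuity in time without which convergence of Laplace transforms would say nothing about a
  fixed time. Two sequences are then compared with the value at infinity, the values P(t) F(n) and
  the partial sums of the normalised \<nu>-average of P(t) F; sharing their limit, they yield the
  boundary condition.

  No Hille-Yosida theorem is invoked. Every F in the domain equals the resolvent at parameter 1 of F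
  - Q F, and for such F an explicit remainder bound controls P(t) F - F - t Q F. The same bound
  serves three times: pointwise, to show that Q acts on resolvents as expected; with a crude
  modulus, for strong continuity; with a uniform modulus, for the generator.\<close>

section \<open>Interchange of sums, and Laplace transforms of bounded functions\<close>

text \<open>Tannery's theorem, applied to the partial sums over j. The dominating sequence bounds
  these partial sums, which is the form in which bounds for transition probabilities and resolvents
  arise later.\<close>

lemma sums_swap:
  fixes x :: "nat \<Rightarrow> nat \<Rightarrow> real"
  assumes x: "\<And>k. x k sums y k"
    and w: "\<And>k J. \<bar>\<Sum>j<J. x k j\<bar> \<le> w k" and "summable w"
  shows "(\<lambda>j. \<Sum>k. x k j) sums (\<Sum>k. y k)"
proof -
  have sx: "summable (\<lambda>k. x k j)" for j
  proof (rule summable_comparison_test'[where N = 0 and g = "\<lambda>k. 2 * w k"])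
    show "summable (\<lambda>k. 2 * w k)" using \<open>summable w\<close> by (rule summable_mult)
    show "norm (x k j) \<le> 2 * w k" for k
      using w[of k j] w[of k "Suc j"] by simp
  qed
  have *: "eventually (\<lambda>n. summable (\<lambda>k. norm (\<Sum>j<n. x k j))) sequentially \<and>
      summable (\<lambda>k. norm (y k)) \<and> (\<lambda>n. \<Sum>k. \<Sum>j<n. x k j) \<longlonglongrightarrow> suminf y"
    by (rule tannerys_theorem[where M = w])
      (use x w \<open>summable w\<close> in \<open>auto simp: sums_def intro!: always_eventually\<close>)
  have "(\<Sum>k. \<Sum>j<n. x k j) = (\<Sum>j<n. \<Sum>k. x k j)" for n
    by (rule suminf_sum) (rule sx)
  with * show "(\<lambda>j. \<Sum>k. x k j) sums (\<Sum>k. y k)" by (simp add: sums_def)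
qed

lemma set_integrable_exp_minus:
  fixes \<alpha> :: real
  assumes "\<alpha> > 0"
  shows "set_integrable lborel {0..} (\<lambda>t. exp (- \<alpha> * t))"
    and "(LBINT t:{0..}. exp (- \<alpha> * t)) = 1 / \<alpha>"
proof -
  have hi: "((\<lambda>t. exp (- \<alpha> * t)) has_integral 1 / \<alpha>) {0..}"
    using has_integral_exp_minus_to_infinity[OF assms, of 0] by simp
  then have "(\<lambda>t. exp (- \<alpha> * t)) absolutely_integrable_on {0..}"
    by (intro nonnegative_absolutely_integrable_1) auto
  moreover have "(\<lambda>t. indicat_real {0..} t *\<^sub>R exp (- \<alpha> * t)) \<in> borel_measurable lborel"
    by measurable
  ultimately show si: "set_integrable lborel {0..} (\<lambda>t. exp (- \<alpha> * t))"
    unfolding set_integrable_def by (simp add: integrable_completion)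
  show "(LBINT t:{0..}. exp (- \<alpha> * t)) = 1 / \<alpha>"
    using set_borel_integral_eq_integral(2)[OF si] hi by (simp add: integral_unique)
qed

definition laplace :: "(real \<Rightarrow> real) \<Rightarrow> real \<Rightarrow> real" where
  "laplace \<phi> \<alpha> = (LBINT t:{0..}. exp (- \<alpha> * t) * \<phi> t)"

lemma laplace_integrable_bounded:
  fixes \<phi> :: "real \<Rightarrow> real"
  assumes "\<alpha> > 0" "set_borel_measurable borel {0..} \<phi>" "\<And>t. t \<ge> 0 \<Longrightarrow> \<bar>\<phi> t\<bar> \<le> C"
  shows "set_integrable lborel {0..} (\<lambda>t. exp (- \<alpha> * t) * \<phi> t)"
proof (rule set_integrable_bound)
  show "set_integrable lborel {0..} (\<lambda>t. C * exp (- \<alpha> * t))"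
    using set_integrable_exp_minus(1)[OF assms(1)] by simp
  have "(\<lambda>x. exp (- \<alpha> * x) * (indicator {0..} x *\<^sub>R \<phi> x)) \<in> borel_measurable borel"
    using assms(2) unfolding set_borel_measurable_def by measurable
  then show "set_borel_measurable lborel {0..} (\<lambda>t. exp (- \<alpha> * t) * \<phi> t)"
    unfolding set_borel_measurable_def by (simp add: mult_ac)
  show "AE x in lborel. x \<in> {0..} \<longrightarrow>
      norm (exp (- \<alpha> * x) * \<phi> x) \<le> norm (C * exp (- \<alpha> * x))"
  proof (intro AE_I2 impI)
    fix x :: real assume "x \<in> {0..}"
    then have "\<bar>\<phi> x\<bar> \<le> \<bar>C\<bar>" using assms(3)[of x] by simp
    then show "norm (exp (- \<alpha> * x) * \<phi> x) \<le> norm (C * exp (- \<alpha> * x))"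
      by (simp add: abs_mult mult.commute mult_left_mono)
  qed
qed

lemma set_integral_abs_le:
  fixes f g :: "real \<Rightarrow> real"
  assumes "set_integrable lborel A f" "set_integrable lborel A g" "\<And>t. t \<in> A \<Longrightarrow> \<bar>f t\<bar> \<le> g t"
  shows "\<bar>LBINT t:A. f t\<bar> \<le> (LBINT t:A. g t)"
proof -
  have "(LBINT t:A. f t) \<le> (LBINT t:A. g t)"
    by (rule set_integral_mono) (use assms abs_le_D1 in auto)
  moreover have "(LBINT t:A. - f t) \<le> (LBINT t:A. g t)"
    using assms abs_le_D2 by (intro set_integral_mono) (auto simp: set_integrable_def)
  ultimately show ?thesis using set_integral_uminus[OF assms(1)] by linarith
qed

lemma laplace_abs_le:
  assumes "\<alpha> > 0" "set_borel_measurable borel {0..} \<phi>" "\<And>t. t \<ge> 0 \<Longrightarrow> \<bar>\<phi> t\<bar> \<le> C"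
  shows "\<bar>laplace \<phi> \<alpha>\<bar> \<le> C / \<alpha>"
proof -
  have "\<bar>laplace \<phi> \<alpha>\<bar> \<le> (LBINT t:{0..}. C * exp (- \<alpha> * t))"
    unfolding laplace_def
  proof (rule set_integral_abs_le)
    show "set_integrable lborel {0..} (\<lambda>t. exp (- \<alpha> * t) * \<phi> t)"
      by (rule laplace_integrable_bounded) fact+
    show "set_integrable lborel {0..} (\<lambda>t. C * exp (- \<alpha> * t))"
      using set_integrable_exp_minus(1)[OF assms(1)] by simp
    show "\<bar>exp (- \<alpha> * t) * \<phi> t\<bar> \<le> C * exp (- \<alpha> * t)" if "t \<in> {0..}" for t
      using assms(3)[of t] that by (simp add: abs_mult mult.commute mult_left_mono)
  qed
  then show ?thesis using set_integrable_exp_minus(2)[OF assms(1)] by simp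
qed

lemma set_borel_measurable_limit:
  fixes u :: "nat \<Rightarrow> real \<Rightarrow> real"
  assumes "\<And>n. set_borel_measurable borel A (u n)" "\<And>t. t \<in> A \<Longrightarrow> (\<lambda>n. u n t) \<longlonglongrightarrow> v t"
  shows "set_borel_measurable borel A v"
  unfolding set_borel_measurable_def
proof (rule borel_measurable_LIMSEQ_metric)
  show "(\<lambda>x. indicator A x *\<^sub>R u n x) \<in> borel_measurable borel" for n
    using assms(1) by (simp add: set_borel_measurable_def)
  show "(\<lambda>n. indicator A x *\<^sub>R u n x) \<longlonglongrightarrow> indicator A x *\<^sub>R v x" for x
    by (cases "x \<in> A") (auto intro: assms(2))
qed

lemma laplace_tendsto_bounded:
  fixes u :: "nat \<Rightarrow> real \<Rightarrow> real"
  assumes "\<alpha> > 0" and meas: "\<And>n. set_borel_measurable borel {0..} (u n)"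
    and lim: "\<And>t. t \<ge> 0 \<Longrightarrow> (\<lambda>n. u n t) \<longlonglongrightarrow> v t"
    and bound: "\<And>n t. t \<ge> 0 \<Longrightarrow> \<bar>u n t\<bar> \<le> C"
  shows "(\<lambda>n. laplace (u n) \<alpha>) \<longlonglongrightarrow> laplace v \<alpha>"
  unfolding laplace_def set_lebesgue_integral_def
proof (rule integral_dominated_convergence[where w = "\<lambda>t. indicator {0..} t *\<^sub>R (C * exp (- \<alpha> * t))"])
  have mv: "set_borel_measurable borel {0..} v"
    by (rule set_borel_measurable_limit) (use meas lim in auto)
  have vb: "\<bar>v t\<bar> \<le> C" if "t \<ge> 0" for t
    by (rule tendsto_upperbound[OF tendsto_rabs[OF lim[OF that]]]) (use bound that in auto)
  show "(\<lambda>x. indicat_real {0..} x *\<^sub>R (exp (- \<alpha> * x) * v x)) \<in> borel_measurable lborel"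
    using laplace_integrable_bounded[OF assms(1) mv vb] by (simp add: set_integrable_def)
  show "(\<lambda>x. indicat_real {0..} x *\<^sub>R (exp (- \<alpha> * x) * u n x)) \<in> borel_measurable lborel" for n
    using laplace_integrable_bounded[OF assms(1) meas bound] by (simp add: set_integrable_def)
  have "set_integrable lborel {0..} (\<lambda>t. C * exp (- \<alpha> * t))"
    using set_integrable_exp_minus(1)[OF assms(1)] by simp
  then show "integrable lborel (\<lambda>t. indicat_real {0..} t *\<^sub>R (C * exp (- \<alpha> * t)))"
    by (simp add: set_integrable_def)
  show "AE x in lborel. (\<lambda>n. indicat_real {0..} x *\<^sub>R (exp (- \<alpha> * x) * u n x))
      \<longlonglongrightarrow> indicat_real {0..} x *\<^sub>R (exp (- \<alpha> * x) * v x)"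
    by (intro AE_I2) (auto simp: indicator_def intro!: tendsto_mult_left lim)
  show "AE x in lborel. norm (indicat_real {0..} x *\<^sub>R (exp (- \<alpha> * x) * u n x))
      \<le> indicat_real {0..} x *\<^sub>R (C * exp (- \<alpha> * x))" for n
    using bound by (intro AE_I2)
      (auto simp: indicator_def abs_mult mult.commute intro!: mult_left_mono)
qed

lemma set_borel_measurable_sum:
  assumes "\<And>j. j \<in> I \<Longrightarrow> set_borel_measurable borel A (h j)"
  shows "set_borel_measurable borel A (\<lambda>t. \<Sum>j\<in>I. h j t :: real)"
  using assms unfolding set_borel_measurable_def by (simp add: sum_distrib_left)

lemma laplace_sum:
  assumes "\<And>j. j \<in> I \<Longrightarrow> set_integrable lborel {0..} (\<lambda>t. exp (- \<alpha> * t) * h j t)"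
  shows "laplace (\<lambda>t. \<Sum>j\<in>I. h j t) \<alpha> = (\<Sum>j\<in>I. laplace (h j) \<alpha>)"
  using assms unfolding laplace_def set_integrable_def set_lebesgue_integral_def
  by (simp add: sum_distrib_left Bochner_Integration.integral_sum)

text \<open>Dominated convergence for the partial sums: the factor exp (- \<alpha> t) makes their
  uniform bound C an integrable majorant.\<close>

lemma laplace_sums:
  fixes h :: "nat \<Rightarrow> real \<Rightarrow> real"
  assumes "\<alpha> > 0" and meas: "\<And>j. set_borel_measurable borel {0..} (h j)"
    and sums: "\<And>t. t \<ge> 0 \<Longrightarrow> (\<lambda>j. h j t) sums H t"
    and bound: "\<And>J t. t \<ge> 0 \<Longrightarrow> \<bar>\<Sum>j<J. h j t\<bar> \<le> C"
  shows "(\<lambda>j. laplace (h j) \<alpha>) sums laplace H \<alpha>"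
proof -
  have hb: "\<bar>h j t\<bar> \<le> 2 * C" if "t \<ge> 0" for j t
    using bound[OF that, of j] bound[OF that, of "Suc j"] by simp
  have "(\<lambda>J. laplace (\<lambda>t. \<Sum>j<J. h j t) \<alpha>) \<longlonglongrightarrow> laplace H \<alpha>"
    by (rule laplace_tendsto_bounded)
      (use assms in \<open>auto simp: sums_def intro!: set_borel_measurable_sum\<close>)
  moreover have "laplace (\<lambda>t. \<Sum>j<J. h j t) \<alpha> = (\<Sum>j<J. laplace (h j) \<alpha>)" for J
    by (intro laplace_sum laplace_integrable_bounded[OF assms(1) meas hb]) auto
  ultimately show ?thesis by (simp add: sums_def)
qed

lemma laplace_cmult: "laplace (\<lambda>t. c * \<phi> t) \<alpha> = c * laplace \<phi> \<alpha>"
  unfolding laplace_def by (simp add: mult.left_commute)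

text \<open>Splitting the half-line at t and translating the right part. This computes P(t) on a
  resolvent image and also cuts the minimal resolvent off at a finite time.\<close>

lemma laplace_shift:
  assumes t: "t \<ge> 0" and int: "set_integrable lborel {0..} (\<lambda>s. exp (- \<alpha> * s) * \<phi> s)"
  shows "laplace (\<lambda>s. \<phi> (t + s)) \<alpha> =
    exp (\<alpha> * t) * (laplace \<phi> \<alpha> - (LBINT s:{0..t}. exp (- \<alpha> * s) * \<phi> s))"
proof -
  let ?g = "\<lambda>s. exp (- \<alpha> * s) * \<phi> s"
  have "laplace \<phi> \<alpha> = (LBINT s:{0..t} \<union> {t<..}. ?g s)"
    using t unfolding laplace_def by (simp add: ivl_disj_un)
  also have "\<dots> = (LBINT s:{0..t}. ?g s) + (LBINT s:{t<..}. ?g s)"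
    by (intro set_integral_Un set_integrable_subset[OF int]) (use t in auto)
  also have "(LBINT s:{t<..}. ?g s) = (LBINT s:{t..}. ?g s)"
    by (rule set_integral_discrete_difference[where X = "{t}"]) auto
  also have "\<dots> = (\<integral>s. indicator {t..} (t + 1 * s) *\<^sub>R ?g (t + 1 * s) \<partial>lborel)"
    unfolding set_lebesgue_integral_def using lborel_integral_real_affine[of 1 _ t] by simp
  also have "\<dots> = (\<integral>s. exp (- \<alpha> * t) * (indicator {0..} s *\<^sub>R (exp (- \<alpha> * s) * \<phi> (t + s))) \<partial>lborel)"
    by (intro Bochner_Integration.integral_cong) (auto simp: indicator_def exp_add[symmetric] algebra_simps)
  also have "\<dots> = exp (- \<alpha> * t) * laplace (\<lambda>s. \<phi> (t + s)) \<alpha>"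
    by (simp add: laplace_def set_lebesgue_integral_def)
  finally have "exp (\<alpha> * t) * (laplace \<phi> \<alpha> - (LBINT s:{0..t}. ?g s)) =
      (exp (\<alpha> * t) * exp (- \<alpha> * t)) * laplace (\<lambda>s. \<phi> (t + s)) \<alpha>"
    by simp
  also have "exp (\<alpha> * t) * exp (- \<alpha> * t) = 1" by (simp add: exp_add[symmetric])
  finally show ?thesis by simp
qed

section \<open>Transition operators and their resolvents\<close>

definition trans_op :: "(real \<Rightarrow> nat \<Rightarrow> nat \<Rightarrow> real) \<Rightarrow> real \<Rightarrow> (nat \<Rightarrow> real) \<Rightarrow> nat \<Rightarrow> real" where
  "trans_op p t f i = (\<Sum>j. p t i j * f j)"

text \<open>Defined through the semigroup, so that the semigroup law can act under the integral;
  \<open>res_op_sums\<close> identifies it with summation against \<open>resolvent\<close> for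
  bounded functions.\<close>

definition res_op :: "(real \<Rightarrow> nat \<Rightarrow> nat \<Rightarrow> real) \<Rightarrow> real \<Rightarrow> (nat \<Rightarrow> real) \<Rightarrow> nat \<Rightarrow> real" where
  "res_op p \<alpha> f i = laplace (\<lambda>t. trans_op p t f i) \<alpha>"

locale transition =
  fixes p :: "real \<Rightarrow> nat \<Rightarrow> nat \<Rightarrow> real"
  assumes std: "standard_transition_matrix p"
begin

lemma p_nonneg: "t \<ge> 0 \<Longrightarrow> p t i j \<ge> 0"
  and p_summable: "t \<ge> 0 \<Longrightarrow> summable (p t i)"
  and p_suminf_le: "t \<ge> 0 \<Longrightarrow> (\<Sum>j. p t i j) \<le> 1"
  and p_zero: "p 0 i j = of_bool (i = j)"
  and chapman_kolmogorov: "s \<ge> 0 \<Longrightarrow> t \<ge> 0 \<Longrightarrow> (\<lambda>k. p s i k * p t k j) sums p (s + t) i j"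
  and p_tendsto: "((\<lambda>t. p t i j) \<longlongrightarrow> of_bool (i = j)) (at_right 0)"
  using std unfolding standard_transition_matrix_def by blast+

lemma p_sum_le:
  assumes "t \<ge> 0" "finite A"
  shows "(\<Sum>j\<in>A. p t i j) \<le> 1"
  using sum_le_suminf[OF p_summable[OF assms(1)] assms(2), of i] p_nonneg[OF assms(1)]
    p_suminf_le[OF assms(1), of i] by force

lemma p_le_one: "t \<ge> 0 \<Longrightarrow> p t i j \<le> 1"
  using p_sum_le[of t "{j}" i] by simp

lemma trans_op_sums:
  assumes "t \<ge> 0" "\<forall>j. \<bar>f j\<bar> \<le> C"
  shows "(\<lambda>j. p t i j * f j) sums trans_op p t f i"
  unfolding trans_op_def
proof (rule summable_sums, rule summable_comparison_test'[where N = 0])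
  show "summable (\<lambda>j. C * p t i j)" by (rule summable_mult[OF p_summable[OF assms(1)]])
  show "norm (p t i j * f j) \<le> C * p t i j" for j
    using assms p_nonneg[OF assms(1), of i j] by (simp add: abs_mult mult.commute mult_right_mono)
qed

text \<open>The mass not in A, killed mass included, is 1 minus the sum over A, and f is at most C
  in modulus. Three choices of A matter: the empty set gives contractivity, {i} gives continuity in
  time, and i with its neighbours gives the generator.\<close>

lemma trans_op_diff_sum_le:
  assumes t: "t \<ge> 0" and f: "\<forall>j. \<bar>f j\<bar> \<le> C" and A: "finite A"
  shows "\<bar>trans_op p t f i - (\<Sum>j\<in>A. p t i j * f j)\<bar> \<le> C * (1 - (\<Sum>j\<in>A. p t i j))"
proof -
  have C: "C \<ge> 0" using spec[OF f, of 0] by simp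
  have 1: "(\<lambda>j. p t i j * f j - (if j \<in> A then p t i j * f j else 0))
      sums (trans_op p t f i - (\<Sum>j\<in>A. p t i j * f j))"
    by (intro sums_diff trans_op_sums[OF t f] sums_If_finite_set A)
  have 2: "(\<lambda>j. C * (p t i j - (if j \<in> A then p t i j else 0)))
      sums (C * ((\<Sum>j. p t i j) - (\<Sum>j\<in>A. p t i j)))"
    by (intro sums_mult sums_diff summable_sums p_summable[OF t] sums_If_finite_set A)
  have le: "norm (p t i j * f j - (if j \<in> A then p t i j * f j else 0))
      \<le> C * (p t i j - (if j \<in> A then p t i j else 0))" for j
    using spec[OF f, of j] p_nonneg[OF t, of i j] by (simp add: abs_mult mult.commute mult_right_mono)
  have "norm (trans_op p t f i - (\<Sum>j\<in>A. p t i j * f j))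
      \<le> C * ((\<Sum>j. p t i j) - (\<Sum>j\<in>A. p t i j))"
    using norm_suminf_le[OF le sums_summable[OF 2]] sums_unique[OF 1] sums_unique[OF 2] by simp
  also have "\<dots> \<le> C * (1 - (\<Sum>j\<in>A. p t i j))"
    using C p_suminf_le[OF t, of i] by (intro mult_left_mono) auto
  finally show ?thesis by simp
qed

lemma trans_op_abs_le:
  assumes "t \<ge> 0" "\<forall>j. \<bar>f j\<bar> \<le> C"
  shows "\<bar>trans_op p t f i\<bar> \<le> C"
  using trans_op_diff_sum_le[OF assms finite.emptyI, where i = i] by simp

lemma trans_op_bounded:
  assumes "t \<ge> 0" "\<forall>j. \<bar>f j\<bar> \<le> C"
  shows "\<forall>i. \<bar>trans_op p t f i\<bar> \<le> C"
  using trans_op_abs_le[OF assms] by simp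

lemma partial_sum_abs_le:
  assumes t: "t \<ge> 0" and f: "\<forall>j. \<bar>f j\<bar> \<le> C"
  shows "\<bar>\<Sum>j<J. p t i j * f j\<bar> \<le> C"
proof -
  have C: "C \<ge> 0" using spec[OF f, of 0] by simp
  have "\<bar>\<Sum>j<J. p t i j * f j\<bar> \<le> (\<Sum>j<J. p t i j * C)"
    using f p_nonneg[OF t] by (intro order_trans[OF sum_abs] sum_mono) (auto simp: abs_mult intro!: mult_left_mono)
  also have "\<dots> = (\<Sum>j<J. p t i j) * C" by (simp add: sum_distrib_right)
  also have "\<dots> \<le> C" using p_sum_le[OF t, of "{..<J}" i] C by (simp add: mult_left_le_one_le sum_nonneg p_nonneg t)
  finally show ?thesis .
qed

lemma trans_op_0: "trans_op p 0 f i = f i"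
proof -
  have "(\<lambda>j. if j = i then f j else 0) = (\<lambda>j. p 0 i j * f j)"
    by (auto simp: p_zero)
  with sums_single[of i f] show ?thesis unfolding trans_op_def by (simp add: sums_iff)
qed

lemma trans_op_indicator: "trans_op p t (\<lambda>k. of_bool (k = j)) i = p t i j"
proof -
  have "(\<lambda>k. if k = j then p t i k else 0) = (\<lambda>k. p t i k * of_bool (k = j))" by auto
  with sums_single[of j "p t i"] show ?thesis unfolding trans_op_def by (simp add: sums_iff)
qed

lemma trans_op_add:
  assumes s: "s \<ge> 0" and t: "t \<ge> 0" and f: "\<forall>j. \<bar>f j\<bar> \<le> C"
  shows "trans_op p (s + t) f i = trans_op p s (trans_op p t f) i"
proof -
  have "(\<lambda>j. \<Sum>k. p s i k * (p t k j * f j)) sums (\<Sum>k. p s i k * trans_op p t f k)"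
  proof (rule sums_swap[where w = "\<lambda>k. p s i k * C"])
    show "(\<lambda>j. p s i k * (p t k j * f j)) sums (p s i k * trans_op p t f k)" for k
      by (intro sums_mult trans_op_sums[OF t f])
    show "\<bar>\<Sum>j<J. p s i k * (p t k j * f j)\<bar> \<le> p s i k * C" for k J
      using partial_sum_abs_le[OF t f, where J = J and i = k] p_nonneg[OF s, of i k]
      by (simp add: sum_distrib_left[symmetric] abs_mult mult_left_mono)
    show "summable (\<lambda>k. p s i k * C)" by (intro summable_mult2 p_summable[OF s])
  qed
  moreover have "(\<Sum>k. p s i k * (p t k j * f j)) = p (s + t) i j * f j" for j
    using sums_mult2[OF chapman_kolmogorov[OF s t, of i j], of "f j"] by (simp add: sums_iff mult.assoc)
  ultimately show ?thesis unfolding trans_op_def by (simp add: sums_iff)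
qed

lemma trans_op_diff_le:
  assumes "t \<ge> 0" "\<forall>j. \<bar>f j\<bar> \<le> C"
  shows "\<bar>trans_op p t f i - f i\<bar> \<le> 2 * C * (1 - p t i i)"
proof -
  have "\<bar>trans_op p t f i - p t i i * f i\<bar> \<le> C * (1 - p t i i)"
    using trans_op_diff_sum_le[OF assms, where A = "{i}" and i = i] by simp
  moreover have "\<bar>p t i i * f i - f i\<bar> = (1 - p t i i) * \<bar>f i\<bar>"
  proof -
    have "p t i i * f i - f i = - ((1 - p t i i) * f i)" by (simp add: algebra_simps)
    then show ?thesis using p_le_one[OF assms(1), of i i] by (simp add: abs_mult)
  qed
  moreover have "(1 - p t i i) * \<bar>f i\<bar> \<le> (1 - p t i i) * C"
    using p_le_one[OF assms(1), of i i] assms(2) by (intro mult_left_mono) auto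
  ultimately have "\<bar>trans_op p t f i - f i\<bar> \<le> C * (1 - p t i i) + (1 - p t i i) * C" by linarith
  then show ?thesis by (simp add: algebra_simps)
qed

text \<open>P(s + h) f - P(s) f is P(h) - 1 applied to P(s) f, which has the same bound C. Hence the
  modulus depends on \<open>p h i i\<close> only: it is uniform in s, but not in i.\<close>

lemma trans_op_modulus:
  assumes f: "\<forall>j. \<bar>f j\<bar> \<le> C" and "e > 0"
  shows "\<exists>d>0. \<forall>s\<ge>0. \<forall>h\<ge>0. h < d \<longrightarrow> \<bar>trans_op p (s + h) f i - trans_op p s f i\<bar> < e"
proof -
  have "((\<lambda>h. 2 * C * (1 - p h i i)) \<longlongrightarrow> 2 * C * (1 - of_bool (i = i))) (at_right 0)"
    by (intro tendsto_intros p_tendsto)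
  then have "((\<lambda>h. 2 * C * (1 - p h i i)) \<longlongrightarrow> 0) (at_right 0)" by simp
  then have "\<forall>\<^sub>F h in at_right 0. 2 * C * (1 - p h i i) < e"
    using \<open>e > 0\<close> by (rule order_tendstoD)
  then obtain d where d: "d > 0" "\<And>h. 0 < h \<Longrightarrow> h < d \<Longrightarrow> 2 * C * (1 - p h i i) < e"
    unfolding eventually_at_right_field by auto
  have "\<bar>trans_op p (s + h) f i - trans_op p s f i\<bar> < e" if "s \<ge> 0" "h \<ge> 0" "h < d" for s h
  proof (cases "h = 0")
    case False
    then have "\<bar>trans_op p (h + s) f i - trans_op p s f i\<bar> \<le> 2 * C * (1 - p h i i)"
      using trans_op_add[OF \<open>h \<ge> 0\<close> \<open>s \<ge> 0\<close> f] trans_op_diff_le[OF \<open>h \<ge> 0\<close> trans_op_bounded[OF \<open>s \<ge> 0\<close> f]]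
      by simp
    then show ?thesis using d(2)[of h] that False by (simp add: add.commute)
  qed (use \<open>e > 0\<close> in simp)
  then show ?thesis using d(1) by blast
qed

lemma continuous_on_trans_op:
  assumes f: "\<forall>j. \<bar>f j\<bar> \<le> C"
  shows "continuous_on {0..} (\<lambda>t. trans_op p t f i)"
  unfolding continuous_on_iff
proof (intro ballI allI impI)
  fix x e :: real assume "x \<in> {0..}" "e > 0"
  from trans_op_modulus[OF f \<open>e > 0\<close>, where i = i] obtain d where d: "d > 0"
    "\<And>s h. s \<ge> 0 \<Longrightarrow> h \<ge> 0 \<Longrightarrow> h < d \<Longrightarrow> \<bar>trans_op p (s + h) f i - trans_op p s f i\<bar> < e"
    by blast
  have "dist (trans_op p y f i) (trans_op p x f i) < e" if "y \<in> {0..}" "dist y x < d" for y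
  proof (cases "x \<le> y")
    case True
    with d(2)[of x "y - x"] that \<open>x \<in> {0..}\<close> show ?thesis by (auto simp: dist_real_def)
  next
    case False
    with d(2)[of y "x - y"] that \<open>x \<in> {0..}\<close> show ?thesis by (auto simp: dist_real_def abs_minus_commute)
  qed
  with d(1) show "\<exists>d>0. \<forall>y\<in>{0..}. dist y x < d \<longrightarrow> dist (trans_op p y f i) (trans_op p x f i) < e"
    by blast
qed

lemma measurable_trans_op:
  assumes "\<forall>j. \<bar>f j\<bar> \<le> C"
  shows "set_borel_measurable borel {0..} (\<lambda>t. trans_op p t f i)"
  by (rule set_measurable_continuous_on[OF _ continuous_on_trans_op[OF assms]]) simp

lemma continuous_on_p: "continuous_on {0..} (\<lambda>t. p t i j)"
  using continuous_on_trans_op[where f = "\<lambda>k. of_bool (k = j)" and C = 1 and i = i] by (simp add: trans_op_indicator)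

lemma measurable_p: "set_borel_measurable borel {0..} (\<lambda>t. p t i j)"
  by (rule set_measurable_continuous_on[OF _ continuous_on_p]) simp

lemma resolvent_eq_laplace: "resolvent p \<alpha> i j = laplace (\<lambda>t. p t i j) \<alpha>"
  by (simp add: resolvent_def laplace_def)

lemma resolvent_nonneg:
  assumes "\<alpha> > 0" shows "resolvent p \<alpha> i j \<ge> 0"
  unfolding resolvent_def set_lebesgue_integral_def
  by (rule Bochner_Integration.integral_nonneg) (auto simp: indicator_def p_nonneg)

lemma trans_op_laplace_integrable:
  assumes "\<alpha> > 0" "\<forall>j. \<bar>f j\<bar> \<le> C"
  shows "set_integrable lborel {0..} (\<lambda>t. exp (- \<alpha> * t) * trans_op p t f i)"
  by (rule laplace_integrable_bounded[OF assms(1) measurable_trans_op[OF assms(2)] trans_op_abs_le[OF _ assms(2)]])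

lemma res_op_sums:
  assumes "\<alpha> > 0" "\<forall>j. \<bar>f j\<bar> \<le> C"
  shows "(\<lambda>j. resolvent p \<alpha> i j * f j) sums res_op p \<alpha> f i"
proof -
  have "(\<lambda>j. laplace (\<lambda>t. p t i j * f j) \<alpha>) sums res_op p \<alpha> f i"
    unfolding res_op_def
  proof (rule laplace_sums[OF assms(1)])
    have "(\<lambda>x. f j * (indicat_real {0..} x *\<^sub>R p x i j)) \<in> borel_measurable borel" for j
      using measurable_p[of i j] unfolding set_borel_measurable_def by measurable
    then show "set_borel_measurable borel {0..} (\<lambda>t. p t i j * f j)" for j
      unfolding set_borel_measurable_def by (simp add: mult_ac)
    show "(\<lambda>j. p t i j * f j) sums trans_op p t f i" if "t \<ge> 0" for t
      by (rule trans_op_sums[OF that assms(2)])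
    show "\<bar>\<Sum>j<J. p t i j * f j\<bar> \<le> C" if "t \<ge> 0" for J t
      by (rule partial_sum_abs_le[OF that assms(2)])
  qed
  moreover have "laplace (\<lambda>t. p t i j * f j) \<alpha> = resolvent p \<alpha> i j * f j" for j
    using laplace_cmult[of "f j" "\<lambda>t. p t i j" \<alpha>] by (simp add: resolvent_eq_laplace mult.commute)
  ultimately show ?thesis by simp
qed

lemma res_op_abs_le:
  assumes "\<alpha> > 0" "\<forall>j. \<bar>f j\<bar> \<le> C"
  shows "\<bar>res_op p \<alpha> f i\<bar> \<le> C / \<alpha>"
  unfolding res_op_def
  by (rule laplace_abs_le[OF assms(1) measurable_trans_op[OF assms(2)] trans_op_abs_le[OF _ assms(2)]])

text \<open>P(t) passes under the Laplace integral and turns P(s) f into P(t + s) f; the shift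
  formula does the rest.\<close>

lemma trans_op_res_op:
  assumes t: "t \<ge> 0" and \<alpha>: "\<alpha> > 0" and f: "\<forall>j. \<bar>f j\<bar> \<le> C"
  shows "trans_op p t (res_op p \<alpha> f) i =
    exp (\<alpha> * t) * (res_op p \<alpha> f i - (LBINT s:{0..t}. exp (- \<alpha> * s) * trans_op p s f i))"
proof -
  have "(\<lambda>k. laplace (\<lambda>s. p t i k * trans_op p s f k) \<alpha>) sums laplace (\<lambda>s. trans_op p (t + s) f i) \<alpha>"
  proof (rule laplace_sums[OF \<alpha>])
    have "(\<lambda>x. p t i k * (indicat_real {0..} x *\<^sub>R trans_op p x f k)) \<in> borel_measurable borel" for k
      using measurable_trans_op[OF f, where i = k] unfolding set_borel_measurable_def by measurable
    then show "set_borel_measurable borel {0..} (\<lambda>s. p t i k * trans_op p s f k)" for k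
      unfolding set_borel_measurable_def by (simp add: mult_ac)
    show "(\<lambda>k. p t i k * trans_op p s f k) sums trans_op p (t + s) f i" if "s \<ge> 0" for s
      unfolding trans_op_add[OF t that f] by (rule trans_op_sums[OF t trans_op_bounded[OF that f]])
    show "\<bar>\<Sum>k<J. p t i k * trans_op p s f k\<bar> \<le> C" if "s \<ge> 0" for J s
      by (rule partial_sum_abs_le[OF t trans_op_bounded[OF that f]])
  qed
  then have "trans_op p t (res_op p \<alpha> f) i = laplace (\<lambda>s. trans_op p (t + s) f i) \<alpha>"
    by (simp add: trans_op_def[of p t "res_op p \<alpha> f"] laplace_cmult res_op_def sums_iff)
  also have "\<dots> = exp (\<alpha> * t) * (res_op p \<alpha> f i - (LBINT s:{0..t}. exp (- \<alpha> * s) * trans_op p s f i))"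
    unfolding res_op_def by (rule laplace_shift[OF t trans_op_laplace_integrable[OF \<alpha> f]])
  finally show ?thesis .
qed

text \<open>With F the resolvent of f at parameter 1, P(t) F = exp t F - (integral over [0, t] of
  exp (t - s) P(s) f). The remainder splits into (exp t - 1 - t) F and the deviation of the integral
  from t f. Replacing the exponential weights by 1 costs t (exp t - 1) C in each part; replacing
  P(s) f by f costs t e. The modulus e is a parameter, so that pointwise and uniform versions come
  from one bound.\<close>

lemma trans_op_res_op_estimate:
  assumes t: "t \<ge> 0" and f: "\<forall>j. \<bar>f j\<bar> \<le> C"
    and e: "\<And>s. 0 \<le> s \<Longrightarrow> s \<le> t \<Longrightarrow> \<bar>trans_op p s f i - f i\<bar> \<le> e"
  shows "\<bar>trans_op p t (res_op p 1 f) i - res_op p 1 f i - t * (res_op p 1 f i - f i)\<bar>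
    \<le> t * (2 * C * (exp t - 1) + e)"
proof -
  let ?F = "res_op p 1 f i" and ?g = "\<lambda>s. exp (t - s) * trans_op p s f i"
  have C: "C \<ge> 0" using spec[OF f, of 0] by simp
  have F: "\<bar>?F\<bar> \<le> C" using res_op_abs_le[OF _ f, where \<alpha> = 1 and i = i] by simp
  have exp_le: "0 \<le> exp t - 1 - t" "exp t - 1 - t \<le> t * (exp t - 1)"
  proof -
    show "0 \<le> exp t - 1 - t" using exp_ge_add_one_self[of t] by linarith
    have "1 - t \<le> exp (- t)" using exp_ge_add_one_self[of "- t"] by simp
    then have "(1 - t) * exp t \<le> exp (- t) * exp t" by (intro mult_right_mono) auto
    then show "exp t - 1 - t \<le> t * (exp t - 1)" by (simp add: exp_add[symmetric] algebra_simps)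
  qed
  have int: "set_integrable lborel {0..t} (\<lambda>s. exp (- s) * trans_op p s f i)"
    using set_integrable_subset[OF trans_op_laplace_integrable[OF _ f, where \<alpha> = 1 and i = i]] by simp
  have intg: "set_integrable lborel {0..t} ?g"
    using set_integrable_mult_right[OF int, of "exp t"] by (simp add: exp_diff exp_minus field_simps)
  have "exp t * (LBINT s:{0..t}. exp (- s) * trans_op p s f i) = (LBINT s:{0..t}. ?g s)"
    unfolding set_integral_mult_right[symmetric]
    by (rule set_lebesgue_integral_cong) (auto simp: exp_diff exp_minus field_simps)
  then have T: "trans_op p t (res_op p 1 f) i = exp t * ?F - (LBINT s:{0..t}. ?g s)"
    using trans_op_res_op[OF t _ f, where \<alpha> = 1 and i = i] by (simp add: algebra_simps)
  have const: "set_integrable lborel {0..t} (\<lambda>s. c)" "(LBINT s:{0..t}. c) = t * c" for c :: real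
    using t by (simp_all add: set_integrable_def set_lebesgue_integral_def)
  have "\<bar>LBINT s:{0..t}. ?g s - f i\<bar> \<le> (LBINT s:{0..t}. (exp t - 1) * C + e)"
  proof (rule set_integral_abs_le)
    show "set_integrable lborel {0..t} (\<lambda>s. ?g s - f i)" by (intro set_integral_diff(1) intg const)
    show "set_integrable lborel {0..t} (\<lambda>s. (exp t - 1) * C + e)" by (rule const)
    fix s assume "s \<in> {0..t}"
    then have s: "0 \<le> s" "s \<le> t" by auto
    have "\<bar>(exp (t - s) - 1) * trans_op p s f i\<bar> \<le> (exp t - 1) * C"
      unfolding abs_mult using s by (intro mult_mono trans_op_abs_le f) auto
    moreover have "?g s - f i = (exp (t - s) - 1) * trans_op p s f i + (trans_op p s f i - f i)"
      by (simp add: algebra_simps)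
    ultimately show "\<bar>?g s - f i\<bar> \<le> (exp t - 1) * C + e"
      using e[OF s] by linarith
  qed
  moreover have "(LBINT s:{0..t}. ?g s - f i) = (LBINT s:{0..t}. ?g s) - t * f i"
    using set_integral_diff(2)[OF intg const(1)[of "f i"]] by (simp add: const(2))
  ultimately have I: "\<bar>(LBINT s:{0..t}. ?g s) - t * f i\<bar> \<le> t * ((exp t - 1) * C + e)"
    by (simp add: const(2))
  have "\<bar>(exp t - 1 - t) * ?F\<bar> \<le> (t * (exp t - 1)) * C"
    unfolding abs_mult using exp_le F C t by (intro mult_mono) auto
  moreover have "trans_op p t (res_op p 1 f) i - ?F - t * (?F - f i)
      = (exp t - 1 - t) * ?F - ((LBINT s:{0..t}. ?g s) - t * f i)"
    using T by (simp add: algebra_simps)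
  moreover have "t * (2 * C * (exp t - 1) + e) = (t * (exp t - 1)) * C + t * ((exp t - 1) * C + e)"
    by (simp add: algebra_simps)
  ultimately show ?thesis using I by linarith
qed

lemma trans_op_res_op_derivative:
  assumes f: "\<forall>j. \<bar>f j\<bar> \<le> C"
  shows "((\<lambda>t. (trans_op p t (res_op p 1 f) i - res_op p 1 f i) / t) \<longlongrightarrow> res_op p 1 f i - f i) (at_right 0)"
proof (rule tendstoI)
  fix e :: real assume "e > 0"
  then obtain d where d: "d > 0" "\<And>h. h \<ge> 0 \<Longrightarrow> h < d \<Longrightarrow> \<bar>trans_op p h f i - f i\<bar> < e / 2"
    using trans_op_modulus[OF f, where e = "e / 2" and i = i] by (fastforce simp: trans_op_0 dest: spec[of _ 0])
  have "((\<lambda>t. 2 * C * (exp t - 1)) \<longlongrightarrow> 2 * C * (exp 0 - 1)) (at_right 0)"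
    by (intro tendsto_intros)
  then have "\<forall>\<^sub>F t in at_right 0. 2 * C * (exp t - 1) < e / 2"
    by (rule order_tendstoD) (use \<open>e > 0\<close> in simp)
  moreover have "\<forall>\<^sub>F t in at_right 0. 0 < t \<and> t < d"
    using d(1) by (auto simp: eventually_at_right_field)
  ultimately show "\<forall>\<^sub>F t in at_right 0.
      dist ((trans_op p t (res_op p 1 f) i - res_op p 1 f i) / t) (res_op p 1 f i - f i) < e"
  proof eventually_elim
    case (elim t)
    let ?D = "trans_op p t (res_op p 1 f) i - res_op p 1 f i"
    have "\<bar>?D - t * (res_op p 1 f i - f i)\<bar> \<le> t * (2 * C * (exp t - 1) + e / 2)"
      by (rule trans_op_res_op_estimate[OF _ f]) (use elim d(2) in \<open>auto intro: less_imp_le\<close>)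
    also have "\<dots> < t * e" using elim by (intro mult_strict_left_mono) auto
    finally have "\<bar>?D - t * (res_op p 1 f i - f i)\<bar> / t < e"
      using elim by (simp add: divide_less_eq mult.commute)
    moreover have "?D / t - (res_op p 1 f i - f i) = (?D - t * (res_op p 1 f i - f i)) / t"
      using elim by (simp add: diff_divide_distrib)
    ultimately show ?case using elim by (simp add: dist_real_def)
  qed
qed

end

section \<open>The derivative at time zero at a single state\<close>

lemma Q_process_generator:
  assumes Q: "Q_process a b p" and a0: "a 0 = 0" and F: "\<forall>j. \<bar>F j\<bar> \<le> C"
  shows "((\<lambda>t. (trans_op p t F i - F i) / t) \<longlongrightarrow> Q_operator a b F i) (at_right 0)"
proof -
  interpret transition p using Q by unfold_locales (simp add: Q_process_def)
  define A where "A = (if i = 0 then {} else {i - 1}) \<union> {i, Suc i}"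
  have A: "finite A" "i \<in> A" by (auto simp: A_def)
  have sumA: "(\<Sum>j\<in>A. q_matrix a b i j * G j) = Q_operator a b G i" for G
    using a0 by (cases i) (auto simp: A_def q_matrix_def Q_operator_def algebra_simps)
  have dq: "((\<lambda>t. (p t i j - of_bool (i = j)) / t) \<longlongrightarrow> q_matrix a b i j) (at_right 0)" for j
  proof -
    have "((\<lambda>t. p t i j) has_real_derivative q_matrix a b i j) (at 0 within {0..})"
      using Q by (simp add: Q_process_def)
    then have "((\<lambda>t. p t i j) has_real_derivative q_matrix a b i j) (at 0 within {0<..})"
      by (rule DERIV_subset) auto
    then show ?thesis by (simp add: has_field_derivative_iff p_zero)
  qed
  have lim: "((\<lambda>t. \<Sum>j\<in>A. (p t i j - of_bool (i = j)) / t * G j) \<longlongrightarrow> Q_operator a b G i) (at_right 0)" for G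
    unfolding sumA[symmetric] by (intro tendsto_sum tendsto_mult_right dq)
  have eq: "(\<Sum>j\<in>A. (p t i j - of_bool (i = j)) / t * G j) = ((\<Sum>j\<in>A. p t i j * G j) - G i) / t" for t G
  proof -
    have "(\<Sum>j\<in>A. (p t i j - of_bool (i = j)) / t * G j)
        = ((\<Sum>j\<in>A. p t i j * G j) - (\<Sum>j\<in>A. of_bool (i = j) * G j)) / t"
      by (simp add: sum_divide_distrib[symmetric] sum_subtractf[symmetric] left_diff_distrib)
    also have "(\<Sum>j\<in>A. of_bool (i = j) * G j) = G i"
      using A by (simp add: of_bool_def if_distrib[of "\<lambda>x. x * _"] cong: if_cong)
    finally show ?thesis .
  qed
  \<comment> \<open>Row i of Q sums to zero, so the limit for the constant function 1 says that the
    mass missing from A is o(t). A bounded F therefore feels only the finite sum over A.\<close>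
  have Q1: "Q_operator a b (\<lambda>_. 1) i = 0" using a0 by (simp add: Q_operator_def)
  have small: "((\<lambda>t. C * (1 - (\<Sum>j\<in>A. p t i j)) / t) \<longlongrightarrow> 0) (at_right 0)"
    using tendsto_mult_left[OF lim[of "\<lambda>_. 1"], of "- C"] unfolding eq Q1
    by (simp add: minus_divide_left[symmetric] algebra_simps diff_divide_distrib)
  have "((\<lambda>t. (trans_op p t F i - F i) / t - (\<Sum>j\<in>A. (p t i j - of_bool (i = j)) / t * F j)) \<longlongrightarrow> 0) (at_right 0)"
  proof (rule Lim_null_comparison[OF _ small])
    have "norm ((trans_op p t F i - F i) / t - (\<Sum>j\<in>A. (p t i j - of_bool (i = j)) / t * F j))
        \<le> C * (1 - (\<Sum>j\<in>A. p t i j)) / t" if "t > 0" for t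
    proof -
      have "(trans_op p t F i - F i) / t - (\<Sum>j\<in>A. (p t i j - of_bool (i = j)) / t * F j)
          = (trans_op p t F i - (\<Sum>j\<in>A. p t i j * F j)) / t"
        unfolding eq by (simp add: diff_divide_distrib)
      then show ?thesis
        using trans_op_diff_sum_le[OF _ F A(1), where t = t and i = i] that by (simp add: divide_right_mono)
    qed
    then show "\<forall>\<^sub>F t in at_right 0. norm ((trans_op p t F i - F i) / t
        - (\<Sum>j\<in>A. (p t i j - of_bool (i = j)) / t * F j)) \<le> C * (1 - (\<Sum>j\<in>A. p t i j)) / t"
      by (auto simp: eventually_at_right_field intro: exI[of _ 1])
  qed
  from tendsto_add[OF this lim[of F]] show ?thesis by simp
qed

text \<open>Both sides are the derivative at time 0 of P(t) applied to the resolvent: one computed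
  from the entries of Q, the other from the semigroup law.\<close>

lemma Q_operator_res_op:
  assumes Q: "Q_process a b p" and a0: "a 0 = 0" and f: "\<forall>j. \<bar>f j\<bar> \<le> C"
  shows "Q_operator a b (res_op p 1 f) i = res_op p 1 f i - f i"
proof -
  interpret transition p using Q by unfold_locales (simp add: Q_process_def)
  have "\<forall>j. \<bar>res_op p 1 f j\<bar> \<le> C" using res_op_abs_le[OF _ f, where \<alpha> = 1] by simp
  from tendsto_unique[OF _ Q_process_generator[OF Q a0 this] trans_op_res_op_derivative[OF f]]
  show ?thesis by simp
qed

section \<open>The minimal process\<close>

lemma at_within_Icc_eq_at_within_atLeast:
  fixes t :: real
  assumes "0 \<le> t" "t < T"
  shows "at t within {0..T} = at t within {0..}"
  by (rule at_within_nhd[of _ "{..<T}"]) (use assms in auto)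

lemma continuous_on_atLeast_iff_Icc:
  fixes f :: "real \<Rightarrow> real"
  shows "continuous_on {0..} f \<longleftrightarrow> (\<forall>T\<ge>0. continuous_on {0..T} f)"
proof
  assume *: "\<forall>T\<ge>0. continuous_on {0..T} f"
  show "continuous_on {0..} f"
    unfolding continuous_on_eq_continuous_within
  proof
    fix t :: real assume "t \<in> {0..}"
    then have "continuous (at t within {0..t + 1}) f"
      using * by (auto simp: continuous_on_eq_continuous_within)
    then show "continuous (at t within {0..}) f"
      using at_within_Icc_eq_at_within_atLeast[of t "t + 1"] \<open>t \<in> {0..}\<close> by simp
  qed
qed (auto intro: continuous_on_subset)

section \<open>Variation of constants and Picard iteration for the backward equation\<close>

text \<open>Variation of constants: the solution of y' = g - q y with initial value c.\<close>

definition duhamel :: "real \<Rightarrow> real \<Rightarrow> (real \<Rightarrow> real) \<Rightarrow> real \<Rightarrow> real" where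
  "duhamel q c g t = exp (- q * t) * (c + integral {0..t} (\<lambda>s. exp (q * s) * g s))"

lemma duhamel_zero [simp]: "duhamel q c g 0 = c"
  by (simp add: duhamel_def)

lemma duhamel_has_derivative:
  assumes g: "continuous_on {0..} g" and t: "t \<ge> 0"
  shows "(duhamel q c g has_real_derivative g t - q * duhamel q c g t) (at t within {0..})"
proof -
  have "continuous_on {0..t + 1} (\<lambda>s. exp (q * s) * g s)"
    by (intro continuous_intros continuous_on_subset[OF g]) auto
  then have "((\<lambda>x. integral {0..x} (\<lambda>s. exp (q * s) * g s)) has_real_derivative exp (q * t) * g t)
      (at t within {0..})"
    using integral_has_real_derivative[of 0 "t + 1" _ t] at_within_Icc_eq_at_within_atLeast[of t "t + 1"] t
    by simp
  then show ?thesis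
    unfolding duhamel_def
    by (auto intro!: derivative_eq_intros simp: algebra_simps exp_minus field_simps)
qed

lemma duhamel_unique:
  assumes "\<And>t. t \<ge> 0 \<Longrightarrow> (y has_real_derivative g t - q * y t) (at t within {0..})" and t: "t \<ge> 0"
  shows "y t = duhamel q (y 0) g t"
proof -
  have "((\<lambda>s. exp (q * s) * y s) has_real_derivative exp (q * s) * g s) (at s within {0..t})"
    if "s \<in> {0..t}" for s
  proof -
    have "(y has_real_derivative g s - q * y s) (at s within {0..t})"
      using assms(1)[of s] that by (auto intro: DERIV_subset)
    then show ?thesis by (auto intro!: derivative_eq_intros simp: algebra_simps)
  qed
  then have "((\<lambda>s. exp (q * s) * g s) has_integral (exp (q * t) * y t - exp (q * 0) * y 0)) {0..t}"
    by (intro fundamental_theorem_of_calculus)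
      (use t in \<open>auto simp: has_real_derivative_iff_has_vector_derivative[symmetric]\<close>)
  then show ?thesis unfolding duhamel_def by (simp add: integral_unique exp_minus)
qed

text \<open>Positivity of the kernel exp (- q (t - s)). All comparisons between Picard iterates and
  backward solutions rest on this.\<close>

lemma duhamel_mono:
  assumes "continuous_on {0..} g" "continuous_on {0..} h" "c \<le> d" "t \<ge> 0"
    "\<And>s. 0 \<le> s \<Longrightarrow> s \<le> t \<Longrightarrow> g s \<le> h s"
  shows "duhamel q c g t \<le> duhamel q d h t"
  unfolding duhamel_def
proof (intro mult_left_mono add_mono assms integral_le)
  show "(\<lambda>s. exp (q * s) * g s) integrable_on {0..t}" "(\<lambda>s. exp (q * s) * h s) integrable_on {0..t}"
    by (intro integrable_continuous_interval continuous_intros continuous_on_subset[OF assms(1)]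
        continuous_on_subset[OF assms(2)]; simp)+
qed (use assms in auto)

lemma continuous_on_of_derivative:
  fixes y :: "real \<Rightarrow> real"
  assumes "\<And>t. t \<ge> 0 \<Longrightarrow> (y has_real_derivative D t) (at t within {0..})"
  shows "continuous_on {0..} y"
  unfolding continuous_on_eq_continuous_within
  by (intro ballI DERIV_continuous[OF assms]) simp

text \<open>At i = 0 truncated subtraction makes the index i - 1 equal to 0 again; the corresponding
  term is harmless because \<open>a 0 = 0\<close>. The Picard iterates and the equation for
  \<open>R_tail\<close> use the same convention.\<close>

lemma suminf_q_matrix:
  assumes "a 0 = 0"
  shows "(\<Sum>k. q_matrix a b i k * G k) = a i * G (i - 1) + b i * G (Suc i) - (a i + b i) * G i"
proof -
  have "(\<Sum>k. q_matrix a b i k * G k) = (\<Sum>k\<in>{i - 1, i, Suc i}. q_matrix a b i k * G k)"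
    by (rule suminf_finite) (auto simp: q_matrix_def)
  also have "\<dots> = a i * G (i - 1) + b i * G (Suc i) - (a i + b i) * G i"
    using assms by (cases i) (auto simp: q_matrix_def algebra_simps)
  finally show ?thesis .
qed

text \<open>The diagonal of Q is treated exactly and the off-diagonal part is taken from the
  previous iterate. Thus iterate n is the probability of being at j at time t after fewer than n
  jumps from i.\<close>

primrec picard :: "(nat \<Rightarrow> real) \<Rightarrow> (nat \<Rightarrow> real) \<Rightarrow> nat \<Rightarrow> nat \<Rightarrow> nat \<Rightarrow> real \<Rightarrow> real" where
  "picard a b j 0 = (\<lambda>i t. 0)"
| "picard a b j (Suc n) = (\<lambda>i. duhamel (a i + b i) (of_bool (i = j))
     (\<lambda>s. a i * picard a b j n (i - 1) s + b i * picard a b j n (Suc i) s))"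

locale bd_chain =
  fixes a b :: "nat \<Rightarrow> real"
  assumes bd: "birth_death a b"
begin

lemma a0: "a 0 = 0" and a_nonneg: "a k \<ge> 0" and b_pos: "b k > 0" and b_nonneg: "b k \<ge> 0"
  and a_pos: "k \<ge> 1 \<Longrightarrow> a k > 0"
proof -
  show "a k \<ge> 0" using bd unfolding birth_death_def by (cases k) (auto simp: less_imp_le)
qed (use bd in \<open>auto simp: birth_death_def less_imp_le\<close>)

lemma picard_continuous: "continuous_on {0..} (picard a b j n i)"
proof (induction n arbitrary: i)
  case (Suc n)
  have "continuous_on {0..} (\<lambda>s. a i * picard a b j n (i - 1) s + b i * picard a b j n (Suc i) s)"
    by (intro continuous_intros Suc)
  from continuous_on_of_derivative[OF duhamel_has_derivative[OF this]] show ?case by simp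
qed simp

lemma picard_source_continuous:
  "continuous_on {0..} (\<lambda>s. a i * picard a b j n (i - 1) s + b i * picard a b j n (Suc i) s)"
  by (intro continuous_intros picard_continuous)

lemma picard_derivative:
  assumes "t \<ge> 0"
  shows "(picard a b j (Suc n) i has_real_derivative
    a i * picard a b j n (i - 1) t + b i * picard a b j n (Suc i) t - (a i + b i) * picard a b j (Suc n) i t)
    (at t within {0..})"
  using duhamel_has_derivative[OF picard_source_continuous assms] by simp

lemma picard_nonneg:
  assumes "t \<ge> 0" shows "picard a b j n i t \<ge> 0"
  using assms
proof (induction n arbitrary: i t)
  case (Suc n)
  have "duhamel (a i + b i) 0 (\<lambda>_. 0) t \<le> picard a b j (Suc n) i t"
    unfolding picard.simps
    by (rule duhamel_mono) (use Suc picard_source_continuous a_nonneg b_nonneg in auto)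
  then show ?case by (simp add: duhamel_def)
qed simp

lemma picard_mono:
  assumes "t \<ge> 0" shows "picard a b j n i t \<le> picard a b j (Suc n) i t"
  using assms
proof (induction n arbitrary: i t)
  case 0
  show ?case using picard_nonneg[OF 0, of j 1 i] by simp
next
  case (Suc n)
  have "duhamel (a i + b i) (of_bool (i = j))
      (\<lambda>s. a i * picard a b j n (i - 1) s + b i * picard a b j n (Suc i) s) t \<le>
    duhamel (a i + b i) (of_bool (i = j))
      (\<lambda>s. a i * picard a b j (Suc n) (i - 1) s + b i * picard a b j (Suc n) (Suc i) s) t"
  proof (rule duhamel_mono[OF picard_source_continuous picard_source_continuous order_refl Suc.prems])
    fix s :: real assume "0 \<le> s"
    then show "a i * picard a b j n (i - 1) s + b i * picard a b j n (Suc i) s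
        \<le> a i * picard a b j (Suc n) (i - 1) s + b i * picard a b j (Suc n) (Suc i) s"
      by (intro add_mono mult_left_mono Suc.IH a_nonneg b_nonneg)
  qed
  then show ?case by simp
qed

text \<open>A backward solution is a fixed point of the monotone Picard step and lies above the zero
  iterate, hence above all iterates.\<close>

lemma picard_le_backward_solution:
  assumes f: "backward_solution a b f" and "t \<ge> 0"
  shows "picard a b j n i t \<le> f t i j"
  using assms(2)
proof (induction n arbitrary: i t)
  case 0
  then show ?case using f by (simp add: backward_solution_def)
next
  case (Suc n)
  have der: "((\<lambda>s. f s i j) has_real_derivative
      (a i * f t (i - 1) j + b i * f t (Suc i) j) - (a i + b i) * f t i j) (at t within {0..})"
    if "t \<ge> 0" for t i
    using f that unfolding backward_solution_def suminf_q_matrix[of a, OF a0] by blast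
  have cont: "continuous_on {0..} (\<lambda>s. f s i j)" for i
    by (rule continuous_on_of_derivative) (rule der)
  have "f t i j = duhamel (a i + b i) (f 0 i j) (\<lambda>s. a i * f s (i - 1) j + b i * f s (Suc i) j) t"
    by (rule duhamel_unique) (use der Suc.prems in auto)
  also have "f 0 i j = of_bool (i = j)" using f by (simp add: backward_solution_def)
  finally show ?case
    unfolding picard.simps
    by (simp only:) (rule duhamel_mono; use Suc picard_source_continuous a_nonneg b_nonneg in
      \<open>auto intro!: add_mono mult_left_mono continuous_intros cont\<close>)
qed

definition picard_limit :: "real \<Rightarrow> nat \<Rightarrow> nat \<Rightarrow> real" where
  "picard_limit t i j = lim (\<lambda>n. picard a b j n i t)"

context
  fixes f assumes f: "backward_solution a b f"
begin

text \<open>Any backward solution f supplies the upper bound for the increasing iterates; the limit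
  itself does not depend on f.\<close>

lemma picard_tendsto:
  assumes "t \<ge> 0" shows "(\<lambda>n. picard a b j n i t) \<longlonglongrightarrow> picard_limit t i j"
proof -
  have "incseq (\<lambda>n. picard a b j n i t)"
    using picard_mono[OF assms] by (rule incseq_SucI)
  from incseq_convergent[OF this, of "f t i j"] picard_le_backward_solution[OF f assms]
  show ?thesis unfolding picard_limit_def by (metis limI)
qed

lemma picard_limit_le:
  assumes "t \<ge> 0" shows "picard_limit t i j \<le> f t i j"
  by (rule LIMSEQ_le_const2[OF picard_tendsto[OF assms]])
    (use picard_le_backward_solution[OF f assms] in auto)

lemma picard_limit_nonneg:
  assumes "t \<ge> 0" shows "picard_limit t i j \<ge> 0"
  by (rule LIMSEQ_le_const[OF picard_tendsto[OF assms]]) (use picard_nonneg[OF assms] in auto)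

text \<open>Dominated convergence, with f as majorant, carries the integral equation over to the
  limit. The integral equation gives continuity of the limit, and continuity allows the equation to
  be differentiated.\<close>

lemma backward_solution_picard_limit: "backward_solution a b picard_limit"
proof -
  let ?G = "\<lambda>i j s. a i * picard_limit s (i - 1) j + b i * picard_limit s (Suc i) j"
  let ?g = "\<lambda>n i j s. a i * picard a b j n (i - 1) s + b i * picard a b j n (Suc i) s"
  have fc: "continuous_on {0..} (\<lambda>s. f s i j)" for i j
    using f unfolding backward_solution_def by (intro continuous_on_of_derivative) blast
  \<comment> \<open>Integrability is recorded along with the equation because continuity of the
    limit is not yet available; it is deduced from the continuity of indefinite integrals.\<close>
  have eq: "(\<lambda>s. exp ((a i + b i) * s) * ?G i j s) integrable_on {0..t} \<and>
      picard_limit t i j = duhamel (a i + b i) (of_bool (i = j)) (?G i j) t" if t: "t \<ge> 0" for i j t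
  proof -
    let ?H = "\<lambda>s. exp ((a i + b i) * s) * (a i * f s (i - 1) j + b i * f s (Suc i) j)"
    have 1: "(\<lambda>s. exp ((a i + b i) * s) * ?g n i j s) integrable_on {0..t}" for n
      by (intro integrable_continuous_interval continuous_intros
          continuous_on_subset[OF picard_source_continuous]) auto
    have 2: "?H integrable_on {0..t}"
      by (intro integrable_continuous_interval continuous_intros continuous_on_subset[OF fc]) auto
    have 3: "norm (exp ((a i + b i) * s) * ?g n i j s) \<le> ?H s" if "s \<in> {0..t}" for n s
    proof -
      have s: "s \<ge> 0" using that by simp
      have "0 \<le> ?g n i j s" using picard_nonneg[OF s] a_nonneg b_nonneg by simp
      moreover have "?g n i j s \<le> a i * f s (i - 1) j + b i * f s (Suc i) j"
        using picard_le_backward_solution[OF f s] a_nonneg b_nonneg by (intro add_mono mult_left_mono) auto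
      ultimately show ?thesis by simp
    qed
    have 4: "(\<lambda>n. exp ((a i + b i) * s) * ?g n i j s) \<longlonglongrightarrow> exp ((a i + b i) * s) * ?G i j s"
      if "s \<in> {0..t}" for s
      using that by (intro tendsto_intros picard_tendsto) auto
    note dc = dominated_convergence[OF 1 2 3 4]
    have "(\<lambda>n. picard a b j (Suc n) i t) \<longlonglongrightarrow> duhamel (a i + b i) (of_bool (i = j)) (?G i j) t"
      unfolding picard.simps duhamel_def by (intro tendsto_intros dc(2)) auto
    with LIMSEQ_Suc[OF picard_tendsto[OF t, of j i]]
    have "picard_limit t i j = duhamel (a i + b i) (of_bool (i = j)) (?G i j) t"
      by (rule LIMSEQ_unique)
    with dc(1) show ?thesis by auto
  qed
  have "continuous_on {0..} (\<lambda>t. picard_limit t i j)" for i j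
    unfolding continuous_on_atLeast_iff_Icc
  proof (intro allI impI)
    fix T :: real assume "T \<ge> 0"
    have "continuous_on {0..T} (duhamel (a i + b i) (of_bool (i = j)) (?G i j))"
      unfolding duhamel_def
      by (intro continuous_intros indefinite_integral_continuous_1) (use eq[OF \<open>T \<ge> 0\<close>] in blast)
    then show "continuous_on {0..T} (\<lambda>t. picard_limit t i j)"
      by (rule continuous_on_eq) (use eq in auto)
  qed
  then have Gc: "continuous_on {0..} (?G i j)" for i j by (intro continuous_intros)
  have der: "((\<lambda>s. picard_limit s i j) has_real_derivative
      ?G i j t - (a i + b i) * picard_limit t i j) (at t within {0..})" if "t \<ge> 0" for i j t
  proof -
    have "(duhamel (a i + b i) (of_bool (i = j)) (?G i j) has_real_derivative
        ?G i j t - (a i + b i) * picard_limit t i j) (at t within {0..})"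
      using duhamel_has_derivative[OF Gc that, of "a i + b i" "of_bool (i = j)"] eq[OF that] by simp
    then show ?thesis
      by (rule has_field_derivative_transform_within[of _ _ _ _ 1]) (use that eq in auto)
  qed
  have "picard_limit 0 i j = of_bool (i = j)" for i j
    using eq[of 0 i j] by simp
  then show ?thesis
    unfolding backward_solution_def suminf_q_matrix[of a, OF a0]
    using picard_limit_nonneg der by blast
qed

end

text \<open>The limit of the iterates is a backward solution below \<open>pmin\<close>, and
  \<open>pmin\<close> is below every backward solution, so they coincide. Bounds on iterates thereby
  pass to the minimal process.\<close>

lemma picard_tendsto_minimal:
  assumes "minimal_Q_process a b pmin" "t \<ge> 0"
  shows "(\<lambda>n. picard a b j n i t) \<longlonglongrightarrow> pmin t i j"
proof -
  have bs: "backward_solution a b pmin" using assms by (simp add: minimal_Q_process_def)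
  have "pmin t i j \<le> picard_limit t i j"
    using assms backward_solution_picard_limit[OF bs] by (auto simp: minimal_Q_process_def)
  with picard_limit_le[OF bs assms(2), of i j] picard_tendsto[OF bs assms(2), of j i]
  show ?thesis by simp
qed

section \<open>Scale, speed and the tails of the series R\<close>

lemma scale_increment:
  "(scale_fun a b (Suc k) - scale_fun a b k) * (b k * speed a b k) = 1 / 2"
proof -
  have B: "(\<Prod>l<k. b l) \<noteq> 0" "b k \<noteq> 0" "(\<Prod>l=1..k. a l) \<noteq> 0"
    using b_pos a_pos by (auto simp: less_imp_neq[symmetric] neq_iff)
  have "scale_fun a b (Suc k) - scale_fun a b k = (\<Prod>l=1..k. a l) / (2 * (\<Prod>l=0..k. b l))"
    by (cases k) (auto simp: scale_fun_def)
  also have "(\<Prod>l=0..k. b l) = (\<Prod>l<k. b l) * b k"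
    by (simp add: atLeast0AtMost lessThan_Suc_atMost[symmetric])
  finally show ?thesis using B by (simp add: speed_def field_simps)
qed

lemma speed_pos: "speed a b k > 0"
  unfolding speed_def using a_pos b_pos by (intro divide_pos_pos prod_pos) auto

text \<open>Detailed balance: the speed measure is reversing for Q.\<close>

lemma speed_Suc: "a (Suc k) * speed a b (Suc k) = b k * speed a b k"
  using a_pos[of "Suc k"] by (simp add: speed_def field_simps)

lemma scale_increment_pos: "scale_fun a b (Suc k) - scale_fun a b k > 0"
proof -
  have "b k * speed a b k > 0" using b_pos speed_pos by simp
  then show ?thesis using scale_increment[of k] by (smt (verit) mult_nonpos_nonneg divide_pos_pos)
qed

lemma R_term_nonneg: "R_term a b k \<ge> 0"
  unfolding R_term_def
  using scale_increment_pos[of k] speed_pos by (intro mult_nonneg_nonneg sum_nonneg) (auto intro: less_imp_le)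

text \<open>The first product is (\<mu>(0) + ... + \<mu>(i)) / (2 \<mu>(i)); by detailed balance the
  second is the same expression with the sum stopped at i - 1. Only \<mu>(i) / (2 \<mu>(i))
  remains.\<close>

lemma R_term_recurrence: "b i * R_term a b i - a i * R_term a b (i - 1) = 1 / 2"
proof -
  let ?d = "\<lambda>k. scale_fun a b (Suc k) - scale_fun a b k" and ?\<mu> = "speed a b"
  have \<mu>: "?\<mu> i > 0" by (rule speed_pos)
  have bR: "b i * R_term a b i = (\<Sum>k\<le>i. ?\<mu> k) / (2 * ?\<mu> i)"
  proof -
    have "b i * R_term a b i * ?\<mu> i = (?d i * (b i * ?\<mu> i)) * (\<Sum>k\<le>i. ?\<mu> k)"
      by (simp add: R_term_def mult_ac)
    then have "b i * R_term a b i * ?\<mu> i = 1 / 2 * (\<Sum>k\<le>i. ?\<mu> k)" unfolding scale_increment .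
    then show ?thesis using \<mu> by (simp add: field_simps)
  qed
  show ?thesis
  proof (cases i)
    case 0
    then show ?thesis using bR \<mu> a0 by (simp add: field_simps)
  next
    case (Suc k)
    have "a i * R_term a b k * ?\<mu> i = (?d k * (b k * ?\<mu> k)) * (\<Sum>k\<le>k. ?\<mu> k)"
      using speed_Suc[of k] Suc by (simp add: R_term_def mult_ac)
    then have "a i * R_term a b k * ?\<mu> i = 1 / 2 * (\<Sum>k\<le>k. ?\<mu> k)" unfolding scale_increment .
    then have "a i * R_term a b k = (\<Sum>k\<le>k. ?\<mu> k) / (2 * ?\<mu> i)"
      using \<mu> by (simp add: field_simps)
    with bR have "b i * R_term a b i - a i * R_term a b k = ?\<mu> i / (2 * ?\<mu> i)"
      using Suc by (simp add: diff_divide_distrib[symmetric])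
    then show ?thesis using Suc \<mu> by simp
  qed
qed

text \<open>\<open>2 * R_tail i\<close> is the expected explosion time of the minimal process started from \<open>i\<close>.\<close>

definition R_tail :: "nat \<Rightarrow> real" where
  "R_tail i = (\<Sum>k. R_term a b (k + i))"

context
  assumes R_finite: "R_series a b < \<infinity>"
begin

lemma R_term_summable: "summable (R_term a b)"
  using R_finite R_term_nonneg unfolding R_series_def
  by (intro summable_suminf_not_top) auto

lemma R_tail_nonneg: "R_tail i \<ge> 0"
  unfolding R_tail_def
  using R_term_summable R_term_nonneg by (intro suminf_nonneg) (auto simp: summable_iff_shift)

lemma R_tail_tendsto: "R_tail \<longlonglongrightarrow> 0"
proof -
  have "R_tail i = suminf (R_term a b) - (\<Sum>k<i. R_term a b k)" for i
    unfolding R_tail_def using suminf_minus_initial_segment[OF R_term_summable] .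
  then have "R_tail = (\<lambda>i. suminf (R_term a b) - (\<Sum>k<i. R_term a b k))" by blast
  moreover have "(\<lambda>i. suminf (R_term a b) - (\<Sum>k<i. R_term a b k)) \<longlonglongrightarrow>
      suminf (R_term a b) - suminf (R_term a b)"
    by (intro tendsto_intros summable_LIMSEQ R_term_summable)
  ultimately show ?thesis by simp
qed

lemma R_tail_Suc: "R_tail i = R_term a b i + R_tail (Suc i)"
proof -
  have "summable (\<lambda>k. R_term a b (k + i))" using R_term_summable by (simp add: summable_iff_shift)
  from suminf_split_head[OF this] show ?thesis by (simp add: R_tail_def)
qed

text \<open>The Poisson equation Q v = -1 for v = 2 \<open>R_tail\<close>, in the additive form that
  matches one Picard step. Differences of neighbouring tails are single terms of R, to which the
  recurrence applies.\<close>

lemma R_tail_equation: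
  "(a i + b i) * (2 * R_tail i) = 1 + a i * (2 * R_tail (i - 1)) + b i * (2 * R_tail (Suc i))"
proof (cases i)
  case 0
  then show ?thesis using R_tail_Suc[of i] R_term_recurrence[of i] a0 by (simp add: algebra_simps)
next
  case (Suc k)
  have "a i * R_tail k = a i * R_term a b k + a i * R_tail i"
    using R_tail_Suc[of k] Suc by (simp add: algebra_simps)
  moreover have "b i * R_tail i = b i * R_term a b i + b i * R_tail (Suc i)"
    using R_tail_Suc[of i] by (simp add: algebra_simps)
  ultimately show ?thesis using R_term_recurrence[of i] Suc by (simp add: algebra_simps)
qed

section \<open>Occupation times and bounds on the minimal resolvent\<close>

text \<open>A comparison by induction on n: the occupation times of iterate n + 1 satisfy, with
  inequality, the equation that 2 \<open>R_tail\<close> satisfies exactly. The bound depends neither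
  on T nor on J nor on n.\<close>

lemma picard_integral_le:
  assumes T: "T \<ge> 0"
  shows "(\<Sum>j<J. integral {0..T} (picard a b j n i)) \<le> 2 * R_tail i"
proof (induction n arbitrary: i)
  case 0
  then show ?case using R_tail_nonneg by simp
next
  case (Suc n)
  let ?I = "\<lambda>n i j. integral {0..T} (picard a b j n i)"
  have int: "picard a b j n i integrable_on {0..T}" for j n i
    by (intro integrable_continuous_interval continuous_on_subset[OF picard_continuous]) auto
  \<comment> \<open>The differential equation is integrated over [0, T], and the nonnegative value
    of the iterate at time T is dropped.\<close>
  have step: "(a i + b i) * ?I (Suc n) i j \<le> of_bool (i = j) + a i * ?I n (i - 1) j + b i * ?I n (Suc i) j" for j
  proof -
    let ?h = "\<lambda>t. a i * picard a b j n (i - 1) t + b i * picard a b j n (Suc i) t - (a i + b i) * picard a b j (Suc n) i t"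
    have "(?h has_integral picard a b j (Suc n) i T - picard a b j (Suc n) i 0) {0..T}"
    proof (rule fundamental_theorem_of_calculus[OF T])
      show "(picard a b j (Suc n) i has_vector_derivative ?h t) (at t within {0..T})" if "t \<in> {0..T}" for t
        unfolding has_real_derivative_iff_has_vector_derivative[symmetric]
        by (rule DERIV_subset[OF picard_derivative]) (use that in auto)
    qed
    moreover have "(?h has_integral a i * ?I n (i - 1) j + b i * ?I n (Suc i) j - (a i + b i) * ?I (Suc n) i j) {0..T}"
      by (intro has_integral_diff has_integral_add has_integral_mult_right integrable_integral int)
    ultimately have "picard a b j (Suc n) i T - picard a b j (Suc n) i 0 =
        a i * ?I n (i - 1) j + b i * ?I n (Suc i) j - (a i + b i) * ?I (Suc n) i j"
      by (rule has_integral_unique)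
    then show ?thesis using picard_nonneg[OF T, of j "Suc n" i] by simp
  qed
  have "(a i + b i) * (\<Sum>j<J. ?I (Suc n) i j) \<le>
      (\<Sum>j<J. of_bool (i = j) + a i * ?I n (i - 1) j + b i * ?I n (Suc i) j)"
    unfolding sum_distrib_left by (rule sum_mono) (rule step)
  also have "\<dots> = (\<Sum>j<J. of_bool (i = j)) + a i * (\<Sum>j<J. ?I n (i - 1) j) + b i * (\<Sum>j<J. ?I n (Suc i) j)"
    by (simp add: sum.distrib sum_distrib_left)
  \<comment> \<open>At most one of the initial values, the one with j = i, is nonzero.\<close>
  also have "\<dots> \<le> 1 + a i * (2 * R_tail (i - 1)) + b i * (2 * R_tail (Suc i))"
    using Suc a_nonneg b_nonneg
    by (intro add_mono mult_left_mono) (auto simp: of_bool_def)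
  also have "\<dots> = (a i + b i) * (2 * R_tail i)" by (simp add: R_tail_equation)
  finally show ?case using a_nonneg[of i] b_pos[of i] by (simp add: add_nonneg_pos)
qed

context
  fixes pmin assumes minimal: "minimal_Q_process a b pmin"
begin

interpretation transition pmin
  using minimal by unfold_locales (simp add: minimal_Q_process_def Q_process_def)

lemma minimal_integral_le:
  assumes T: "T \<ge> 0"
  shows "(\<Sum>j<J. integral {0..T} (\<lambda>t. pmin t i j)) \<le> 2 * R_tail i"
proof -
  have bs: "backward_solution a b pmin" using minimal by (simp add: minimal_Q_process_def)
  have "(\<lambda>n. integral {0..T} (picard a b j n i)) \<longlonglongrightarrow> integral {0..T} (\<lambda>t. pmin t i j)" for j
  proof (rule dominated_convergence(2))
    show "picard a b j n i integrable_on {0..T}" for n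
      by (intro integrable_continuous_interval continuous_on_subset[OF picard_continuous]) auto
    show "(\<lambda>t. pmin t i j) integrable_on {0..T}"
      by (intro integrable_continuous_interval continuous_on_subset[OF continuous_on_p]) auto
  qed (use picard_nonneg picard_le_backward_solution[OF bs] picard_tendsto_minimal[OF minimal] in auto)
  then have "(\<lambda>n. \<Sum>j<J. integral {0..T} (picard a b j n i)) \<longlonglongrightarrow> (\<Sum>j<J. integral {0..T} (\<lambda>t. pmin t i j))"
    by (rule tendsto_sum)
  then show ?thesis by (rule LIMSEQ_le_const2) (use picard_integral_le[OF T] in auto)
qed

text \<open>The first Picard iterate is the probability exp (- q t) of no jump up to time t, a lower
  bound for \<open>pmin t i i\<close>.\<close>

lemma resolvent_diagonal_pos:
  assumes "\<alpha> > 0" shows "resolvent pmin \<alpha> i i > 0"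
proof -
  let ?q = "a i + b i"
  have q: "?q > 0" using a_nonneg[of i] b_pos[of i] by simp
  have le: "exp (- ?q * t) \<le> pmin t i i" if "t \<ge> 0" for t
    using picard_le_backward_solution[of pmin t i 1 i] minimal that
    by (simp add: minimal_Q_process_def duhamel_def)
  have "(LBINT t:{0..}. exp (- (\<alpha> + ?q) * t)) \<le> resolvent pmin \<alpha> i i"
    unfolding resolvent_def
  proof (rule set_integral_mono)
    show "set_integrable lborel {0..} (\<lambda>t. exp (- (\<alpha> + ?q) * t))"
      by (rule set_integrable_exp_minus(1)) (use assms q in simp)
    show "set_integrable lborel {0..} (\<lambda>t. exp (- \<alpha> * t) * pmin t i i)"
      by (rule laplace_integrable_bounded[OF assms measurable_p, of _ _ 1])
        (use p_nonneg p_le_one in auto)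
    show "exp (- (\<alpha> + ?q) * t) \<le> exp (- \<alpha> * t) * pmin t i i" if "t \<in> {0..}" for t
    proof -
      have "exp (- (\<alpha> + ?q) * t) = exp (- \<alpha> * t) * exp (- ?q * t)"
        unfolding exp_add[symmetric] by (simp add: algebra_simps)
      then show ?thesis using le[of t] that by simp
    qed
  qed
  moreover have "(LBINT t:{0..}. exp (- (\<alpha> + ?q) * t)) = 1 / (\<alpha> + ?q)"
    by (rule set_integrable_exp_minus(2)) (use assms q in simp)
  moreover have "1 / (\<alpha> + ?q) > 0" using assms q by simp
  ultimately show ?thesis by linarith
qed

text \<open>Up to time T the discount factor is at most 1 and the occupation time bound applies;
  after T at most exp (- \<alpha> T) / \<alpha> is left, and T tends to infinity.\<close>

lemma resolvent_sum_le:
  assumes \<alpha>: "\<alpha> > 0"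
  shows "(\<Sum>j<J. resolvent pmin \<alpha> i j) \<le> 2 * R_tail i"
proof -
  define \<phi> where "\<phi> t = (\<Sum>j<J. pmin t i j)" for t
  have meas: "set_borel_measurable borel {0..} \<phi>"
    unfolding \<phi>_def by (intro set_borel_measurable_sum measurable_p)
  have bd: "\<bar>\<phi> t\<bar> \<le> 1" if "t \<ge> 0" for t
    using partial_sum_abs_le[OF that, of "\<lambda>_. 1" 1 i J] by (simp add: \<phi>_def)
  have pint: "set_integrable lborel {0..} (\<lambda>t. exp (- \<alpha> * t) * pmin t i j)" for j
    by (rule laplace_integrable_bounded[OF \<alpha> measurable_p, of _ _ 1]) (use p_nonneg p_le_one in auto)
  have int: "set_integrable lborel {0..} (\<lambda>t. exp (- \<alpha> * t) * \<phi> t)"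
    by (rule laplace_integrable_bounded[OF \<alpha> meas bd])
  have cont: "continuous_on {0..} \<phi>"
    unfolding \<phi>_def by (intro continuous_intros continuous_on_p)
  have eq: "laplace \<phi> \<alpha> = (\<Sum>j<J. resolvent pmin \<alpha> i j)"
    unfolding \<phi>_def resolvent_eq_laplace by (rule laplace_sum) (rule pint)
  have le: "laplace \<phi> \<alpha> \<le> 2 * R_tail i + exp (- \<alpha> * T) * (1 / \<alpha>)" if T: "T \<ge> 0" for T
  proof -
    have "laplace (\<lambda>s. \<phi> (T + s)) \<alpha> \<le> 1 / \<alpha>"
    proof -
      have "set_borel_measurable borel {0..} (\<lambda>s. \<phi> (T + s))"
        by (rule set_measurable_continuous_on, simp, rule continuous_on_compose2[OF cont])
          (use T in \<open>auto intro!: continuous_intros\<close>)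
      from laplace_abs_le[OF \<alpha> this, of 1] bd T show ?thesis by auto
    qed
    then have "exp (- \<alpha> * T) * laplace (\<lambda>s. \<phi> (T + s)) \<alpha> \<le> exp (- \<alpha> * T) * (1 / \<alpha>)"
      by (intro mult_left_mono) auto
    moreover have "exp (- \<alpha> * T) * laplace (\<lambda>s. \<phi> (T + s)) \<alpha> =
        laplace \<phi> \<alpha> - (LBINT s:{0..T}. exp (- \<alpha> * s) * \<phi> s)"
      unfolding laplace_shift[OF T int] by (simp add: mult.assoc[symmetric] exp_add[symmetric])
    moreover have "(LBINT s:{0..T}. exp (- \<alpha> * s) * \<phi> s) \<le> 2 * R_tail i"
    proof -
      have si: "set_integrable lborel {0..T} (\<lambda>s. exp (- \<alpha> * s) * \<phi> s)"
        by (rule set_integrable_subset[OF int]) auto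
      have i1: "(\<lambda>t. pmin t i j) integrable_on {0..T}" for j
        by (intro integrable_continuous_interval continuous_on_subset[OF continuous_on_p]) auto
      have "(LBINT s:{0..T}. exp (- \<alpha> * s) * \<phi> s) = integral {0..T} (\<lambda>s. exp (- \<alpha> * s) * \<phi> s)"
        by (rule set_borel_integral_eq_integral(2)[OF si])
      also have "\<dots> \<le> integral {0..T} \<phi>"
      proof (rule integral_le)
        show "(\<lambda>s. exp (- \<alpha> * s) * \<phi> s) integrable_on {0..T}"
          by (rule set_borel_integral_eq_integral(1)[OF si])
        show "\<phi> integrable_on {0..T}"
          by (intro integrable_continuous_interval continuous_on_subset[OF cont]) auto
        show "exp (- \<alpha> * s) * \<phi> s \<le> \<phi> s" if "s \<in> {0..T}" for s
          using that \<alpha> by (intro mult_left_le_one_le) (auto simp: \<phi>_def p_nonneg sum_nonneg)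
      qed
      also have "\<dots> = (\<Sum>j<J. integral {0..T} (\<lambda>t. pmin t i j))"
        unfolding \<phi>_def by (rule integral_sum) (use i1 in auto)
      finally show ?thesis using minimal_integral_le[OF T, of i J] by linarith
    qed
    ultimately show ?thesis by linarith
  qed
  have "((\<lambda>T. 2 * R_tail i + exp (- \<alpha> * T) * (1 / \<alpha>)) \<longlongrightarrow> 2 * R_tail i + 0 * (1 / \<alpha>)) at_top"
  proof (intro tendsto_intros)
    have "filterlim (\<lambda>T. - \<alpha> * T) at_bot at_top"
      using \<alpha> by (intro filterlim_tendsto_neg_mult_at_bot[OF tendsto_const]) (auto intro: filterlim_ident)
    then show "((\<lambda>T. exp (- \<alpha> * T)) \<longlongrightarrow> 0) at_top"
      by (rule filterlim_compose[OF exp_at_bot])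
  qed
  then have "laplace \<phi> \<alpha> \<le> 2 * R_tail i + 0 * (1 / \<alpha>)"
    by (rule tendsto_lowerbound) (use le in \<open>auto simp: eventually_at_top_linorder intro: exI[of _ 0]\<close>)
  with eq show ?thesis by simp
qed

lemma res_op_minimal_abs_le:
  assumes \<alpha>: "\<alpha> > 0" and f: "\<forall>j. \<bar>f j\<bar> \<le> C"
  shows "\<bar>res_op pmin \<alpha> f i\<bar> \<le> C * (2 * R_tail i)"
proof (rule LIMSEQ_le_const2)
  show "(\<lambda>J. \<bar>\<Sum>j<J. resolvent pmin \<alpha> i j * f j\<bar>) \<longlonglongrightarrow> \<bar>res_op pmin \<alpha> f i\<bar>"
    using res_op_sums[OF \<alpha> f, of i] unfolding sums_def by (rule tendsto_rabs)
  have C: "C \<ge> 0" using spec[OF f, of 0] by simp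
  have "\<bar>\<Sum>j<J. resolvent pmin \<alpha> i j * f j\<bar> \<le> C * (2 * R_tail i)" for J
  proof -
    have "\<bar>\<Sum>j<J. resolvent pmin \<alpha> i j * f j\<bar> \<le> (\<Sum>j<J. C * resolvent pmin \<alpha> i j)"
      using f resolvent_nonneg[OF \<alpha>]
      by (intro order_trans[OF sum_abs] sum_mono) (auto simp: abs_mult mult.commute intro!: mult_right_mono)
    also have "\<dots> \<le> C * (2 * R_tail i)"
      unfolding sum_distrib_left[symmetric] using resolvent_sum_le[OF \<alpha>] C by (intro mult_left_mono)
    finally show ?thesis .
  qed
  then show "\<exists>N. \<forall>J\<ge>N. \<bar>\<Sum>j<J. resolvent pmin \<alpha> i j * f j\<bar> \<le> C * (2 * R_tail i)" by blast
qed

lemma res_op_minimal_tendsto: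
  assumes "\<alpha> > 0" "\<forall>j. \<bar>f j\<bar> \<le> C"
  shows "res_op pmin \<alpha> f \<longlonglongrightarrow> 0"
proof (rule Lim_null_comparison)
  show "\<forall>\<^sub>F i in sequentially. norm (res_op pmin \<alpha> f i) \<le> C * (2 * R_tail i)"
    using res_op_minimal_abs_le[OF assms] by (intro always_eventually) auto
  show "(\<lambda>i. C * (2 * R_tail i)) \<longlonglongrightarrow> 0"
    using tendsto_mult_left[OF tendsto_mult_left[OF R_tail_tendsto, of 2], of C] by simp
qed

lemma res_op_minimal_one_pos:
  assumes \<alpha>: "\<alpha> > 0"
  shows "res_op pmin \<alpha> (\<lambda>_. 1) i > 0"
proof -
  have "(\<lambda>j. resolvent pmin \<alpha> i j * 1) sums res_op pmin \<alpha> (\<lambda>_. 1) i"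
    by (rule res_op_sums[OF \<alpha>, of _ 1]) simp
  then have "summable (resolvent pmin \<alpha> i)" "res_op pmin \<alpha> (\<lambda>_. 1) i = (\<Sum>j. resolvent pmin \<alpha> i j)"
    by (simp_all add: sums_iff)
  then show ?thesis
    using suminf_pos2[of "resolvent pmin \<alpha> i" i] resolvent_nonneg[OF \<alpha>] resolvent_diagonal_pos[OF \<alpha>]
    by simp
qed

end

end

end

section \<open>A continuity theorem for Laplace transforms\<close>

text \<open>In the variable x = exp (-s) the half-line becomes (0, 1], and the moments of exp (-s)
  \<phi>(s) ds are Laplace transforms: the power x^i gives the parameter i + 1, which is positive
  thanks to the extra weight exp (-s).\<close>

definition exp_pairing :: "(real \<Rightarrow> real) \<Rightarrow> (real \<Rightarrow> real) \<Rightarrow> real" where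
  "exp_pairing k \<phi> = (LBINT s:{0..}. k (exp (- s)) * (exp (- s) * \<phi> s))"

lemma exp_pairing_integrable:
  fixes k :: "real \<Rightarrow> real"
  assumes k: "continuous_on {0..1} k" and \<phi>: "set_integrable lborel {0..} (\<lambda>s. exp (- s) * \<phi> s)"
  shows "set_integrable lborel {0..} (\<lambda>s. k (exp (- s)) * (exp (- s) * \<phi> s))"
proof -
  have "compact (k ` {0..1})" by (rule compact_continuous_image[OF k]) (rule compact_Icc)
  then have "bounded (k ` {0..1})" by (rule compact_imp_bounded)
  then obtain B where "\<forall>y\<in>k ` {0..1}. norm y \<le> B" unfolding bounded_iff by blast
  then have B: "\<bar>k x\<bar> \<le> B" if "x \<in> {0..1}" for x using that by simp
  show ?thesis
  proof (rule set_integrable_bound)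
    show "set_integrable lborel {0..} (\<lambda>s. B * \<bar>exp (- s) * \<phi> s\<bar>)"
      using set_integrable_abs[OF \<phi>] by simp
    have "continuous_on {0..} (\<lambda>s. k (exp (- s)))"
      by (rule continuous_on_compose2[OF k]) (auto intro!: continuous_intros)
    then have "set_borel_measurable borel {0..} (\<lambda>s. k (exp (- s)))"
      by (intro set_measurable_continuous_on) auto
    then have "(\<lambda>s. (indicat_real {0..} s *\<^sub>R k (exp (- s))) * (indicat_real {0..} s *\<^sub>R (exp (- s) * \<phi> s)))
        \<in> borel_measurable lborel"
      using \<phi> unfolding set_borel_measurable_def set_integrable_def by (intro borel_measurable_times) auto
    also have "(\<lambda>s. (indicat_real {0..} s *\<^sub>R k (exp (- s))) * (indicat_real {0..} s *\<^sub>R (exp (- s) * \<phi> s)))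
        = (\<lambda>s. indicat_real {0..} s *\<^sub>R (k (exp (- s)) * (exp (- s) * \<phi> s)))"
      by (auto simp: indicator_def)
    finally show "set_borel_measurable lborel {0..} (\<lambda>s. k (exp (- s)) * (exp (- s) * \<phi> s))"
      unfolding set_borel_measurable_def .
    show "AE s in lborel. s \<in> {0..} \<longrightarrow>
        norm (k (exp (- s)) * (exp (- s) * \<phi> s)) \<le> norm (B * \<bar>exp (- s) * \<phi> s\<bar>)"
    proof (intro AE_I2 impI)
      fix s :: real assume "s \<in> {0..}"
      then have "\<bar>k (exp (- s))\<bar> \<le> \<bar>B\<bar>" using B[of "exp (- s)"] by simp
      then show "norm (k (exp (- s)) * (exp (- s) * \<phi> s)) \<le> norm (B * \<bar>exp (- s) * \<phi> s\<bar>)"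
        unfolding real_norm_def abs_mult by (intro mult_mono) auto
    qed
  qed
qed

lemma exp_pairing_polynomial:
  assumes \<phi>: "set_integrable lborel {0..} (\<lambda>s. exp (- s) * \<phi> s)"
  shows "exp_pairing (\<lambda>x. \<Sum>i\<le>n. c i * x ^ i) \<phi> = (\<Sum>i\<le>n. c i * laplace \<phi> (real (Suc i)))"
proof -
  have *: "exp (- s) ^ i * (exp (- s) * \<phi> s) = exp (- real (Suc i) * s) * \<phi> s" for i s
    by (simp add: exp_of_nat_mult[symmetric] exp_add[symmetric] algebra_simps)
  have int: "set_integrable lborel {0..} (\<lambda>s. exp (- s) ^ i * (exp (- s) * \<phi> s))" for i
    by (rule exp_pairing_integrable[OF _ \<phi>, of "\<lambda>x. x ^ i"]) (intro continuous_intros)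
  have "exp_pairing (\<lambda>x. \<Sum>i\<le>n. c i * x ^ i) \<phi> =
      (LBINT s:{0..}. (\<Sum>i\<le>n. c i * (exp (- s) ^ i * (exp (- s) * \<phi> s))))"
    unfolding exp_pairing_def by (simp add: sum_distrib_right mult.assoc)
  also have "\<dots> = (\<Sum>i\<le>n. LBINT s:{0..}. c i * (exp (- s) ^ i * (exp (- s) * \<phi> s)))"
    using set_integrable_mult_right[OF int] unfolding set_integrable_def set_lebesgue_integral_def
    by (subst Bochner_Integration.integral_sum[symmetric]) (auto simp: sum_distrib_left)
  also have "\<dots> = (\<Sum>i\<le>n. c i * laplace \<phi> (real (Suc i)))"
    unfolding * laplace_def by simp
  finally show ?thesis .
qed

lemma exp_pairing_diff_le:
  assumes k: "continuous_on {0..1} k" "continuous_on {0..1} g" and kg: "\<And>x. x \<in> {0..1} \<Longrightarrow> \<bar>k x - g x\<bar> \<le> e"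
    and \<phi>: "set_integrable lborel {0..} (\<lambda>s. exp (- s) * \<phi> s)"
  shows "\<bar>exp_pairing k \<phi> - exp_pairing g \<phi>\<bar> \<le> e * (LBINT s:{0..}. \<bar>exp (- s) * \<phi> s\<bar>)"
proof -
  have "exp_pairing k \<phi> - exp_pairing g \<phi> =
      (LBINT s:{0..}. k (exp (- s)) * (exp (- s) * \<phi> s) - g (exp (- s)) * (exp (- s) * \<phi> s))"
    unfolding exp_pairing_def by (rule set_integral_diff(2)[symmetric]) (intro exp_pairing_integrable k \<phi>)+
  also have "\<bar>\<dots>\<bar> \<le> (LBINT s:{0..}. e * \<bar>exp (- s) * \<phi> s\<bar>)"
  proof (rule set_integral_abs_le)
    show "\<bar>k (exp (- s)) * (exp (- s) * \<phi> s) - g (exp (- s)) * (exp (- s) * \<phi> s)\<bar> \<le> e * \<bar>exp (- s) * \<phi> s\<bar>"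
      if "s \<in> {0..}" for s
      unfolding left_diff_distrib[symmetric] abs_mult[of "k _ - g _"]
      by (rule mult_right_mono[OF kg]) (use that in auto)
    show "set_integrable lborel {0..} (\<lambda>s. e * \<bar>exp (- s) * \<phi> s\<bar>)"
      using set_integrable_abs[OF \<phi>] by simp
  qed (intro set_integral_diff(1) exp_pairing_integrable k \<phi>)
  finally show ?thesis by simp
qed

text \<open>Polynomial tests converge by hypothesis. A continuous test is uniformly close to a
  polynomial on [0, 1], and the uniform L1 bound C makes the resulting error independent of
  n.\<close>

lemma exp_pairing_tendsto:
  fixes \<phi> :: "nat \<Rightarrow> real \<Rightarrow> real"
  assumes k: "continuous_on {0..1} k"
    and \<phi>: "\<And>n. set_integrable lborel {0..} (\<lambda>s. exp (- s) * \<phi> n s)"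
    and C: "\<And>n. (LBINT s:{0..}. \<bar>exp (- s) * \<phi> n s\<bar>) \<le> C"
    and \<psi>: "set_integrable lborel {0..} (\<lambda>s. exp (- s) * \<psi> s)"
    and lap: "\<And>m. (\<lambda>n. laplace (\<phi> n) (real (Suc m))) \<longlonglongrightarrow> laplace \<psi> (real (Suc m))"
  shows "(\<lambda>n. exp_pairing k (\<phi> n)) \<longlonglongrightarrow> exp_pairing k \<psi>"
proof (rule tendstoI)
  fix e :: real assume "e > 0"
  define A where "A = (LBINT s:{0..}. \<bar>exp (- s) * \<psi> s\<bar>)"
  have nonneg: "0 \<le> (LBINT s:{0..}. \<bar>exp (- s) * h s\<bar>)" for h :: "real \<Rightarrow> real"
    unfolding set_lebesgue_integral_def by (rule Bochner_Integration.integral_nonneg) simp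
  have A: "A \<ge> 0" unfolding A_def by (rule nonneg)
  have C0: "C \<ge> 0" using C[of 0] nonneg[of "\<phi> 0"] by linarith
  \<comment> \<open>Three errors are added: d C and d A from replacing k by g, and d from the
    convergence for g. Their sum is e / 2.\<close>
  define d where "d = e / (2 * (C + A + 1))"
  have d: "d > 0" using \<open>e > 0\<close> A C0 by (simp add: d_def)
  obtain g where g: "real_polynomial_function g" "\<And>x. x \<in> {0..1} \<Longrightarrow> \<bar>k x - g x\<bar> < d"
    using Stone_Weierstrass_real_polynomial_function[OF _ k d] by auto
  obtain c N where gc: "g = (\<lambda>x. \<Sum>i\<le>N. c i * x ^ i)"
    using g(1) unfolding real_polynomial_function_iff_sum by blast
  have gcont: "continuous_on {0..1} g" unfolding gc by (intro continuous_intros)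
  have kg: "\<bar>k x - g x\<bar> \<le> d" if "x \<in> {0..1}" for x using g(2)[OF that] by simp
  have "(\<lambda>n. exp_pairing g (\<phi> n)) \<longlonglongrightarrow> exp_pairing g \<psi>"
    unfolding gc exp_pairing_polynomial[OF \<phi>] exp_pairing_polynomial[OF \<psi>] by (intro tendsto_intros lap)
  then have "\<forall>\<^sub>F n in sequentially. dist (exp_pairing g (\<phi> n)) (exp_pairing g \<psi>) < d"
    using d by (rule tendstoD)
  then show "\<forall>\<^sub>F n in sequentially. dist (exp_pairing k (\<phi> n)) (exp_pairing k \<psi>) < e"
  proof eventually_elim
    case (elim n)
    have "\<bar>exp_pairing k (\<phi> n) - exp_pairing g (\<phi> n)\<bar> \<le> d * C"
      using exp_pairing_diff_le[OF k gcont kg \<phi>] C[of n] d by (meson mult_left_mono less_imp_le order_trans)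
    moreover have "\<bar>exp_pairing k \<psi> - exp_pairing g \<psi>\<bar> \<le> d * A"
      unfolding A_def by (rule exp_pairing_diff_le[OF k gcont kg \<psi>])
    ultimately have "dist (exp_pairing k (\<phi> n)) (exp_pairing k \<psi>) < d * C + d * A + d"
      using elim unfolding dist_real_def by linarith
    also have "\<dots> = d * (C + A + 1)" by (simp add: algebra_simps)
    also have "\<dots> = e / 2" using A C0 by (simp add: d_def add_pos_nonneg field_simps)
    also have "\<dots> < e" using \<open>e > 0\<close> by simp
    finally show ?case .
  qed
qed

lemma exp_pairing_localized:
  assumes k: "continuous_on {0..1} k" and \<phi>: "set_integrable lborel {0..} (\<lambda>s. exp (- s) * \<phi> s)"
    and nonneg: "\<And>x. k x \<ge> 0"
    and supp: "\<And>s. s \<ge> 0 \<Longrightarrow> k (exp (- s)) \<noteq> 0 \<Longrightarrow> \<bar>\<phi> s - v\<bar> \<le> e"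
  shows "\<bar>exp_pairing k \<phi> - exp_pairing k (\<lambda>_. 1) * v\<bar> \<le> exp_pairing k (\<lambda>_. 1) * e"
proof -
  have one: "set_integrable lborel {0..} (\<lambda>s. k (exp (- s)) * (exp (- s) * 1))"
    by (rule exp_pairing_integrable[OF k]) (use set_integrable_exp_minus(1)[of 1] in simp)
  have "exp_pairing k \<phi> - exp_pairing k (\<lambda>_. 1) * v =
      (LBINT s:{0..}. k (exp (- s)) * (exp (- s) * \<phi> s) - k (exp (- s)) * (exp (- s) * 1) * v)"
    using set_integral_diff(2)[OF exp_pairing_integrable[OF k \<phi>] set_integrable_mult_left[OF one, of v]]
    unfolding exp_pairing_def by simp
  also have "\<bar>\<dots>\<bar> \<le> (LBINT s:{0..}. k (exp (- s)) * (exp (- s) * 1) * e)"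
  proof (rule set_integral_abs_le)
    show "set_integrable lborel {0..} (\<lambda>s. k (exp (- s)) * (exp (- s) * \<phi> s) - k (exp (- s)) * (exp (- s) * 1) * v)"
      by (intro set_integral_diff(1) exp_pairing_integrable[OF k \<phi>] set_integrable_mult_left one)
    show "set_integrable lborel {0..} (\<lambda>s. k (exp (- s)) * (exp (- s) * 1) * e)"
      by (intro set_integrable_mult_left one)
    fix s :: real assume s: "s \<in> {0..}"
    have "k (exp (- s)) * (exp (- s) * \<phi> s) - k (exp (- s)) * (exp (- s) * 1) * v
        = (k (exp (- s)) * exp (- s)) * (\<phi> s - v)" by (simp add: algebra_simps)
    moreover have "\<bar>(k (exp (- s)) * exp (- s)) * (\<phi> s - v)\<bar> \<le> (k (exp (- s)) * exp (- s)) * e"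
    proof (cases "k (exp (- s)) = 0")
      case False
      then show ?thesis using nonneg[of "exp (- s)"] supp[of s] s by (simp add: abs_mult)
    qed simp
    ultimately show "\<bar>k (exp (- s)) * (exp (- s) * \<phi> s) - k (exp (- s)) * (exp (- s) * 1) * v\<bar>
        \<le> k (exp (- s)) * (exp (- s) * 1) * e" by simp
  qed
  finally show ?thesis unfolding exp_pairing_def by simp
qed

section \<open>Bumps to the right of a time, and pointwise convergence\<close>

text \<open>The positive part of a parabola in x = exp (-s) with zeros at s = t and s = t + d. The
  bump is one-sided because the limit function will be merely right-continuous.\<close>

definition tent :: "real \<Rightarrow> real \<Rightarrow> real \<Rightarrow> real" where
  "tent t d x = max 0 ((x - exp (- (t + d))) * (exp (- t) - x))"

lemma tent_nonneg: "tent t d x \<ge> 0"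
  by (simp add: tent_def)

lemma tent_continuous: "continuous_on S (tent t d)"
  unfolding tent_def by (intro continuous_intros)

lemma tent_support:
  assumes "tent t d (exp (- s)) \<noteq> 0" "d > 0"
  shows "t \<le> s" "s < t + d"
proof -
  have pos: "(exp (- s) - exp (- (t + d))) * (exp (- t) - exp (- s)) > 0"
    using assms(1) unfolding tent_def by linarith
  have lt: "exp (- (t + d)) < exp (- t)" using assms(2) by simp
  have "exp (- s) > exp (- (t + d)) \<and> exp (- t) > exp (- s)"
    using pos lt unfolding zero_less_mult_iff by linarith
  then show "t \<le> s" "s < t + d" by simp_all
qed

lemma exp_pairing_tent_pos:
  assumes "t \<ge> 0" "d > 0"
  shows "exp_pairing (tent t d) (\<lambda>_. 1) > 0"
proof -
  let ?S = "{t + d / 3..t + 2 * d / 3}"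
  \<comment> \<open>On the middle third, the first two factors of c are the least values of the two
    factors of the parabola, and the third is a lower bound for the weight exp (-s).\<close>
  define c where "c = (exp (- (t + 2 * d / 3)) - exp (- (t + d))) * (exp (- t) - exp (- (t + d / 3))) * exp (- (t + d))"
  have c: "c > 0" unfolding c_def using assms by (intro mult_pos_pos) auto
  have int: "set_integrable lborel {0..} (\<lambda>s. tent t d (exp (- s)) * (exp (- s) * 1))"
    by (rule exp_pairing_integrable[OF tent_continuous]) (use set_integrable_exp_minus(1)[of 1] in simp)
  have eq: "(\<lambda>x. indicat_real {0..} x * (c * indicat_real ?S x)) = (\<lambda>x. c * indicat_real ?S x)"
    using assms by (auto simp: indicator_def)
  have "0 < c * (d / 3)" using c assms by simp
  also have "c * (d / 3) = (LBINT s:{0..}. c * indicat_real ?S s)"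
    using assms unfolding set_lebesgue_integral_def real_scaleR_def eq by simp
  also have "\<dots> \<le> exp_pairing (tent t d) (\<lambda>_. 1)"
    unfolding exp_pairing_def
  proof (rule set_integral_mono[OF _ int])
    show "set_integrable lborel {0..} (\<lambda>s. c * indicat_real ?S s)"
      unfolding set_integrable_def real_scaleR_def eq
      by (intro integrable_mult_right integrable_real_indicator) (auto simp: emeasure_lborel_Icc_eq)
    fix s :: real assume "s \<in> {0..}"
    show "c * indicat_real ?S s \<le> tent t d (exp (- s)) * (exp (- s) * 1)"
    proof (cases "s \<in> ?S")
      case True
      have "c \<le> (exp (- s) - exp (- (t + d))) * (exp (- t) - exp (- s)) * exp (- s)"
        unfolding c_def using True assms by (intro mult_mono mult_nonneg_nonneg) auto
      also have "\<dots> \<le> tent t d (exp (- s)) * exp (- s)"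
        unfolding tent_def by (intro mult_right_mono) auto
      finally show ?thesis using True by simp
    qed (simp add: tent_nonneg)
  qed
  finally show ?thesis .
qed

text \<open>By Weierstrass, the measures
  \<open>exp (-s) \<phi>\<^sub>n s ds\<close> converge when tested against any continuous function of \<open>exp (-s)\<close>, in particular
  against bumps concentrated immediately to the right of \<open>t\<close>.\<close>

lemma tendsto_of_laplace_tendsto:
  fixes \<phi> :: "nat \<Rightarrow> real \<Rightarrow> real"
  assumes t: "t \<ge> 0"
    and meas: "\<And>n. set_borel_measurable borel {0..} (\<phi> n)"
    and bound: "\<And>n s. s \<ge> 0 \<Longrightarrow> \<bar>\<phi> n s\<bar> \<le> C"
    and \<psi>: "set_integrable lborel {0..} (\<lambda>s. exp (- s) * \<psi> s)"
    and lap: "\<And>m. (\<lambda>n. laplace (\<phi> n) (real (Suc m))) \<longlonglongrightarrow> laplace \<psi> (real (Suc m))"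
    and equicont: "\<And>e. e > 0 \<Longrightarrow> \<exists>d>0. \<forall>n s. t \<le> s \<and> s < t + d \<longrightarrow> \<bar>\<phi> n s - \<phi> n t\<bar> \<le> e"
    and cont: "\<And>e. e > 0 \<Longrightarrow> \<exists>d>0. \<forall>s. t \<le> s \<and> s < t + d \<longrightarrow> \<bar>\<psi> s - \<psi> t\<bar> \<le> e"
  shows "(\<lambda>n. \<phi> n t) \<longlonglongrightarrow> \<psi> t"
proof (rule tendstoI)
  fix e :: real assume "e > 0"
  \<comment> \<open>By equicontinuity d1 is independent of n, so one bump serves the whole
    sequence.\<close>
  obtain d1 where d1: "d1 > 0" "\<And>n s. t \<le> s \<Longrightarrow> s < t + d1 \<Longrightarrow> \<bar>\<phi> n s - \<phi> n t\<bar> \<le> e / 4"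
    using equicont[of "e / 4"] \<open>e > 0\<close> by auto
  obtain d2 where d2: "d2 > 0" "\<And>s. t \<le> s \<Longrightarrow> s < t + d2 \<Longrightarrow> \<bar>\<psi> s - \<psi> t\<bar> \<le> e / 4"
    using cont[of "e / 4"] \<open>e > 0\<close> by auto
  define d where "d = min d1 d2"
  have d: "d > 0" using d1 d2 by (simp add: d_def)
  let ?k = "tent t d"
  define M where "M = exp_pairing ?k (\<lambda>_. 1)"
  have M: "M > 0" unfolding M_def by (rule exp_pairing_tent_pos[OF t d])
  have \<phi>: "set_integrable lborel {0..} (\<lambda>s. exp (- s) * \<phi> n s)" for n
    using laplace_integrable_bounded[of 1, OF _ meas bound] by simp
  have C: "(LBINT s:{0..}. \<bar>exp (- s) * \<phi> n s\<bar>) \<le> C" for n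
  proof -
    have "(LBINT s:{0..}. \<bar>exp (- s) * \<phi> n s\<bar>) \<le> (LBINT s:{0..}. C * exp (- 1 * s))"
      using bound by (intro set_integral_mono set_integrable_abs \<phi> set_integrable_mult_right set_integrable_exp_minus)
        (auto simp: abs_mult mult.commute intro!: mult_right_mono)
    then show ?thesis using set_integrable_exp_minus(2)[of 1] by simp
  qed
  have "(\<lambda>n. exp_pairing ?k (\<phi> n)) \<longlonglongrightarrow> exp_pairing ?k \<psi>"
    by (rule exp_pairing_tendsto[OF tent_continuous \<phi> C \<psi> lap])
  then have "\<forall>\<^sub>F n in sequentially. dist (exp_pairing ?k (\<phi> n)) (exp_pairing ?k \<psi>) < M * (e / 4)"
    by (rule tendstoD) (use M \<open>e > 0\<close> in simp)
  then show "\<forall>\<^sub>F n in sequentially. dist (\<phi> n t) (\<psi> t) < e"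
  proof eventually_elim
    case (elim n)
    have "\<bar>exp_pairing ?k (\<phi> n) - M * \<phi> n t\<bar> \<le> M * (e / 4)"
      unfolding M_def
      by (rule exp_pairing_localized[OF tent_continuous \<phi> tent_nonneg])
        (rule d1(2); use tent_support[of t d] d in \<open>force simp: d_def\<close>)
    moreover have "\<bar>exp_pairing ?k \<psi> - M * \<psi> t\<bar> \<le> M * (e / 4)"
      unfolding M_def
      by (rule exp_pairing_localized[OF tent_continuous \<psi> tent_nonneg])
        (rule d2(2); use tent_support[of t d] d in \<open>force simp: d_def\<close>)
    \<comment> \<open>Two localisation errors and the difference of the pairings, each M e / 4 at
      most.\<close>
    ultimately have "\<bar>M * \<phi> n t - M * \<psi> t\<bar> < 3 * (M * (e / 4))"
      using elim unfolding dist_real_def by linarith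
    then have "M * \<bar>\<phi> n t - \<psi> t\<bar> < 3 * (M * (e / 4))"
      using M by (simp add: right_diff_distrib[symmetric] abs_mult)
    also have "\<dots> \<le> M * e" using M \<open>e > 0\<close> by simp
    finally show ?case using M by (simp add: dist_real_def)
  qed
qed

section \<open>The resolvent of a Doob process\<close>

lemma (in transition) trans_op_diff:
  assumes t: "t \<ge> 0" and f: "\<forall>j. \<bar>f j\<bar> \<le> C" and g: "\<forall>j. \<bar>g j\<bar> \<le> D"
  shows "trans_op p t (\<lambda>j. f j - g j) i = trans_op p t f i - trans_op p t g i"
  using sums_diff[OF trans_op_sums[OF t f, of i] trans_op_sums[OF t g, of i]]
  unfolding trans_op_def by (simp add: sums_iff right_diff_distrib)

locale doob_process = bd_chain +
  fixes \<nu> :: "nat \<Rightarrow> real" and \<gamma> :: real and pmin p :: "real \<Rightarrow> nat \<Rightarrow> nat \<Rightarrow> real"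
  assumes R_finite: "R_series a b < \<infinity>"
    and minimal: "minimal_Q_process a b pmin"
    and triple: "(\<gamma>, 0, \<nu>) \<in> Doob_triples a b"
    and determined: "determined_by a b pmin (\<gamma>, 0, \<nu>) p"
begin

lemma Q_process_p: "Q_process a b p"
  using determined by (simp add: determined_by_def)

sublocale transition p
  using Q_process_p by unfold_locales (simp add: Q_process_def)

sublocale min: transition pmin
  using minimal by unfold_locales (simp add: minimal_Q_process_def Q_process_def)

lemma \<gamma>_nonneg: "\<gamma> \<ge> 0" and \<nu>_nonneg: "\<nu> k \<ge> 0"
  using triple by (auto simp: Doob_triples_def Q_triples_def)

lemma \<nu>_summable: "summable \<nu>"
  using triple \<nu>_nonneg by (intro summable_suminf_not_top) (auto simp: Doob_triples_def total_mass_def)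

lemma \<nu>_pos: obtains k where "\<nu> k > 0"
proof -
  have "0 < total_mass \<nu>" using triple by (simp add: Doob_triples_def)
  then have "\<exists>k. \<nu> k \<noteq> 0" by (rule contrapos_pp) (simp add: total_mass_def)
  then obtain k where "\<nu> k \<noteq> 0" ..
  with \<nu>_nonneg[of k] show ?thesis by (intro that[of k]) simp
qed

definition mass :: real where "mass = (\<Sum>k. \<nu> k)"

lemma \<nu>_mult_summable:
  assumes "\<forall>k. \<bar>h k\<bar> \<le> C"
  shows "summable (\<lambda>k. \<nu> k * h k)"
proof (rule summable_comparison_test'[where N = 0])
  show "summable (\<lambda>k. \<nu> k * C)" by (intro summable_mult2 \<nu>_summable)
  show "norm (\<nu> k * h k) \<le> \<nu> k * C" for k
    using assms \<nu>_nonneg[of k] by (simp add: abs_mult mult_left_mono)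
qed

lemma \<nu>_partial_abs_le:
  assumes "\<forall>k. \<bar>h k\<bar> \<le> C"
  shows "\<bar>\<Sum>k<n. \<nu> k * h k\<bar> \<le> C * mass"
proof -
  have C: "C \<ge> 0" using spec[OF assms, of 0] by simp
  have "\<bar>\<Sum>k<n. \<nu> k * h k\<bar> \<le> (\<Sum>k<n. C * \<nu> k)"
    using assms \<nu>_nonneg
    by (intro order_trans[OF sum_abs] sum_mono) (auto simp: abs_mult mult.commute[of C] intro!: mult_left_mono)
  also have "\<dots> \<le> C * mass"
    unfolding sum_distrib_left[symmetric] mass_def
    using sum_le_suminf[OF \<nu>_summable] \<nu>_nonneg C by (intro mult_left_mono) auto
  finally show ?thesis .
qed

lemma \<nu>_suminf_abs_le:
  assumes "\<forall>k. \<bar>h k\<bar> \<le> C"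
  shows "\<bar>\<Sum>k. \<nu> k * h k\<bar> \<le> C * mass"
  using summable_LIMSEQ[OF \<nu>_mult_summable[OF assms]] \<nu>_partial_abs_le[OF assms]
  by (intro LIMSEQ_le_const2[OF tendsto_rabs]) auto

lemma mass_pos: "mass > 0"
proof -
  obtain k where "\<nu> k > 0" by (rule \<nu>_pos)
  with \<nu>_summable \<nu>_nonneg show ?thesis unfolding mass_def by (intro suminf_pos2[of _ k])
qed

section \<open>The boundary condition, and resolvents satisfying it\<close>

text \<open>The condition defining \<open>C_nu_gamma\<close>, for functions on N with L as value at
  infinity: L is the integral of h against the return distribution \<pi> = \<nu> / (\<gamma> +
  |\<nu>|), the killed part contributing 0.\<close>

definition constraint :: "(nat \<Rightarrow> real) \<Rightarrow> real \<Rightarrow> bool" where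
  "constraint h L \<longleftrightarrow> h \<longlonglongrightarrow> L \<and> L * (\<gamma> + mass) = (\<Sum>k. \<nu> k * h k)"

lemma constraint_bounded:
  assumes "constraint h L" obtains C where "\<forall>k. \<bar>h k\<bar> \<le> C"
  using assms convergent_imp_Bseq[of h] unfolding constraint_def Bseq_def convergent_def by auto

lemma constraint_diff:
  assumes "constraint g K" "constraint h L"
  shows "constraint (\<lambda>k. g k - h k) (K - L)"
proof -
  obtain C D where C: "\<forall>k. \<bar>g k\<bar> \<le> C" and D: "\<forall>k. \<bar>h k\<bar> \<le> D"
    using assms constraint_bounded by metis
  have "(\<Sum>k. \<nu> k * (g k - h k)) = (\<Sum>k. \<nu> k * g k) - (\<Sum>k. \<nu> k * h k)"
    unfolding right_diff_distrib by (rule suminf_diff[symmetric]) (intro \<nu>_mult_summable[OF C] \<nu>_mult_summable[OF D])+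
  then show ?thesis using assms unfolding constraint_def by (auto intro: tendsto_diff simp: left_diff_distrib)
qed

lemma u_fun_eq:
  assumes "\<alpha> > 0"
  shows "u_fun pmin \<alpha> i = 1 - \<alpha> * res_op pmin \<alpha> (\<lambda>_. 1) i"
  using min.res_op_sums[OF assms, of "\<lambda>_. 1" 1 i] by (simp add: u_fun_def sums_iff)

lemma u_fun_bounds:
  assumes \<alpha>: "\<alpha> > 0"
  shows "u_fun pmin \<alpha> i < 1" "u_fun pmin \<alpha> i \<ge> 0" "\<bar>u_fun pmin \<alpha> i\<bar> \<le> 1" "\<bar>1 - u_fun pmin \<alpha> i\<bar> \<le> 1"
proof -
  have "\<bar>res_op pmin \<alpha> (\<lambda>_. 1) i\<bar> \<le> 1 / \<alpha>" by (rule min.res_op_abs_le[OF \<alpha>]) simp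
  then have "res_op pmin \<alpha> (\<lambda>_. 1) i \<le> 1 / \<alpha>" by linarith
  then have "\<alpha> * res_op pmin \<alpha> (\<lambda>_. 1) i \<le> 1" using \<alpha> by (simp add: field_simps)
  moreover have "\<alpha> * res_op pmin \<alpha> (\<lambda>_. 1) i > 0"
    using \<alpha> res_op_minimal_one_pos[OF R_finite minimal \<alpha>] by simp
  ultimately show "u_fun pmin \<alpha> i < 1" "u_fun pmin \<alpha> i \<ge> 0"
    "\<bar>u_fun pmin \<alpha> i\<bar> \<le> 1" "\<bar>1 - u_fun pmin \<alpha> i\<bar> \<le> 1"
    unfolding u_fun_eq[OF \<alpha>] by auto
qed

lemma u_fun_tendsto:
  assumes "\<alpha> > 0" shows "u_fun pmin \<alpha> \<longlonglongrightarrow> 1"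
proof -
  have "(\<lambda>i. 1 - \<alpha> * res_op pmin \<alpha> (\<lambda>_. 1) i) \<longlonglongrightarrow> 1 - \<alpha> * 0"
    by (intro tendsto_intros res_op_minimal_tendsto[OF R_finite minimal assms, of _ 1]) simp
  moreover have "u_fun pmin \<alpha> = (\<lambda>i. 1 - \<alpha> * res_op pmin \<alpha> (\<lambda>_. 1) i)" using u_fun_eq[OF assms] by blast
  ultimately show ?thesis by simp
qed

definition denom :: "real \<Rightarrow> real" where
  "denom \<alpha> = \<gamma> + (\<Sum>k. \<nu> k * (1 - u_fun pmin \<alpha> k))"

text \<open>\<nu> charges some state k, and u < 1 there, so one term is strictly positive even when
  \<gamma> = 0.\<close>

lemma denom_pos:
  assumes "\<alpha> > 0" shows "denom \<alpha> > 0"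
proof -
  obtain k where "\<nu> k > 0" by (rule \<nu>_pos)
  then have "(\<Sum>k. \<nu> k * (1 - u_fun pmin \<alpha> k)) > 0"
    using u_fun_bounds[OF assms] \<nu>_nonneg
    by (intro suminf_pos2[of _ k] \<nu>_mult_summable[of _ 1]) (auto intro!: mult_nonneg_nonneg less_imp_le)
  then show ?thesis using \<gamma>_nonneg by (simp add: denom_def)
qed

lemma resolvent_eq:
  assumes "\<alpha> > 0"
  shows "resolvent p \<alpha> i j = resolvent pmin \<alpha> i j +
    u_fun pmin \<alpha> i * ((\<Sum>k. \<nu> k * resolvent pmin \<alpha> k j) / denom \<alpha>)"
  using determined assms by (simp add: determined_by_def denom_def)

text \<open>The resolvent formula integrated against g. The sums over j and k may be exchanged
  because the partial sums over j are bounded by C / \<alpha> uniformly in k and \<nu> is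
  finite.\<close>

lemma res_op_eq:
  assumes \<alpha>: "\<alpha> > 0" and g: "\<forall>j. \<bar>g j\<bar> \<le> C"
  shows "res_op p \<alpha> g i = res_op pmin \<alpha> g i +
    u_fun pmin \<alpha> i * ((\<Sum>k. \<nu> k * res_op pmin \<alpha> g k) / denom \<alpha>)"
proof -
  have C: "C \<ge> 0" using spec[OF g, of 0] by simp
  have part: "\<bar>\<Sum>j<J. resolvent pmin \<alpha> k j * g j\<bar> \<le> C / \<alpha>" for k J
  proof -
    have s1: "(\<lambda>j. resolvent pmin \<alpha> k j * 1) sums res_op pmin \<alpha> (\<lambda>_. 1) k"
      by (rule min.res_op_sums[OF \<alpha>, of _ 1]) simp
    have "(\<Sum>j<J. resolvent pmin \<alpha> k j) \<le> res_op pmin \<alpha> (\<lambda>_. 1) k"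
      using sum_le_suminf[of "resolvent pmin \<alpha> k" "{..<J}"] s1 min.resolvent_nonneg[OF \<alpha>]
      by (simp add: sums_iff)
    also have "\<dots> \<le> 1 / \<alpha>"
      using min.res_op_abs_le[OF \<alpha>, of "\<lambda>_. 1" 1 k] by simp
    finally have 1: "(\<Sum>j<J. resolvent pmin \<alpha> k j) \<le> 1 / \<alpha>" .
    have "\<bar>\<Sum>j<J. resolvent pmin \<alpha> k j * g j\<bar> \<le> (\<Sum>j<J. C * resolvent pmin \<alpha> k j)"
      using g min.resolvent_nonneg[OF \<alpha>]
      by (intro order_trans[OF sum_abs] sum_mono) (auto simp: abs_mult mult.commute intro!: mult_right_mono)
    also have "\<dots> \<le> C * (1 / \<alpha>)" unfolding sum_distrib_left[symmetric] using 1 C by (rule mult_left_mono)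
    finally show ?thesis by simp
  qed
  have x: "(\<lambda>j. \<nu> k * (resolvent pmin \<alpha> k j * g j)) sums (\<nu> k * res_op pmin \<alpha> g k)" for k
    by (intro sums_mult min.res_op_sums[OF \<alpha> g])
  have w: "\<bar>\<Sum>j<J. \<nu> k * (resolvent pmin \<alpha> k j * g j)\<bar> \<le> \<nu> k * (C / \<alpha>)" for k J
    unfolding sum_distrib_left[symmetric] abs_mult using \<nu>_nonneg[of k] part[of k J] mult_left_mono[OF part[of k J] \<nu>_nonneg[of k]] by simp
  have sw: "summable (\<lambda>k. \<nu> k * (C / \<alpha>))" by (intro summable_mult2 \<nu>_summable)
  have rb: "\<bar>resolvent pmin \<alpha> k j\<bar> \<le> 1 / \<alpha>" for k j
    unfolding min.resolvent_eq_laplace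
    by (rule laplace_abs_le[OF \<alpha> min.measurable_p]) (use min.p_nonneg min.p_le_one in auto)
  have "(\<Sum>k. \<nu> k * (resolvent pmin \<alpha> k j * g j)) = (\<Sum>k. \<nu> k * resolvent pmin \<alpha> k j) * g j" for j
    using suminf_mult2[OF \<nu>_mult_summable[of "\<lambda>k. resolvent pmin \<alpha> k j" "1 / \<alpha>"], of "g j"] rb
    by (simp add: mult.assoc)
  with sums_swap[OF x w sw]
  have "(\<lambda>j. (\<Sum>k. \<nu> k * resolvent pmin \<alpha> k j) * g j) sums (\<Sum>k. \<nu> k * res_op pmin \<alpha> g k)" by simp
  from sums_add[OF min.res_op_sums[OF \<alpha> g, of i] sums_mult[OF this, of "u_fun pmin \<alpha> i / denom \<alpha>"]]
  have "(\<lambda>j. resolvent p \<alpha> i j * g j) sums (res_op pmin \<alpha> g i +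
      u_fun pmin \<alpha> i * ((\<Sum>k. \<nu> k * res_op pmin \<alpha> g k) / denom \<alpha>))"
    unfolding resolvent_eq[OF \<alpha>] by (simp add: algebra_simps)
  with res_op_sums[OF \<alpha> g, of i] show ?thesis by (rule sums_unique2)
qed

text \<open>The minimal part vanishes at infinity and u tends to 1, so the limit is the quotient c.
  Since the denominator is \<gamma> + |\<nu>| - \<nu>(u), the product c (\<gamma> + |\<nu>|) equals
  \<nu>(G) + c \<nu>(u), the \<nu>-sum of the resolvent.\<close>

lemma res_op_constraint:
  assumes \<alpha>: "\<alpha> > 0" and g: "\<forall>j. \<bar>g j\<bar> \<le> C"
  shows "constraint (res_op p \<alpha> g) ((\<Sum>k. \<nu> k * res_op pmin \<alpha> g k) / denom \<alpha>)"
proof -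
  let ?G = "\<lambda>k. res_op pmin \<alpha> g k" and ?u = "u_fun pmin \<alpha>"
  define c where "c = (\<Sum>k. \<nu> k * ?G k) / denom \<alpha>"
  have R: "res_op p \<alpha> g = (\<lambda>i. ?G i + ?u i * c)"
    unfolding c_def using res_op_eq[OF \<alpha> g] by blast
  have "(\<lambda>i. ?G i + ?u i * c) \<longlonglongrightarrow> 0 + 1 * c"
    by (intro tendsto_intros res_op_minimal_tendsto[OF R_finite minimal \<alpha> g] u_fun_tendsto[OF \<alpha>])
  moreover have "c * (\<gamma> + mass) = (\<Sum>k. \<nu> k * (?G k + ?u k * c))"
  proof -
    have sG: "summable (\<lambda>k. \<nu> k * ?G k)"
      by (rule \<nu>_mult_summable) (use min.res_op_abs_le[OF \<alpha> g] in blast)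
    have su: "summable (\<lambda>k. \<nu> k * ?u k)"
      by (rule \<nu>_mult_summable) (use u_fun_bounds[OF \<alpha>] in blast)
    have "denom \<alpha> = \<gamma> + (mass - (\<Sum>k. \<nu> k * ?u k))"
      unfolding denom_def mass_def suminf_diff[OF \<nu>_summable su] by (simp add: right_diff_distrib)
    moreover have "c * denom \<alpha> = (\<Sum>k. \<nu> k * ?G k)" using denom_pos[OF \<alpha>] by (simp add: c_def)
    moreover have "(\<Sum>k. \<nu> k * (?G k + ?u k * c)) = (\<Sum>k. \<nu> k * ?G k) + (\<Sum>k. \<nu> k * ?u k) * c"
      unfolding suminf_mult2[OF su] suminf_add[OF sG summable_mult2[OF su]] by (simp add: algebra_simps)
    moreover have "c * (\<gamma> + mass) = c * (\<gamma> + (mass - (\<Sum>k. \<nu> k * ?u k))) + (\<Sum>k. \<nu> k * ?u k) * c"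
      by (simp add: algebra_simps)
    ultimately show ?thesis by simp
  qed
  ultimately show ?thesis unfolding constraint_def R c_def by simp
qed

text \<open>Nonzero solutions of \<open>h = Q h\<close> are strictly monotone, so their value at infinity exceeds every
  average of their other values in modulus.\<close>

lemma eigenfunction_zero:
  assumes Q: "\<And>k. Q_operator a b h k = h k" and c: "constraint h L"
  shows "h k = 0"
proof -
  have not_pos: "\<not> h 0 > 0" if Q: "\<And>k. Q_operator a b h k = h k" and c: "constraint h L" for h L
  proof
    assume h0: "h 0 > 0"
    \<comment> \<open>The equation as a recursion for increments: once h is positive and increasing
      it stays so. At k = 0 the last term disappears with \<open>a 0\<close>.\<close>
    have step: "b k * (h (Suc k) - h k) = h k + a k * (h k - h (k - 1))" for k
      using Q[of k] a0 by (cases k) (auto simp: Q_operator_def algebra_simps)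
    have inc: "h k > 0 \<and> h (Suc k) > h k" for k
    proof (induction k)
      case 0
      have "b 0 * (h 1 - h 0) > 0" using step[of 0] a0 h0 by simp
      then show ?case using b_pos[of 0] h0 by (simp add: zero_less_mult_iff)
    next
      case (Suc k)
      have "b (Suc k) * (h (Suc (Suc k)) - h (Suc k)) > 0"
        unfolding step using Suc a_nonneg[of "Suc k"] by (simp add: add_pos_nonneg)
      then show ?case using b_pos[of "Suc k"] Suc by (simp add: zero_less_mult_iff)
    qed
    then have "incseq h" by (intro incseq_SucI) (simp add: less_imp_le)
    then have le: "h k \<le> L" for k using c incseq_le unfolding constraint_def by blast
    have lt: "h k < L" for k using le[of "Suc k"] inc[of k] by linarith
    have L: "L > 0" using lt[of 0] h0 by linarith
    obtain C where C: "\<forall>k. \<bar>h k\<bar> \<le> C" using constraint_bounded[OF c] .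
    obtain k where k: "\<nu> k > 0" by (rule \<nu>_pos)
    \<comment> \<open>This sum is strictly positive by monotonicity, whereas the boundary condition
      makes it equal to - L \<gamma>, which is at most 0.\<close>
    have "(\<Sum>k. \<nu> k * (L - h k)) > 0"
    proof (rule suminf_pos2)
      show "summable (\<lambda>k. \<nu> k * (L - h k))"
        unfolding right_diff_distrib by (intro summable_diff summable_mult2 \<nu>_summable \<nu>_mult_summable[OF C])
      show "0 \<le> \<nu> k * (L - h k)" for k using \<nu>_nonneg lt[of k] by simp
      show "0 < \<nu> k * (L - h k)" using k lt[of k] by simp
    qed
    also have "(\<Sum>k. \<nu> k * (L - h k)) = mass * L - (\<Sum>k. \<nu> k * h k)"
      unfolding mass_def right_diff_distrib suminf_mult2[OF \<nu>_summable]
      by (rule suminf_diff[symmetric]) (intro summable_mult2 \<nu>_summable \<nu>_mult_summable[OF C])+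
    also have "\<dots> = - (L * \<gamma>)" using c by (simp add: constraint_def algebra_simps)
    finally show False using L \<gamma>_nonneg by (simp add: mult_less_0_iff)
  qed
  have zero: "constraint (\<lambda>_. 0) 0" by (simp add: constraint_def)
  have "\<not> h 0 > 0" by (rule not_pos[OF Q c])
  moreover have "\<not> - h 0 > 0"
  proof (rule not_pos[of "\<lambda>k. - h k"])
    show "constraint (\<lambda>k. - h k) (- L)" using constraint_diff[OF zero c] by simp
    show "Q_operator a b (\<lambda>k. - h k) k = - h k" for k
      using Q[of k] by (auto simp: Q_operator_def algebra_simps)
  qed
  ultimately have h0: "h 0 = 0" by simp
  \<comment> \<open>Once h(0) = 0, the equation at 0 gives h(1) = 0, and the second-order recursion
    propagates zero.\<close>
  have "h k = 0 \<and> h (Suc k) = 0" for k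
  proof (induction k)
    case 0
    then show ?case using Q[of 0] h0 b_pos[of 0] by (simp add: Q_operator_def)
  next
    case (Suc k)
    then show ?case using Q[of "Suc k"] b_pos[of "Suc k"] by (simp add: Q_operator_def)
  qed
  then show ?thesis by blast
qed

text \<open>Both sides solve h - Q h = F - Q F, the right one by \<open>Q_operator_res_op\<close>,
  and both satisfy the boundary condition; \<open>eigenfunction_zero\<close> removes the
  difference.\<close>

lemma constraint_eq_res_op:
  assumes F: "constraint F L" and g: "\<forall>k. \<bar>F k - Q_operator a b F k\<bar> \<le> C"
  shows "F = res_op p 1 (\<lambda>k. F k - Q_operator a b F k)"
proof
  fix i
  let ?R = "res_op p 1 (\<lambda>k. F k - Q_operator a b F k)"
  have "F i - ?R i = 0"
  proof (rule eigenfunction_zero)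
    show "constraint (\<lambda>k. F k - ?R k) (L - (\<Sum>k. \<nu> k * res_op pmin 1 (\<lambda>k. F k - Q_operator a b F k) k) / denom 1)"
      by (rule constraint_diff[OF F res_op_constraint[OF _ g]]) simp
    fix k
    have "Q_operator a b (\<lambda>k. F k - ?R k) k = Q_operator a b F k - Q_operator a b ?R k"
      by (simp add: Q_operator_def algebra_simps)
    then show "Q_operator a b (\<lambda>k. F k - ?R k) k = F k - ?R k"
      using Q_operator_res_op[OF Q_process_p a0 g, of k] by simp
  qed
  then show "F i = ?R i" by simp
qed

section \<open>Strong continuity on the states in N\<close>

text \<open>Flattening F to L far out changes its \<nu>-sum by \<delta>. Adding \<delta> / \<nu>(k0)
  at one state k0 charged by \<nu> restores the sum and leaves the limit alone.\<close>

lemma eventually_constant_approximation: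
  assumes F: "constraint F L" and "e > 0"
  obtains F' N where "constraint F' L" "\<And>k. k \<ge> N \<Longrightarrow> F' k = L" "\<And>k. \<bar>F k - F' k\<bar> \<le> e"
proof -
  obtain k0 where k0: "\<nu> k0 > 0" by (rule \<nu>_pos)
  \<comment> \<open>Flattening costs at most e' and the correction at k0 at most e' |\<nu>| /
    \<nu>(k0); together they make e.\<close>
  define e' where "e' = e / (1 + mass / \<nu> k0)"
  have pos: "1 + mass / \<nu> k0 > 0" using k0 mass_pos by (simp add: add_pos_pos)
  have e': "e' > 0" using \<open>e > 0\<close> pos by (simp add: e'_def)
  have "F \<longlonglongrightarrow> L" using F by (simp add: constraint_def)
  then obtain n where n: "\<And>k. k \<ge> n \<Longrightarrow> \<bar>F k - L\<bar> < e'"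
    using e' unfolding lim_sequentially dist_real_def by blast
  define D where "D k = (if k < n then 0 else F k - L)" for k
  have D: "\<forall>k. \<bar>D k\<bar> \<le> e'" using n e' by (auto simp: D_def intro: less_imp_le)
  define \<delta> where "\<delta> = (\<Sum>k. \<nu> k * D k)"
  have \<delta>: "\<bar>\<delta>\<bar> \<le> e' * mass" unfolding \<delta>_def by (rule \<nu>_suminf_abs_le[OF D])
  define F' where "F' k = F k - D k + (if k = k0 then \<delta> / \<nu> k0 else 0)" for k
  define N where "N = max n (Suc k0)"
  have N: "F' k = L" if "k \<ge> N" for k using that by (auto simp: F'_def D_def N_def)
  obtain C where C: "\<forall>k. \<bar>F k\<bar> \<le> C" using constraint_bounded[OF F] .
  have "(\<lambda>k. \<nu> k * F k - \<nu> k * D k + (if k = k0 then \<nu> k * (\<delta> / \<nu> k0) else 0)) sums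
      ((\<Sum>k. \<nu> k * F k) - \<delta> + \<nu> k0 * (\<delta> / \<nu> k0))"
    unfolding \<delta>_def
    by (intro sums_add sums_diff summable_sums \<nu>_mult_summable[OF C] \<nu>_mult_summable[OF D] sums_single)
  moreover have "(\<lambda>k. \<nu> k * F k - \<nu> k * D k + (if k = k0 then \<nu> k * (\<delta> / \<nu> k0) else 0)) = (\<lambda>k. \<nu> k * F' k)"
    by (auto simp: F'_def algebra_simps)
  ultimately have "(\<Sum>k. \<nu> k * F' k) = (\<Sum>k. \<nu> k * F k)" using k0 by (simp add: sums_iff)
  moreover have "F' \<longlonglongrightarrow> L"
    using N by (intro tendsto_eventually) (auto simp: eventually_sequentially)
  ultimately have "constraint F' L" using F by (simp add: constraint_def)
  moreover have "\<bar>F k - F' k\<bar> \<le> e" for k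
  proof -
    have "\<bar>F k - F' k\<bar> \<le> \<bar>D k\<bar> + \<bar>\<delta>\<bar> / \<nu> k0" using k0 abs_triangle_ineq4[of "D k0" "\<delta> / \<nu> k0"] by (auto simp: F'_def)
    also have "\<dots> \<le> e' + e' * mass / \<nu> k0"
      using D \<delta> k0 by (intro add_mono divide_right_mono) auto
    also have "\<dots> = e' * (1 + mass / \<nu> k0)" by (simp add: algebra_simps)
    also have "\<dots> = e" using pos by (simp add: e'_def)
    finally show ?thesis .
  qed
  ultimately show ?thesis using that N by blast
qed

text \<open>For an eventually constant F', the function F' - Q F' is bounded, so F' is a resolvent
  and P(t) F' - F' is O(t) uniformly in the state. Contractivity carries this to F.\<close>

lemma strong_continuity:
  assumes F: "constraint F L" and "e > 0"
  obtains d where "d > 0" "\<And>t i. 0 \<le> t \<Longrightarrow> t < d \<Longrightarrow> \<bar>trans_op p t F i - F i\<bar> \<le> e"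
proof -
  obtain F' N where F': "constraint F' L" "\<And>k. k \<ge> N \<Longrightarrow> F' k = L" "\<And>k. \<bar>F k - F' k\<bar> \<le> e / 3"
    using eventually_constant_approximation[OF F, of "e / 3"] \<open>e > 0\<close> by auto
  obtain C where C: "\<forall>k. \<bar>F k\<bar> \<le> C" using constraint_bounded[OF F] .
  obtain C' where C': "\<forall>k. \<bar>F' k\<bar> \<le> C'" using constraint_bounded[OF F'(1)] .
  define g where "g k = F' k - Q_operator a b F' k" for k
  have "Q_operator a b F' k = 0" if "k \<ge> Suc N" for k
    using that F'(2) by (simp add: Q_operator_def algebra_simps)
  then have "g \<longlonglongrightarrow> L"
    using F'(2) by (intro tendsto_eventually) (auto simp: eventually_sequentially g_def intro!: exI[of _ "Suc N"])
  then obtain B where B: "\<forall>k. \<bar>g k\<bar> \<le> B"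
    using convergent_imp_Bseq[of g] unfolding Bseq_def convergent_def by auto
  have F'g: "F' = res_op p 1 g"
    unfolding g_def by (rule constraint_eq_res_op[OF F'(1)]) (use B in \<open>simp add: g_def\<close>)
  have B0: "B \<ge> 0" using spec[OF B, of 0] by simp
  define K where "K = 2 * B * exp 1 + 2 * B + 1"
  have K: "K > 0" using B0 by (simp add: K_def add_nonneg_pos)
  have F'B: "\<bar>F' i\<bar> \<le> B" for i using res_op_abs_le[OF _ B, where \<alpha> = 1 and i = i] F'g by simp
  have est: "\<bar>trans_op p t F' i - F' i\<bar> \<le> t * K" if t: "0 \<le> t" "t \<le> 1" for t i
  proof -
    \<comment> \<open>The trivial modulus 2 B suffices for a bound of order t; g need not satisfy
      the boundary condition.\<close>
    have "\<bar>trans_op p s g i - g i\<bar> \<le> 2 * B" if "0 \<le> s" for s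
      using trans_op_abs_le[OF that B, of i] spec[OF B, of i] by linarith
    then have "\<bar>trans_op p t F' i - F' i - t * (F' i - g i)\<bar> \<le> t * (2 * B * (exp t - 1) + 2 * B)"
      unfolding F'g by (intro trans_op_res_op_estimate[OF t(1) B]) auto
    also have "\<dots> \<le> t * (2 * B * exp 1)"
      using t B0 by (intro mult_left_mono) (auto simp: algebra_simps intro!: mult_left_mono)
    finally have 1: "\<bar>trans_op p t F' i - F' i - t * (F' i - g i)\<bar> \<le> t * (2 * B * exp 1)" .
    have "\<bar>t * (F' i - g i)\<bar> \<le> t * (2 * B)"
      unfolding abs_mult using t F'B[of i] spec[OF B, of i] by (intro mult_mono) auto
    with 1 have "\<bar>trans_op p t F' i - F' i\<bar> \<le> t * (2 * B * exp 1) + t * (2 * B)" by linarith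
    also have "\<dots> \<le> t * K" using t unfolding K_def by (simp add: algebra_simps)
    finally show ?thesis .
  qed
  define d where "d = min 1 (e / (3 * K))"
  have "\<bar>trans_op p t F i - F i\<bar> \<le> e" if t: "0 \<le> t" "t < d" for t i
  proof -
    have FF: "\<forall>k. \<bar>F k - F' k\<bar> \<le> e / 3" using F'(3) by simp
    have "t * K \<le> e / 3" using t K by (simp add: d_def field_simps)
    moreover have "\<bar>trans_op p t F i - trans_op p t F' i\<bar> \<le> e / 3"
      using trans_op_abs_le[OF t(1) FF, of i] trans_op_diff[OF t(1) C C', of i] by simp
    moreover have "\<bar>trans_op p t F' i - F' i\<bar> \<le> t * K" by (rule est) (use t in \<open>auto simp: d_def\<close>)
    ultimately show ?thesis using F'(3)[of i] by linarith
  qed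
  moreover have "d > 0" using \<open>e > 0\<close> K by (simp add: d_def)
  ultimately show ?thesis using that by blast
qed

text \<open>Here the short-time operator acts first: P(t) F - P(s) F is P(s) applied to P(t - s) F -
  F. Contractivity of P(s) keeps the bound uniform in i, unlike in
  \<open>trans_op_modulus\<close>.\<close>

lemma uniform_continuity:
  assumes F: "constraint F L" and "e > 0"
  obtains d where "d > 0"
    "\<And>s t i. 0 \<le> s \<Longrightarrow> s \<le> t \<Longrightarrow> t < s + d \<Longrightarrow> \<bar>trans_op p t F i - trans_op p s F i\<bar> \<le> e"
proof -
  obtain C where C: "\<forall>k. \<bar>F k\<bar> \<le> C" using constraint_bounded[OF F] .
  obtain d where d: "d > 0" "\<And>t i. 0 \<le> t \<Longrightarrow> t < d \<Longrightarrow> \<bar>trans_op p t F i - F i\<bar> \<le> e"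
    using strong_continuity[OF F \<open>e > 0\<close>] by blast
  have "\<bar>trans_op p t F i - trans_op p s F i\<bar> \<le> e" if "0 \<le> s" "s \<le> t" "t < s + d" for s t i
  proof -
    have h: "0 \<le> t - s" "t - s < d" using that by auto
    have b: "\<forall>k. \<bar>trans_op p (t - s) F k - F k\<bar> \<le> e" using d(2)[OF h] by simp
    have "trans_op p t F i = trans_op p s (trans_op p (t - s) F) i"
      using trans_op_add[OF \<open>0 \<le> s\<close> h(1) C, of i] by simp
    then have "trans_op p t F i - trans_op p s F i = trans_op p s (\<lambda>k. trans_op p (t - s) F k - F k) i"
      using trans_op_diff[OF \<open>0 \<le> s\<close> trans_op_bounded[OF h(1) C] C] by simp
    then show ?thesis using trans_op_abs_le[OF \<open>0 \<le> s\<close> b, of i] by simp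
  qed
  with d(1) show ?thesis using that by blast
qed

section \<open>The boundary condition at a fixed time\<close>

text \<open>Two uses of \<open>tendsto_of_laplace_tendsto\<close> with the same target \<psi>: for
  the values at the states n, and for the partial \<nu>-sums divided by \<gamma> + |\<nu>|. In the
  second case the Laplace transforms converge to that of \<psi> because resolvents satisfy the
  boundary condition.\<close>

lemma trans_op_constraint:
  fixes \<psi> :: "real \<Rightarrow> real"
  assumes F: "constraint F L" and t: "t \<ge> 0"
    and \<psi>_cont: "\<And>e. e > 0 \<Longrightarrow> \<exists>d>0. \<forall>s. t \<le> s \<and> s < t + d \<longrightarrow> \<bar>\<psi> s - \<psi> t\<bar> \<le> e"
    and \<psi>_int: "set_integrable lborel {0..} (\<lambda>s. exp (- s) * \<psi> s)"
    and lap: "\<And>\<alpha>. \<alpha> > 0 \<Longrightarrow> res_op p \<alpha> F \<longlonglongrightarrow> laplace \<psi> \<alpha>"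
  shows "constraint (trans_op p t F) (\<psi> t)"
proof -
  obtain C where C: "\<forall>k. \<bar>F k\<bar> \<le> C" using constraint_bounded[OF F] .
  have C0: "C \<ge> 0" using spec[OF C, of 0] by simp
  have "(\<lambda>n. trans_op p t F n) \<longlonglongrightarrow> \<psi> t"
  proof (rule tendsto_of_laplace_tendsto[OF t _ _ \<psi>_int _ _ \<psi>_cont])
    show "set_borel_measurable borel {0..} (\<lambda>t. trans_op p t F n)" for n by (rule measurable_trans_op[OF C])
    show "\<bar>trans_op p s F n\<bar> \<le> C" if "s \<ge> 0" for n s by (rule trans_op_abs_le[OF that C])
    show "(\<lambda>n. laplace (\<lambda>t. trans_op p t F n) (real (Suc m))) \<longlonglongrightarrow> laplace \<psi> (real (Suc m))" for m
      using lap[of "real (Suc m)"] unfolding res_op_def[abs_def] by simp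
    show "\<exists>d>0. \<forall>n s. t \<le> s \<and> s < t + d \<longrightarrow> \<bar>trans_op p s F n - trans_op p t F n\<bar> \<le> e" if "e > 0" for e
      using uniform_continuity[OF F that] t by metis
  qed
  moreover have "(\<lambda>n. (\<Sum>k<n. \<nu> k * trans_op p t F k) / (\<gamma> + mass)) \<longlonglongrightarrow> \<psi> t"
  proof (rule tendsto_of_laplace_tendsto[OF t _ _ \<psi>_int _ _ \<psi>_cont])
    have pos: "\<gamma> + mass > 0" using mass_pos \<gamma>_nonneg by simp
    have avg: "\<bar>(\<Sum>k<n. \<nu> k * h k) / (\<gamma> + mass)\<bar> \<le> D" if h: "\<forall>k. \<bar>h k\<bar> \<le> D" for h n D
    proof -
      have "D \<ge> 0" using spec[OF h, of 0] by simp
      have "\<bar>\<Sum>k<n. \<nu> k * h k\<bar> \<le> D * mass" by (rule \<nu>_partial_abs_le[OF h])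
      also have "\<dots> \<le> D * (\<gamma> + mass)" using \<gamma>_nonneg \<open>D \<ge> 0\<close> by (intro mult_left_mono) auto
      finally show ?thesis using pos by (simp add: field_simps)
    qed
    have meas: "continuous_on {0..} (\<lambda>t. trans_op p t F k)" for k by (rule continuous_on_trans_op[OF C])
    show "set_borel_measurable borel {0..} (\<lambda>t. (\<Sum>k<n. \<nu> k * trans_op p t F k) / (\<gamma> + mass))" for n
      by (rule set_measurable_continuous_on) (use pos in \<open>auto intro!: continuous_intros meas\<close>)
    show "\<bar>(\<Sum>k<n. \<nu> k * trans_op p s F k) / (\<gamma> + mass)\<bar> \<le> C" if "s \<ge> 0" for n s
      by (rule avg[OF trans_op_bounded[OF that C]])
    show "(\<lambda>n. laplace (\<lambda>t. (\<Sum>k<n. \<nu> k * trans_op p t F k) / (\<gamma> + mass)) (real (Suc m)))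
        \<longlonglongrightarrow> laplace \<psi> (real (Suc m))" for m
    proof -
      let ?\<alpha> = "real (Suc m)"
      have \<alpha>: "?\<alpha> > 0" by simp
      have int: "set_integrable lborel {0..} (\<lambda>t. exp (- ?\<alpha> * t) * (\<nu> k / (\<gamma> + mass) * trans_op p t F k))" for k
        using set_integrable_mult_right[OF trans_op_laplace_integrable[OF \<alpha> C, where i = k], of "\<nu> k / (\<gamma> + mass)"]
        by (simp add: mult.left_commute)
      have eq: "laplace (\<lambda>t. (\<Sum>k<n. \<nu> k * trans_op p t F k) / (\<gamma> + mass)) ?\<alpha> =
          (\<Sum>k<n. \<nu> k * res_op p ?\<alpha> F k) / (\<gamma> + mass)" for n
      proof -
        have "laplace (\<lambda>t. \<Sum>k<n. \<nu> k / (\<gamma> + mass) * trans_op p t F k) ?\<alpha> =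
            (\<Sum>k<n. laplace (\<lambda>t. \<nu> k / (\<gamma> + mass) * trans_op p t F k) ?\<alpha>)"
          by (rule laplace_sum) (rule int)
        then show ?thesis
          unfolding laplace_cmult res_op_def[symmetric] by (simp add: sum_divide_distrib del: of_nat_Suc)
      qed
      obtain c where c: "constraint (res_op p ?\<alpha> F) c" using res_op_constraint[OF \<alpha> C] by blast
      \<comment> \<open>Both are the limit at infinity of the resolvent of F.\<close>
      have "laplace \<psi> ?\<alpha> = c"
        using c lap[OF \<alpha>] LIMSEQ_unique unfolding constraint_def by blast
      moreover have "\<forall>k. \<bar>res_op p ?\<alpha> F k\<bar> \<le> C / ?\<alpha>" using res_op_abs_le[OF \<alpha> C] by blast
      then have "(\<lambda>n. (\<Sum>k<n. \<nu> k * res_op p ?\<alpha> F k) / (\<gamma> + mass)) \<longlonglongrightarrow>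
          (\<Sum>k. \<nu> k * res_op p ?\<alpha> F k) / (\<gamma> + mass)"
        using pos by (intro tendsto_divide tendsto_const summable_LIMSEQ \<nu>_mult_summable) auto
      moreover have "(\<Sum>k. \<nu> k * res_op p ?\<alpha> F k) / (\<gamma> + mass) = c"
        using c pos unfolding constraint_def by (metis less_irrefl nonzero_mult_div_cancel_right)
      ultimately show ?thesis unfolding eq by simp
    qed
    show "\<exists>d>0. \<forall>n s. t \<le> s \<and> s < t + d \<longrightarrow>
        \<bar>(\<Sum>k<n. \<nu> k * trans_op p s F k) / (\<gamma> + mass) - (\<Sum>k<n. \<nu> k * trans_op p t F k) / (\<gamma> + mass)\<bar> \<le> e"
      if "e > 0" for e
    proof -
      obtain d where d: "d > 0"
        "\<And>s t i. 0 \<le> s \<Longrightarrow> s \<le> t \<Longrightarrow> t < s + d \<Longrightarrow> \<bar>trans_op p t F i - trans_op p s F i\<bar> \<le> e"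
        using uniform_continuity[OF F \<open>e > 0\<close>] by blast
      have "\<bar>(\<Sum>k<n. \<nu> k * trans_op p s F k) / (\<gamma> + mass) - (\<Sum>k<n. \<nu> k * trans_op p t F k) / (\<gamma> + mass)\<bar> \<le> e"
        if s: "t \<le> s" "s < t + d" for n s
      proof -
        have "\<forall>k. \<bar>trans_op p s F k - trans_op p t F k\<bar> \<le> e" using d(2)[OF t s] by simp
        from avg[OF this, of n] show ?thesis
          by (simp add: diff_divide_distrib[symmetric] sum_subtractf[symmetric] right_diff_distrib)
      qed
      with d(1) show ?thesis by blast
    qed
  qed
  then have "(\<lambda>n. (\<Sum>k<n. \<nu> k * trans_op p t F k) / (\<gamma> + mass) * (\<gamma> + mass)) \<longlonglongrightarrow> \<psi> t * (\<gamma> + mass)"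
    by (rule tendsto_mult_right)
  then have "(\<lambda>n. \<Sum>k<n. \<nu> k * trans_op p t F k) \<longlonglongrightarrow> \<psi> t * (\<gamma> + mass)"
    using mass_pos \<gamma>_nonneg by simp
  then have "(\<Sum>k. \<nu> k * trans_op p t F k) = \<psi> t * (\<gamma> + mass)"
    by (simp add: sums_def[symmetric] sums_iff)
  ultimately show ?thesis by (simp add: constraint_def)
qed

end

section \<open>Continuous functions on the compactified state space\<close>

lemma apply_bcontfun_Fin_tendsto:
  fixes F :: "state \<Rightarrow>\<^sub>C real"
  shows "(\<lambda>k. F (Fin k)) \<longlonglongrightarrow> F Infty"
  by (rule continuous_on_tendsto_compose[OF continuous_on_apply_bcontfun[of UNIV F] Fin_tendsto_Infty]) auto

lemma abs_apply_bcontfun_le: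
  fixes F :: "state \<Rightarrow>\<^sub>C real"
  shows "\<bar>F x\<bar> \<le> norm F"
  using norm_bounded[of F x] by simp

lemma apply_bounded: "\<forall>k. \<bar>apply_bcontfun f (Fin k)\<bar> \<le> norm f"
  for f :: "state \<Rightarrow>\<^sub>C real"
  using abs_apply_bcontfun_le by blast

lemma bounded_linear_apply: "bounded_linear (\<lambda>F :: state \<Rightarrow>\<^sub>C real. F x)"
  by (rule bounded_linear_intro[of _ 1])
    (simp_all add: plus_bcontfun.rep_eq scaleR_bcontfun.rep_eq abs_apply_bcontfun_le)

text \<open>The states in N accumulate at infinity and the cemetery carries 0, so equality, like the
  norm bound below, can be checked on N.\<close>

lemma C_bar_eqI:
  assumes F: "F \<in> C_bar" and G: "G \<in> C_bar" and eq: "\<And>k. F (Fin k) = G (Fin k)"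
  shows "F = G"
proof (rule bcontfun_eqI)
  fix x
  have "F Infty = G Infty"
    using LIMSEQ_unique[OF apply_bcontfun_Fin_tendsto[of F]] apply_bcontfun_Fin_tendsto[of G] eq by simp
  then show "F x = G x" using F G eq by (cases x) (auto simp: C_bar_def)
qed

lemma norm_le_of_Fin:
  assumes F: "F \<in> C_bar" and C: "\<And>k. \<bar>F (Fin k)\<bar> \<le> C"
  shows "norm F \<le> C"
proof (rule norm_bound)
  have "C \<ge> 0" using C[of 0] by simp
  moreover have "\<bar>F Infty\<bar> \<le> C"
    by (rule LIMSEQ_le_const2[OF tendsto_rabs[OF apply_bcontfun_Fin_tendsto]]) (use C in auto)
  ultimately show "norm (F x) \<le> C" for x
    using F C by (cases x) (auto simp: C_bar_def)
qed

section \<open>The space of continuous functions with the boundary condition\<close>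

context doob_process
begin

text \<open>The boundary condition as a bounded linear functional: the space is an intersection of
  two kernels, hence a closed subspace.\<close>

definition boundary :: "(state \<Rightarrow>\<^sub>C real) \<Rightarrow> real" where
  "boundary F = F Infty * (\<gamma> + mass) - (\<Sum>k. \<nu> k * F (Fin k))"

lemma \<nu>_apply_summable: "summable (\<lambda>k. \<nu> k * apply_bcontfun F (Fin k))"
  by (rule \<nu>_mult_summable) (rule apply_bounded)

lemma bounded_linear_boundary: "bounded_linear boundary"
proof (rule bounded_linear_intro)
  fix F G :: "state \<Rightarrow>\<^sub>C real" and r :: real
  show "boundary (F + G) = boundary F + boundary G"
    unfolding boundary_def
    by (simp add: plus_bcontfun.rep_eq distrib_left distrib_right suminf_add[OF \<nu>_apply_summable \<nu>_apply_summable, symmetric])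
  show "boundary (r *\<^sub>R F) = r *\<^sub>R boundary F"
    unfolding boundary_def
    by (simp add: scaleR_bcontfun.rep_eq mult.left_commute suminf_mult[OF \<nu>_apply_summable] right_diff_distrib mult.assoc)
  have "\<bar>F Infty * (\<gamma> + mass)\<bar> \<le> norm F * (\<gamma> + mass)"
    unfolding abs_mult using abs_apply_bcontfun_le[of F Infty] \<gamma>_nonneg mass_pos by (intro mult_mono) auto
  moreover have "\<bar>\<Sum>k. \<nu> k * F (Fin k)\<bar> \<le> norm F * mass"
    by (rule \<nu>_suminf_abs_le) (rule apply_bounded)
  ultimately show "norm (boundary F) \<le> norm F * (\<gamma> + mass + mass)"
    unfolding boundary_def distrib_left by (simp add: abs_le_iff)
qed

lemma C_nu_gamma_eq: "C_nu_gamma \<nu> \<gamma> = {F. apply_bcontfun F Cemetery = 0} \<inter> {F. boundary F = 0}"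
proof -
  have "(\<Sum>k. (F Infty - F (Fin k)) * \<nu> k) + \<gamma> * F Infty = boundary F" for F :: "state \<Rightarrow>\<^sub>C real"
  proof -
    have "(\<lambda>k. \<nu> k * F Infty - \<nu> k * F (Fin k)) sums (mass * F Infty - (\<Sum>k. \<nu> k * F (Fin k)))"
      unfolding mass_def by (intro sums_diff sums_mult2 summable_sums \<nu>_summable \<nu>_apply_summable)
    then have "(\<Sum>k. (F Infty - F (Fin k)) * \<nu> k) = mass * F Infty - (\<Sum>k. \<nu> k * F (Fin k))"
      unfolding right_diff_distrib[symmetric] by (simp add: sums_iff mult.commute)
    then show ?thesis unfolding boundary_def by (simp add: distrib_left mult.commute)
  qed
  then show ?thesis by (auto simp: C_nu_gamma_def C_bar_def)
qed

lemma C_nu_gamma_iff: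
  "F \<in> C_nu_gamma \<nu> \<gamma> \<longleftrightarrow> F Cemetery = 0 \<and> constraint (\<lambda>k. F (Fin k)) (F Infty)"
  unfolding C_nu_gamma_eq constraint_def boundary_def using apply_bcontfun_Fin_tendsto by auto

lemma C_nu_gamma_constraint: "F \<in> C_nu_gamma \<nu> \<gamma> \<Longrightarrow> constraint (\<lambda>k. F (Fin k)) (F Infty)"
  by (simp add: C_nu_gamma_iff)

lemma C_nu_gamma_C_bar: "F \<in> C_nu_gamma \<nu> \<gamma> \<Longrightarrow> F \<in> C_bar"
  by (simp add: C_nu_gamma_def)

lemma subspace_C_nu_gamma: "subspace (C_nu_gamma \<nu> \<gamma>)"
  unfolding C_nu_gamma_eq
  by (intro subspace_inter linear_subspace_kernel bounded_linear.linear bounded_linear_apply bounded_linear_boundary)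

lemma complete_C_nu_gamma: "complete (C_nu_gamma \<nu> \<gamma>)"
  unfolding complete_eq_closed C_nu_gamma_eq
  by (intro closed_Int closed_Collect_eq continuous_on_const linear_continuous_on
      bounded_linear_apply bounded_linear_boundary)

lemma extend_state_C_nu_gamma:
  assumes h: "constraint h L"
  shows "apply_bcontfun (Bcontfun (extend_state h)) = extend_state h"
    and "Bcontfun (extend_state h) \<in> C_nu_gamma \<nu> \<gamma>"
proof -
  have "convergent h" using h by (auto simp: constraint_def convergent_def)
  then show eq: "apply_bcontfun (Bcontfun (extend_state h)) = extend_state h"
    by (intro Bcontfun_inverse extend_state_bcontfun)
  have "lim h = L" using h by (simp add: constraint_def limI)
  then show "Bcontfun (extend_state h) \<in> C_nu_gamma \<nu> \<gamma>"
    using h unfolding C_nu_gamma_iff eq by (simp add: extend_state_def)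
qed

text \<open>Q F inherits from y a limit at infinity, so the extension in \<open>L_op\<close> is
  genuine and must agree with y.\<close>

lemma constraint_Q_operator:
  assumes F: "F \<in> C_nu_gamma \<nu> \<gamma>" and y: "y \<in> C_nu_gamma \<nu> \<gamma>"
    and Q: "\<And>k. Q_operator a b (\<lambda>k. F (Fin k)) k = y (Fin k)"
  shows "F \<in> L_domain a b \<nu> \<gamma>" and "L_op a b F = y"
proof -
  have eq: "Q_operator a b (\<lambda>k. F (Fin k)) = (\<lambda>k. y (Fin k))" using Q by blast
  have c: "constraint (\<lambda>k. y (Fin k)) (y Infty)" using y by (rule C_nu_gamma_constraint)
  show L: "L_op a b F = y"
    unfolding L_op_def eq
    by (rule C_bar_eqI) (use extend_state_C_nu_gamma[OF c] y in \<open>auto simp: C_nu_gamma_C_bar extend_state_def\<close>)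
  have "convergent (\<lambda>k. y (Fin k))" using apply_bcontfun_Fin_tendsto by (auto simp: convergent_def)
  then show "F \<in> L_domain a b \<nu> \<gamma>" using F y L eq by (simp add: L_domain_def)
qed

lemma L_domain_Q_operator:
  assumes F: "F \<in> L_domain a b \<nu> \<gamma>"
  shows "Q_operator a b (\<lambda>k. F (Fin k)) k = L_op a b F (Fin k)"
proof -
  have "convergent (Q_operator a b (\<lambda>k. F (Fin k)))" using F by (simp add: L_domain_def)
  then have "apply_bcontfun (L_op a b F) = extend_state (Q_operator a b (\<lambda>k. F (Fin k)))"
    unfolding L_op_def by (intro Bcontfun_inverse extend_state_bcontfun)
  then show ?thesis by (simp add: extend_state_def)
qed

section \<open>The Ray semigroup and its generator\<close>

context
  fixes P assumes ray: "Ray_semigroup p P"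
begin

text \<open>The prescribed value at infinity is fed in as \<psi>. The result says at once that it is
  the limit along N and that the boundary condition persists.\<close>

lemma P_constraint:
  assumes f: "f \<in> C_nu_gamma \<nu> \<gamma>" and t: "t \<ge> 0"
  shows "constraint (trans_op p t (\<lambda>k. f (Fin k))) (P t f Infty)"
proof (rule trans_op_constraint[OF C_nu_gamma_constraint[OF f] t])
  note r = ray[unfolded Ray_semigroup_def, rule_format, OF C_nu_gamma_C_bar[OF f]]
  show "\<exists>d>0. \<forall>s. t \<le> s \<and> s < t + d \<longrightarrow> \<bar>P s f Infty - P t f Infty\<bar> \<le> e" if "e > 0" for e
  proof -
    have "((\<lambda>s. P s f Infty) \<longlongrightarrow> P t f Infty) (at_right t)"
      using r t by (simp add: continuous_within)
    then have "\<forall>\<^sub>F s in at_right t. dist (P s f Infty) (P t f Infty) < e"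
      using that by (rule tendstoD)
    then obtain c where c: "c > t" "\<And>s. t < s \<Longrightarrow> s < c \<Longrightarrow> \<bar>P s f Infty - P t f Infty\<bar> < e"
      unfolding eventually_at_right_field dist_real_def by blast
    have "\<bar>P s f Infty - P t f Infty\<bar> \<le> e" if "t \<le> s \<and> s < t + (c - t)" for s
      using c(2)[of s] that \<open>e > 0\<close> by (cases "s = t") auto
    then show ?thesis using c(1) by (intro exI[of _ "c - t"]) auto
  qed
  show "set_integrable lborel {0..} (\<lambda>s. exp (- s) * P s f Infty)"
    using r[THEN conjunct2, THEN conjunct2, THEN conjunct2, rule_format, of 1] by simp
  show "res_op p \<alpha> (\<lambda>k. f (Fin k)) \<longlonglongrightarrow> laplace (\<lambda>s. P s f Infty) \<alpha>" if "\<alpha> > 0" for \<alpha>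
  proof -
    have "(\<lambda>i. \<Sum>j. resolvent p \<alpha> i j * f (Fin j)) = res_op p \<alpha> (\<lambda>k. f (Fin k))"
      using res_op_sums[OF that apply_bounded[of f]] by (auto simp: sums_iff)
    then show ?thesis using r that unfolding laplace_def by auto
  qed
qed

lemma P_eq_extend_state:
  assumes f: "f \<in> C_nu_gamma \<nu> \<gamma>" and t: "t \<ge> 0"
  shows "P t f = extend_state (trans_op p t (\<lambda>k. f (Fin k)))"
proof
  fix x
  note r = ray[unfolded Ray_semigroup_def, rule_format, OF C_nu_gamma_C_bar[OF f]]
  have "lim (trans_op p t (\<lambda>k. f (Fin k))) = P t f Infty"
    using P_constraint[OF f t] by (simp add: constraint_def limI)
  then show "P t f x = extend_state (trans_op p t (\<lambda>k. f (Fin k))) x"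
    using r t by (cases x) (auto simp: extend_state_def trans_op_def)
qed

lemma P_C_nu_gamma:
  assumes f: "f \<in> C_nu_gamma \<nu> \<gamma>" and t: "t \<ge> 0"
  shows "apply_bcontfun (Bcontfun (P t f)) = P t f"
    and "Bcontfun (P t f) \<in> C_nu_gamma \<nu> \<gamma>"
    and "Bcontfun (P t f) (Fin k) = trans_op p t (\<lambda>k. f (Fin k)) k"
  using extend_state_C_nu_gamma[OF P_constraint[OF f t]]
  unfolding P_eq_extend_state[OF f t] by (simp_all add: extend_state_def)

lemma P_diff_C_nu_gamma:
  assumes f: "f \<in> C_nu_gamma \<nu> \<gamma>" and t: "t \<ge> 0"
  shows "Bcontfun (P t f) - f \<in> C_nu_gamma \<nu> \<gamma>"
  by (intro subspace_diff[OF subspace_C_nu_gamma] P_C_nu_gamma(2) f t)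

lemma strongly_continuous_contraction_semigroup_P:
  "strongly_continuous_contraction_semigroup (C_nu_gamma \<nu> \<gamma>) (\<lambda>t f. Bcontfun (P t f))"
  unfolding strongly_continuous_contraction_semigroup_def
proof (intro conjI allI impI ballI)
  fix s t c :: real and x y :: "state \<Rightarrow>\<^sub>C real"
  assume x: "x \<in> C_nu_gamma \<nu> \<gamma>"
  note X = P_C_nu_gamma(2) C_nu_gamma_C_bar
  show "Bcontfun (P 0 x) = x"
    by (rule C_bar_eqI) (use x in \<open>auto intro!: X simp: P_C_nu_gamma(3) trans_op_0\<close>)
  show "((\<lambda>t. norm (Bcontfun (P t x) - x)) \<longlongrightarrow> 0) (at_right 0)"
  proof (rule tendstoI)
    fix e :: real assume "e > 0"
    then obtain d where d: "d > 0"
      "\<And>t i. 0 \<le> t \<Longrightarrow> t < d \<Longrightarrow> \<bar>trans_op p t (\<lambda>k. x (Fin k)) i - x (Fin i)\<bar> \<le> e / 2"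
      using strong_continuity[OF C_nu_gamma_constraint[OF x], of "e / 2"] by auto
    have "norm (Bcontfun (P t x) - x) \<le> e / 2" if "0 < t" "t < d" for t
      by (rule norm_le_of_Fin[OF C_nu_gamma_C_bar[OF P_diff_C_nu_gamma[OF x]]])
        (use that d(2) in \<open>simp_all add: minus_bcontfun.rep_eq P_C_nu_gamma(3)[OF x]\<close>)
    then show "\<forall>\<^sub>F t in at_right 0. dist (norm (Bcontfun (P t x) - x)) 0 < e"
      using d(1) \<open>e > 0\<close> unfolding eventually_at_right_field by (intro exI[of _ d]) force
  qed
  assume t: "t \<ge> 0"
  show Px: "Bcontfun (P t x) \<in> C_nu_gamma \<nu> \<gamma>" by (rule P_C_nu_gamma(2)[OF x t])
  show "norm (Bcontfun (P t x)) \<le> norm x"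
    by (rule norm_le_of_Fin)
      (use x t Px trans_op_abs_le[OF t apply_bounded] in \<open>auto simp: C_nu_gamma_C_bar P_C_nu_gamma(3)\<close>)
  have cx: "c *\<^sub>R x \<in> C_nu_gamma \<nu> \<gamma>" by (intro subspace_scale[OF subspace_C_nu_gamma] x)
  show "Bcontfun (P t (c *\<^sub>R x)) = c *\<^sub>R Bcontfun (P t x)"
  proof (rule C_bar_eqI)
    show "c *\<^sub>R Bcontfun (P t x) \<in> C_bar"
      by (intro C_nu_gamma_C_bar subspace_scale[OF subspace_C_nu_gamma] Px)
    show "Bcontfun (P t (c *\<^sub>R x)) (Fin k) = (c *\<^sub>R Bcontfun (P t x)) (Fin k)" for k
      using sums_mult[OF trans_op_sums[OF t apply_bounded[of x], of k], of c]
      unfolding scaleR_bcontfun.rep_eq P_C_nu_gamma(3)[OF cx t] P_C_nu_gamma(3)[OF x t]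
      by (simp add: trans_op_def scaleR_bcontfun.rep_eq sums_iff mult.left_commute)
  qed (intro X cx t)
  {
    assume y: "y \<in> C_nu_gamma \<nu> \<gamma>"
    have xy: "x + y \<in> C_nu_gamma \<nu> \<gamma>" by (intro subspace_add[OF subspace_C_nu_gamma] x y)
    show "Bcontfun (P t (x + y)) = Bcontfun (P t x) + Bcontfun (P t y)"
    proof (rule C_bar_eqI)
      show "Bcontfun (P t x) + Bcontfun (P t y) \<in> C_bar"
        by (intro C_nu_gamma_C_bar subspace_add[OF subspace_C_nu_gamma] Px P_C_nu_gamma(2) y t)
      show "Bcontfun (P t (x + y)) (Fin k) = (Bcontfun (P t x) + Bcontfun (P t y)) (Fin k)" for k
        using sums_add[OF trans_op_sums[OF t apply_bounded[of x], of k] trans_op_sums[OF t apply_bounded[of y], of k]]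
        unfolding plus_bcontfun.rep_eq P_C_nu_gamma(3)[OF xy t] P_C_nu_gamma(3)[OF x t] P_C_nu_gamma(3)[OF y t]
        by (simp add: trans_op_def plus_bcontfun.rep_eq sums_iff distrib_left)
    qed (intro X xy t)
  }
  {
    assume s: "s \<ge> 0"
    show "Bcontfun (P (s + t) x) = Bcontfun (P s (Bcontfun (P t x)))"
    proof (rule C_bar_eqI)
      show "Bcontfun (P (s + t) x) (Fin k) = Bcontfun (P s (Bcontfun (P t x))) (Fin k)" for k
        using trans_op_add[OF s t apply_bounded[of x], of k] s t
        by (simp add: P_C_nu_gamma(3)[OF x] P_C_nu_gamma(3)[OF Px])
    qed (use s t in \<open>auto intro!: X x\<close>)
  }
qed

text \<open>F is the resolvent of g = F - Q F. Since Q F lies in the space, so does g, and strong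
  continuity applied to g makes the remainder estimate uniform over N.\<close>

lemma L_domain_derivative:
  assumes F: "F \<in> L_domain a b \<nu> \<gamma>"
  shows "((\<lambda>t. (1 / t) *\<^sub>R (Bcontfun (P t F) - F)) \<longlongrightarrow> L_op a b F) (at_right 0)"
proof (rule tendstoI)
  let ?F = "\<lambda>k. F (Fin k)"
  fix e :: real assume "e > 0"
  have FX: "F \<in> C_nu_gamma \<nu> \<gamma>" and LX: "L_op a b F \<in> C_nu_gamma \<nu> \<gamma>"
    using F by (simp_all add: L_domain_def)
  define g where "g = F - L_op a b F"
  have gX: "g \<in> C_nu_gamma \<nu> \<gamma>" unfolding g_def by (intro subspace_diff[OF subspace_C_nu_gamma] FX LX)
  have gQ: "(\<lambda>k. ?F k - Q_operator a b ?F k) = (\<lambda>k. g (Fin k))"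
    by (simp add: g_def minus_bcontfun.rep_eq L_domain_Q_operator[OF F])
  have Fg: "?F = res_op p 1 (\<lambda>k. g (Fin k))"
    unfolding gQ[symmetric]
  proof (rule constraint_eq_res_op[OF C_nu_gamma_constraint[OF FX]])
    show "\<forall>k. \<bar>?F k - Q_operator a b ?F k\<bar> \<le> norm g"
      using apply_bounded[of g] fun_cong[OF gQ] by simp
  qed
  define C where "C = norm g"
  have C: "\<forall>k. \<bar>g (Fin k)\<bar> \<le> C" unfolding C_def by (rule apply_bounded)
  obtain d where d: "d > 0"
    "\<And>t i. 0 \<le> t \<Longrightarrow> t < d \<Longrightarrow> \<bar>trans_op p t (\<lambda>k. g (Fin k)) i - g (Fin i)\<bar> \<le> e / 4"
    using strong_continuity[OF C_nu_gamma_constraint[OF gX], of "e / 4"] \<open>e > 0\<close> by auto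
  have "((\<lambda>t. 2 * C * (exp t - 1)) \<longlongrightarrow> 2 * C * (exp 0 - 1)) (at_right 0)"
    by (intro tendsto_intros)
  then have "\<forall>\<^sub>F t in at_right 0. 2 * C * (exp t - 1) < e / 4"
    by (rule order_tendstoD) (use \<open>e > 0\<close> in simp)
  moreover have "\<forall>\<^sub>F t in at_right 0. 0 < t \<and> t < d"
    using d(1) by (auto simp: eventually_at_right_field)
  ultimately show "\<forall>\<^sub>F t in at_right 0. dist ((1 / t) *\<^sub>R (Bcontfun (P t F) - F)) (L_op a b F) < e"
  proof eventually_elim
    case (elim t)
    let ?D = "(1 / t) *\<^sub>R (Bcontfun (P t F) - F) - L_op a b F"
    have t: "t \<ge> 0" "t > 0" using elim by auto
    have "norm ?D \<le> e / 2"
    proof (rule norm_le_of_Fin)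
      show "?D \<in> C_bar"
        by (intro C_nu_gamma_C_bar subspace_diff[OF subspace_C_nu_gamma] subspace_scale[OF subspace_C_nu_gamma]
            P_C_nu_gamma(2) FX LX t)
      fix k
      let ?T = "trans_op p t ?F k"
      have "\<bar>?T - ?F k - t * (?F k - g (Fin k))\<bar> \<le> t * (2 * C * (exp t - 1) + e / 4)"
        using trans_op_res_op_estimate[OF t(1) C, where e = "e / 4" and i = k, folded Fg] elim d(2) by auto
      also have "\<dots> \<le> t * (e / 2)" using elim by (intro mult_left_mono) auto
      finally have le: "\<bar>?T - ?F k - t * (?F k - g (Fin k))\<bar> / t \<le> e / 2"
        using t by (simp add: divide_le_eq mult.commute)
      \<comment> \<open>F - g is Q F by the choice of g, so the remainder divided by t is the error
        of the difference quotient.\<close>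
      have "?D (Fin k) = (?T - ?F k - t * (?F k - g (Fin k))) / t"
        using t by (simp add: minus_bcontfun.rep_eq scaleR_bcontfun.rep_eq P_C_nu_gamma(3)[OF FX] g_def field_simps)
      then show "\<bar>?D (Fin k)\<bar> \<le> e / 2" using le t by simp
    qed
    then show ?case using \<open>e > 0\<close> by (simp add: dist_norm)
  qed
qed

text \<open>For the inclusion of the generator's domain, convergence in norm implies convergence at
  each k, where the limit is already known to be Q F(k). Hence Q F coincides on N with the limit y,
  an element of the space.\<close>

lemma infinitesimal_generator_P:
  "infinitesimal_generator (C_nu_gamma \<nu> \<gamma>) (\<lambda>t f. Bcontfun (P t f)) (L_domain a b \<nu> \<gamma>) (L_op a b)"
  unfolding infinitesimal_generator_def
proof (intro conjI set_eqI iffI ballI)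
  fix F assume F: "F \<in> L_domain a b \<nu> \<gamma>"
  show "((\<lambda>t. (1 / t) *\<^sub>R (Bcontfun (P t F) - F)) \<longlongrightarrow> L_op a b F) (at_right 0)"
    by (rule L_domain_derivative[OF F])
  then show "F \<in> {x \<in> C_nu_gamma \<nu> \<gamma>. \<exists>y\<in>C_nu_gamma \<nu> \<gamma>.
      ((\<lambda>t. (1 / t) *\<^sub>R (Bcontfun (P t x) - x)) \<longlongrightarrow> y) (at_right 0)}"
    using F by (auto simp: L_domain_def)
next
  fix F
  assume "F \<in> {x \<in> C_nu_gamma \<nu> \<gamma>. \<exists>y\<in>C_nu_gamma \<nu> \<gamma>.
      ((\<lambda>t. (1 / t) *\<^sub>R (Bcontfun (P t x) - x)) \<longlongrightarrow> y) (at_right 0)}"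
  then obtain y where FX: "F \<in> C_nu_gamma \<nu> \<gamma>" and y: "y \<in> C_nu_gamma \<nu> \<gamma>"
    and lim: "((\<lambda>t. (1 / t) *\<^sub>R (Bcontfun (P t F) - F)) \<longlongrightarrow> y) (at_right 0)"
    by blast
  have "Q_operator a b (\<lambda>k. F (Fin k)) k = y (Fin k)" for k
  proof (rule tendsto_unique[OF _ Q_process_generator[OF Q_process_p a0 apply_bounded[of F]]])
    have "((\<lambda>t. ((1 / t) *\<^sub>R (Bcontfun (P t F) - F)) (Fin k)) \<longlongrightarrow> y (Fin k)) (at_right 0)"
      by (rule bounded_linear.tendsto[OF bounded_linear_apply lim])
    moreover have "\<forall>\<^sub>F t in at_right 0. ((1 / t) *\<^sub>R (Bcontfun (P t F) - F)) (Fin k) =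
        (trans_op p t (\<lambda>k. F (Fin k)) k - F (Fin k)) / t"
      unfolding eventually_at_right_field
      by (intro exI[of _ 1])
        (simp add: minus_bcontfun.rep_eq scaleR_bcontfun.rep_eq P_C_nu_gamma(3)[OF FX])
    ultimately show "((\<lambda>t. (trans_op p t (\<lambda>k. F (Fin k)) k - F (Fin k)) / t) \<longlongrightarrow> y (Fin k)) (at_right 0)"
      by (rule Lim_transform_eventually)
  qed simp
  then show "F \<in> L_domain a b \<nu> \<gamma>" by (rule constraint_Q_operator(1)[OF FX y])
qed

end

end

theorem theorem4p2:
  fixes a b \<nu> :: "nat \<Rightarrow> real"
    and \<gamma> :: real
    and pmin p :: "real \<Rightarrow> nat \<Rightarrow> nat \<Rightarrow> real"
    and P :: "real \<Rightarrow> (state \<Rightarrow>\<^sub>C real) \<Rightarrow> state \<Rightarrow> real"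
  assumes "birth_death a b"
    and "regular_boundary a b \<or> exit_boundary a b"
    and "minimal_Q_process a b pmin"
    and "(\<gamma>, 0, \<nu>) \<in> Doob_triples a b"
    and "determined_by a b pmin (\<gamma>, 0, \<nu>) p"
    and "Ray_semigroup p P"
  shows "subspace (C_nu_gamma \<nu> \<gamma>) \<and> complete (C_nu_gamma \<nu> \<gamma>) \<and>
    (\<forall>t\<ge>0. \<forall>f\<in>C_nu_gamma \<nu> \<gamma>. P t f \<in> apply_bcontfun ` C_nu_gamma \<nu> \<gamma>) \<and>
    strongly_continuous_contraction_semigroup (C_nu_gamma \<nu> \<gamma>) (\<lambda>t f. Bcontfun (P t f)) \<and>
    infinitesimal_generator (C_nu_gamma \<nu> \<gamma>) (\<lambda>t f. Bcontfun (P t f))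
      (L_domain a b \<nu> \<gamma>) (L_op a b)"
proof -
  \<comment> \<open>Regular and exit boundaries share the finiteness of R, from which all vanishing
    at infinity is derived.\<close>
  have "R_series a b < \<infinity>"
    using assms(2) by (auto simp: regular_boundary_def exit_boundary_def)
  then interpret doob_process a b \<nu> \<gamma> pmin p
    by unfold_locales (use assms in auto)
  note ray = assms(6)
  have "P t f \<in> apply_bcontfun ` C_nu_gamma \<nu> \<gamma>" if "t \<ge> 0" "f \<in> C_nu_gamma \<nu> \<gamma>" for t f
    using P_C_nu_gamma(1,2)[OF ray that(2,1)] by (metis image_eqI)
  then show ?thesis
    using subspace_C_nu_gamma complete_C_nu_gamma
      strongly_continuous_contraction_semigroup_P[OF ray] infinitesimal_generator_P[OF ray]
    by blast
qed

end
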